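(* Let $p>1$, let $\lambda^+,\lambda^-$ be nonnegative finite Borel measures on $M$ of equal mass, and $\lambda=\lambda^+-\lambda^-$. Then $$W_1(\lambda)=\lim_{n\to\infty}\ n\min_{\mu\in\mathcal{M}_1^+}W_p\left(\mu+\lambda^+/n,\ \mu+\lambda^-/n\right).$$
   Context: $(M,g)$ is a compact Riemannian manifold (without boundary) with geodesic distance $D:M\times M\to[0,\infty)$, and $\mathcal{M}_1^+$ is the set of Borel probability measures on $M$. For $p\ge1$ and nonnegative finite Borel measures $\mu_1,\mu_2$ on $M$ of equal mass, $$W_p(\mu_1,\mu_2)=\min_{\Lambda}\left[\int_{M\times M}D^p(x,y)\,d\Lambda(x,y)\right]^{1/p},$$ the minimum being over all nonnegative Borel measures $\Lambda$ on $M\times M$ with first marginal $\mu_1$ and second marginal $\mu_2$. $W_1(\lambda)$ denotes $W_1(\lambda^+,\lambda^-)$, which depends only on the difference $\lambda=\lambda^+-\lambda^-$. *)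

theory Defs
  imports "HOL-Analysis.Analysis"
begin

section \<open>Smooth maps on open sets\<close>

primrec Ck_on ::
  "nat \<Rightarrow> ('a::real_normed_vector \<Rightarrow> 'b::real_normed_vector) \<Rightarrow> 'a set \<Rightarrow> bool" where
  "Ck_on 0 f S \<longleftrightarrow> continuous_on S f"
| "Ck_on (Suc k) f S \<longleftrightarrow>
     (\<forall>x\<in>S. f differentiable (at x)) \<and>
     (\<forall>v. Ck_on k (\<lambda>x. frechet_derivative f (at x) v) S)"

text \<open>This is meant for open \<open>S\<close> only: the derivatives are the unrestricted ones, which on an open
  set do not depend on the values of \<open>f\<close> outside \<open>S\<close>.\<close>

definition smooth_on ::
  "('a::real_normed_vector \<Rightarrow> 'b::real_normed_vector) \<Rightarrow> 'a set \<Rightarrow> bool" where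
  "smooth_on f S \<longleftrightarrow> (\<forall>k. Ck_on k f S)"

section \<open>Riemannian manifolds\<close>

text \<open>The manifold is the whole type \<open>'m\<close>, with its topology; a chart is a pair of an open domain
  and a coordinate map to the model space \<open>'e\<close>. Second countability and the Hausdorff property are
  sort constraints. A coordinate map is arbitrary outside its domain. As charts have open image
  in \<open>'e\<close>, there is no boundary.\<close>

type_synonym ('m, 'e) chart = "'m set \<times> ('m \<Rightarrow> 'e)"

definition is_chart ::
  "('m::{t2_space, second_countable_topology}, 'e::euclidean_space) chart \<Rightarrow> bool" where
  "is_chart c \<longleftrightarrow> (case c of (U, \<phi>) \<Rightarrow>
     open U \<and> open (\<phi> ` U) \<and> homeomorphism U (\<phi> ` U) \<phi> (inv_into U \<phi>))"

definition smooth_atlas ::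
  "('m::{t2_space, second_countable_topology}, 'e::euclidean_space) chart set \<Rightarrow> bool" where
  "smooth_atlas A \<longleftrightarrow>
     (\<forall>c\<in>A. is_chart c) \<and> (\<Union>c\<in>A. fst c) = UNIV \<and>
     (\<forall>(U, \<phi>)\<in>A. \<forall>(V, \<psi>)\<in>A. smooth_on (\<psi> \<circ> inv_into U \<phi>) (\<phi> ` (U \<inter> V)))"

text \<open>A metric tensor is given by its coordinate expressions: \<open>g c x\<close> is the inner product on the
  tangent space at \<open>x\<close>, identified with \<open>'e\<close> by means of the chart \<open>c\<close>. The last clause is the
  transformation law of a covariant 2-tensor.\<close>

definition riemannian_metric ::
  "('m::{t2_space, second_countable_topology}, 'e::euclidean_space) chart set \<Rightarrow>
   (('m, 'e) chart \<Rightarrow> 'm \<Rightarrow> 'e \<Rightarrow> 'e \<Rightarrow> real) \<Rightarrow> bool" where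
  "riemannian_metric A g \<longleftrightarrow>
     (\<forall>c\<in>A. \<forall>x\<in>fst c. bilinear (g c x) \<and> (\<forall>u v. g c x u v = g c x v u) \<and>
        (\<forall>v. v \<noteq> 0 \<longrightarrow> g c x v v > 0)) \<and>
     (\<forall>(U, \<phi>)\<in>A. \<forall>u v. smooth_on (\<lambda>z. g (U, \<phi>) (inv_into U \<phi> z) u v) (\<phi> ` U)) \<and>
     (\<forall>(U, \<phi>)\<in>A. \<forall>(V, \<psi>)\<in>A. \<forall>x\<in>U \<inter> V. \<forall>u v.
        let J = frechet_derivative (\<psi> \<circ> inv_into U \<phi>) (at (\<phi> x))
        in g (U, \<phi>) x u v = g (V, \<psi>) x (J u) (J v))"

text \<open>Connectedness is what makes the geodesic distance finite for all pairs of points.\<close>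

definition compact_riemannian_manifold ::
  "('m::{t2_space, second_countable_topology}, 'e::euclidean_space) chart set \<Rightarrow>
   (('m, 'e) chart \<Rightarrow> 'm \<Rightarrow> 'e \<Rightarrow> 'e \<Rightarrow> real) \<Rightarrow> bool" where
  "compact_riemannian_manifold A g \<longleftrightarrow>
     compact (UNIV :: 'm set) \<and> connected (UNIV :: 'm set) \<and>
     smooth_atlas A \<and> riemannian_metric A g"

section \<open>Geodesic distance\<close>

definition C1_curve_on ::
  "('m::{t2_space, second_countable_topology}, 'e::euclidean_space) chart set \<Rightarrow>
   (real \<Rightarrow> 'm) \<Rightarrow> real \<Rightarrow> real \<Rightarrow> bool" where
  "C1_curve_on A \<gamma> a b \<longleftrightarrow> continuous_on {a..b} \<gamma> \<and>
     (\<forall>(U, \<phi>)\<in>A. \<exists>v. continuous_on {t\<in>{a..b}. \<gamma> t \<in> U} v \<and>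
        (\<forall>t\<in>{a..b}. \<gamma> t \<in> U \<longrightarrow>
           ((\<phi> \<circ> \<gamma>) has_vector_derivative v t) (at t within {a..b})))"

text \<open>Unlike for the library's \<^const>\<open>piecewise_C1_differentiable_on\<close>, each piece is continuously
  differentiable up to its end points, so that the speed is bounded and the length finite.\<close>

definition piecewise_C1_curve ::
  "('m::{t2_space, second_countable_topology}, 'e::euclidean_space) chart set \<Rightarrow>
   (real \<Rightarrow> 'm) \<Rightarrow> bool" where
  "piecewise_C1_curve A \<gamma> \<longleftrightarrow>
     (\<exists>(k::nat) \<tau>. \<tau> 0 = 0 \<and> \<tau> k = 1 \<and>
        (\<forall>i<k. \<tau> i < \<tau> (Suc i) \<and> C1_curve_on A \<gamma> (\<tau> i) (\<tau> (Suc i))))"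

text \<open>By the transformation law of \<open>g\<close>, the speed does not depend on the chosen chart. The finitely
  many times at which \<open>\<gamma>\<close> has no two-sided derivative do not contribute to the length.\<close>

definition curve_speed ::
  "('m::{t2_space, second_countable_topology}, 'e::euclidean_space) chart set \<Rightarrow>
   (('m, 'e) chart \<Rightarrow> 'm \<Rightarrow> 'e \<Rightarrow> 'e \<Rightarrow> real) \<Rightarrow> (real \<Rightarrow> 'm) \<Rightarrow> real \<Rightarrow> real" where
  "curve_speed A g \<gamma> t =
     (let c = (SOME c. c \<in> A \<and> \<gamma> t \<in> fst c);
          v = vector_derivative (snd c \<circ> \<gamma>) (at t)
      in sqrt (g c (\<gamma> t) v v))"

definition curve_length ::
  "('m::{t2_space, second_countable_topology}, 'e::euclidean_space) chart set \<Rightarrow>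
   (('m, 'e) chart \<Rightarrow> 'm \<Rightarrow> 'e \<Rightarrow> 'e \<Rightarrow> real) \<Rightarrow> (real \<Rightarrow> 'm) \<Rightarrow> real" where
  "curve_length A g \<gamma> = integral {0..1} (curve_speed A g \<gamma>)"

definition geodesic_dist ::
  "('m::{t2_space, second_countable_topology}, 'e::euclidean_space) chart set \<Rightarrow>
   (('m, 'e) chart \<Rightarrow> 'm \<Rightarrow> 'e \<Rightarrow> 'e \<Rightarrow> real) \<Rightarrow> 'm \<Rightarrow> 'm \<Rightarrow> real" where
  "geodesic_dist A g x y =
     Inf {curve_length A g \<gamma> | \<gamma>. piecewise_C1_curve A \<gamma> \<and> \<gamma> 0 = x \<and> \<gamma> 1 = y}"

section \<open>Borel measures and Wasserstein distances\<close>

definition finite_borel_measure :: "'m::topological_space measure \<Rightarrow> bool" where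
  "finite_borel_measure \<mu> \<longleftrightarrow> sets \<mu> = sets borel \<and> finite_measure \<mu>"

definition borel_prob_measures :: "'m::topological_space measure set" where
  "borel_prob_measures = {\<mu>. finite_borel_measure \<mu> \<and> emeasure \<mu> UNIV = 1}"

text \<open>The sum of two measures on the same measurable space (the lattice operation
  \<^const>\<open>sup\<close> on measures is something else).\<close>

definition add_measure :: "'a measure \<Rightarrow> 'a measure \<Rightarrow> 'a measure" where
  "add_measure \<mu> \<nu> = measure_of (space \<mu>) (sets \<mu>) (\<lambda>X. emeasure \<mu> X + emeasure \<nu> X)"

lemma sets_add_measure [simp]: "sets (add_measure \<mu> \<nu>) = sets \<mu>"
  by (simp add: add_measure_def)

lemma space_add_measure [simp]: "space (add_measure \<mu> \<nu>) = space \<mu>"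
  by (simp add: add_measure_def space_measure_of_conv)

lemma emeasure_add_measure:
  assumes "sets \<nu> = sets \<mu>" and "X \<in> sets \<mu>"
  shows "emeasure (add_measure \<mu> \<nu>) X = emeasure \<mu> X + emeasure \<nu> X"
proof (rule emeasure_measure_of[OF add_measure_def])
  show "countably_additive (sets (add_measure \<mu> \<nu>)) (\<lambda>X. emeasure \<mu> X + emeasure \<nu> X)"
    unfolding countably_additive_def sets_add_measure
    using assms(1) by (auto simp: suminf_add[symmetric] suminf_emeasure)
qed (use assms in \<open>auto simp: positive_def dest: sets.sets_into_space\<close>)

text \<open>As \<open>'m\<close> is second countable, the Borel sets of \<open>'m \<times> 'm\<close> are those of the product
  \<open>\<sigma>\<close>-algebra.\<close>

definition couplings ::
  "'m::second_countable_topology measure \<Rightarrow> 'm measure \<Rightarrow> ('m \<times> 'm) measure set" where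
  "couplings \<mu>1 \<mu>2 =
     {\<Lambda>. sets \<Lambda> = sets borel \<and> distr \<Lambda> borel fst = \<mu>1 \<and> distr \<Lambda> borel snd = \<mu>2}"

text \<open>\<open>LEAST c. c \<in> S\<close> is the minimum of \<open>S\<close>; it carries information only if this is attained.\<close>

definition wasserstein ::
  "('m::second_countable_topology \<Rightarrow> 'm \<Rightarrow> real) \<Rightarrow> real \<Rightarrow> 'm measure \<Rightarrow> 'm measure \<Rightarrow> real" where
  "wasserstein D p \<mu>1 \<mu>2 =
     (LEAST c. c \<in> (\<lambda>\<Lambda>. (\<integral>(x, y). D x y powr p \<partial>\<Lambda>) powr (1 / p)) ` couplings \<mu>1 \<mu>2)"

end

theory Submission
  imports "HOL-Probability.Helly_Selection" "HOL-Probability.Giry_Monad" Defs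
begin

text \<open>
Write \<open>D\<close> for the geodesic distance, \<open>m\<close> for the common mass of \<open>\<lambda>\<^sup>+\<close> and \<open>\<lambda>\<^sup>-\<close>, and \<open>W\<^sub>1\<close> for their
distance with exponent 1. A background measure \<open>\<mu>\<close> of mass 1 lets the mass \<open>m/n\<close> travel
as a relay: each portion pushes the background mass in front of it by one short step. For \<open>p > 1\<close>
this is the cheap way of moving mass, and it costs what \<open>W\<^sub>1\<close> charges.

Lower bound. By Jensen's inequality \<open>W\<^sub>p\<close> dominates \<open>W\<^sub>1\<close> up to the factor \<open>(1 + m/n)\<close> to the power
\<open>1 - 1/p\<close> (\<open>cost_1_le_cost\<close>), and \<open>W\<^sub>1\<close> does not become smaller if the same measure is added on both
sides (\<open>wasserstein_1_le_shifted_cost\<close>). For a finitely supported measure the latter is rerouting in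
a network: the flow entering a point is matched with the flow leaving it, and the triangle inequality
makes the shortcut at most as long (\<open>flow_cancel\<close>). General measures are pushed to a fine finite
partition, and the resulting finite plan is lifted back by a piecewise constant density with respect
to the product measure (\<open>coupling_with_cells\<close>).

Upper bound. Let \<open>H > W\<^sub>1\<close>. Take an optimal plan for \<open>W\<^sub>1\<close> and subdivide the way from \<open>x\<close> to \<open>y\<close> into
about \<open>n D(x,y) / H\<close> steps of length about \<open>H/n\<close>. Place on the intermediate points the background
mass, \<open>1/n\<close> times the plan; its total is about \<open>W\<^sub>1/H < 1\<close>, and the rest may sit anywhere. Now every
step has length about \<open>H/n\<close> and the moved mass is at most \<open>1 + m/n\<close>, so that \<open>n W\<^sub>p\<close> is at most
about \<open>H\<close> (\<open>shift_along_chains\<close>, \<open>wasserstein_shift_upper_bound\<close>). The intermediate points have to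
depend measurably on \<open>(x,y)\<close>; they are chosen between the centres of a partition so fine
that the way to a centre is itself at most one step.

All minima are attained by weak compactness of the Borel measures of a given mass on a compact space
(\<open>weakly_convergent_subsequence\<close>). Compactness is reduced to Helly's selection theorem on the real line by a
Borel code: a map from the space to the line through which every continuous function factors
continuously (\<open>real_code\<close>).

The geometry enters through three facts: \<open>D\<close> is continuous, it satisfies the triangle inequality, and
two points are joined by chains of \<open>k\<close> steps of length about \<open>D(x,y)/k\<close> (\<open>length_quasimetric\<close>).
They follow from the definition of \<open>D\<close> as an infimum of lengths of curves: curves can be joined and cut at
points of equal arc length, and in a chart straight segments are short.
\<close>

section \<open>Weak compactness of Borel measures on compact spaces\<close>

lemma Hausdorff_space_euclidean_t2: "Hausdorff_space (euclidean :: 'a::t2_space topology)"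
  unfolding Hausdorff_space_def disjnt_def by (metis hausdorff open_openin)

lemma countable_base_sequence:
  obtains B :: "nat \<Rightarrow> 'a::second_countable_topology set"
  where "\<And>i. open (B i)" "\<And>U x. open U \<Longrightarrow> x \<in> U \<Longrightarrow> \<exists>i. x \<in> B i \<and> B i \<subseteq> U"
proof -
  obtain \<B> :: "'a set set" where \<B>: "countable \<B>" "topological_basis \<B>"
    using ex_countable_basis by metis
  have ne: "\<B> \<noteq> {}"
    using topological_basisE[OF \<B>(2) open_UNIV UNIV_I] by blast
  show ?thesis
  proof (rule that[of "from_nat_into \<B>"])
    show "open (from_nat_into \<B> i)" for i
      using from_nat_into[OF ne] \<B>(2) topological_basis_open by metis
    show "\<exists>i. x \<in> from_nat_into \<B> i \<and> from_nat_into \<B> i \<subseteq> U" if U: "open U" "x \<in> U" for U x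
    proof -
      obtain V where V: "V \<in> \<B>" "x \<in> V" "V \<subseteq> U" using topological_basisE[OF \<B>(2) U] .
      obtain i where "from_nat_into \<B> i = V" using from_nat_into_surj[OF \<B>(1) V(1)] by blast
      then show ?thesis using V by blast
    qed
  qed
qed

text \<open>By regularity \<open>U\<close> is the union of the basic open sets \<open>B i\<close> with closure inside \<open>U\<close>. The sum of the
Urysohn functions of these, with weights \<open>(1/2)^i\<close>, is positive exactly on \<open>U\<close>.\<close>

lemma open_eq_positivity_set:
  fixes U :: "'a::{t2_space, second_countable_topology} set"
  assumes "compact (UNIV :: 'a set)" "open U"
  obtains f :: "'a \<Rightarrow> real" where "continuous_on UNIV f" "\<And>x. 0 \<le> f x" "U = {x. f x > 0}"
proof -
  have norm: "normal_space (euclidean :: 'a topology)"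
    using assms(1) by (intro compact_Hausdorff_or_regular_imp_normal_space) (auto simp: compact_space_def Hausdorff_space_euclidean_t2)
  obtain B :: "nat \<Rightarrow> 'a set" where B: "\<And>n. open (B n)"
      "\<And>U x. open U \<Longrightarrow> x \<in> U \<Longrightarrow> \<exists>i. x \<in> B i \<and> B i \<subseteq> U"
    using countable_base_sequence by metis
  define Q where "Q i f \<longleftrightarrow> continuous_on UNIV f \<and> range f \<subseteq> {0..1::real} \<and> (\<forall>x. x \<notin> U \<longrightarrow> f x = 0) \<and>
      (closure (B i) \<subseteq> U \<longrightarrow> (\<forall>x\<in>B i. f x = 1))" for i f
  have exQ: "\<exists>f. Q i f" for i
  proof (cases "closure (B i) \<subseteq> U")
    case True
    obtain f where f: "continuous_map euclidean (top_of_set {0..1::real}) f"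
        "f ` (- U) \<subseteq> {0}" "f ` closure (B i) \<subseteq> {1}"
      using Urysohn_lemma[OF norm, of "- U" "closure (B i)" 0 1] True assms(2)
      by (auto simp: disjnt_def)
    have "continuous_on UNIV f" "range f \<subseteq> {0..1}"
      using f(1) by (auto simp: continuous_map_in_subtopology)
    moreover have "\<forall>x. x \<notin> U \<longrightarrow> f x = 0" using f(2) by blast
    moreover have "\<forall>x\<in>B i. f x = 1" using f(3) closure_subset[of "B i"] by blast
    ultimately show ?thesis unfolding Q_def by blast
  qed (auto intro!: exI[of _ "\<lambda>_. 0"] simp: Q_def)
  obtain f where "\<And>i. Q i (f i)" using exQ by metis
  then have f: "\<And>i. continuous_on UNIV (f i)" "\<And>i. range (f i) \<subseteq> {0..1::real}"
      "\<And>i x. x \<notin> U \<Longrightarrow> f i x = 0" "\<And>i x. closure (B i) \<subseteq> U \<Longrightarrow> x \<in> B i \<Longrightarrow> f i x = 1"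
    unfolding Q_def by blast+
  have f01: "0 \<le> f i x" "f i x \<le> 1" for i x
    using subsetD[OF f(2)[of i] rangeI[of "f i" x]] by auto
  define F where "F x = (\<Sum>i. (1/2)^i * f i x)" for x
  have sm: "summable (\<lambda>i. (1/2)^i * f i x)" for x
    by (rule summable_comparison_test'[of "\<lambda>i. (1/2)^i"]) (auto simp: f01 mult_le_one)
  have lim: "uniform_limit UNIV (\<lambda>n x. \<Sum>i<n. (1/2)^i * f i x) F sequentially"
    unfolding F_def
    by (rule Weierstrass_m_test[of _ _ "\<lambda>i. (1/2)^i"]) (auto simp: f01 mult_le_one)
  have cont: "continuous_on UNIV F"
    by (rule uniform_limit_theorem[OF _ lim])
       (auto intro!: continuous_on_sum continuous_on_mult continuous_on_const f(1) always_eventually)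
  have "F x > 0" if xU: "x \<in> U" for x
  proof -
    obtain V where V: "open V" "x \<in> V" "closure V \<subseteq> U"
    proof -
      have "regular_space (euclidean :: 'a topology)"
        by (intro normal_t1_imp_regular_space norm Hausdorff_imp_t1_space Hausdorff_space_euclidean_t2)
      then obtain V K where "openin euclidean V" "closedin euclidean K" "x \<in> V" "V \<subseteq> K" "K \<subseteq> U"
        using assms(2) xU unfolding neighbourhood_base_of_closedin[symmetric] neighbourhood_base_of
        by (metis open_openin)
      then show ?thesis using that[of V] closure_minimal[of V K] by auto
    qed
    obtain i where i: "x \<in> B i" "B i \<subseteq> V" using B(2)[OF V(1,2)] by blast
    then have "f i x = 1" using V(3) closure_mono[of "B i" V] f(4) by blast
    then show ?thesis unfolding F_def
      using sm f01 by (intro suminf_pos2[of _ i]) auto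
  qed
  moreover have "F x = 0" if "x \<notin> U" for x using f(3)[OF that] by (simp add: F_def)
  moreover have "0 \<le> F x" for x unfolding F_def by (intro suminf_nonneg sm) (simp add: f01)
  ultimately show ?thesis using that[OF cont] by fastforce
qed

lemma compact_UNIV_continuous_bounded:
  fixes f :: "'a::topological_space \<Rightarrow> real"
  assumes "compact (UNIV :: 'a set)" "continuous_on UNIV f"
  obtains B where "0 < B" "\<And>x. \<bar>f x\<bar> \<le> B"
  using compact_imp_bounded[OF compact_continuous_image[OF assms(2,1)]]
  unfolding bounded_pos by auto

lemma integrable_continuous_finite_borel:
  fixes f :: "'a::topological_space \<Rightarrow> real" and M :: "'a measure"
  assumes "compact (UNIV :: 'a set)" "continuous_on UNIV f" "finite_borel_measure M"
  shows "integrable M f"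
proof -
  obtain B where B: "\<And>x. \<bar>f x\<bar> \<le> B" using compact_UNIV_continuous_bounded[OF assms(1,2)] by blast
  interpret finite_measure M using assms(3) by (simp add: finite_borel_measure_def)
  have "f \<in> borel_measurable M"
    using borel_measurable_continuous_onI[OF assms(2)] assms(3)
    by (simp add: finite_borel_measure_def cong: measurable_cong_sets)
  then show ?thesis using B by (intro integrable_const_bound[where B=B]) auto
qed

text \<open>The functions \<open>min 1 (k * f)\<close> increase to the indicator of \<open>{x. f x > 0}\<close>, and every open set has this
form, so the integrals of continuous functions determine the measures of open sets.\<close>

lemma finite_borel_measure_eqI:
  fixes M N :: "'a::{t2_space, second_countable_topology} measure"
  assumes "compact (UNIV :: 'a set)" and M: "finite_borel_measure M" and N: "finite_borel_measure N"
    and eq: "\<And>f :: 'a \<Rightarrow> real. continuous_on UNIV f \<Longrightarrow> (\<integral>x. f x \<partial>M) = (\<integral>x. f x \<partial>N)"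
  shows "M = N"
proof -
  have emeq: "emeasure M U = emeasure N U" if U: "open U" for U
  proof -
    obtain f :: "'a \<Rightarrow> real" where f: "continuous_on UNIV f" "\<And>x. 0 \<le> f x" "U = {x. f x > 0}"
      using open_eq_positivity_set[OF assms(1) U] by metis
    have lim: "(\<lambda>k. \<integral>x. min 1 (real k * f x) \<partial>L) \<longlonglongrightarrow> measure L U"
      if L: "finite_borel_measure L" for L
    proof -
      interpret finite_measure L using L by (simp add: finite_borel_measure_def)
      have [measurable_cong]: "sets L = sets borel" using L by (simp add: finite_borel_measure_def)
      have [measurable]: "f \<in> borel_measurable borel" "U \<in> sets borel"
        using borel_measurable_continuous_onI[OF f(1)] U by auto
      have "(\<lambda>k. \<integral>x. min 1 (real k * f x) \<partial>L) \<longlonglongrightarrow> (\<integral>x. indicator U x \<partial>L)"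
      proof (rule integral_dominated_convergence[where w="\<lambda>_. 1"])
        show "AE x in L. (\<lambda>k. min 1 (real k * f x)) \<longlonglongrightarrow> indicator U x"
        proof (rule AE_I2)
          fix x
          show "(\<lambda>k. min 1 (real k * f x)) \<longlonglongrightarrow> indicator U x"
          proof (cases "f x > 0")
            case True
            obtain k0 where "1 < real k0 * f x" using reals_Archimedean3[OF True] by blast
            have "min 1 (real k * f x) = 1" if "k \<ge> k0" for k
            proof -
              have "real k0 * f x \<le> real k * f x" using that f(2) by (intro mult_right_mono) auto
              then show ?thesis using \<open>1 < real k0 * f x\<close> by linarith
            qed
            then have "eventually (\<lambda>k. min 1 (real k * f x) = 1) sequentially"
              unfolding eventually_sequentially by blast
            then show ?thesis using True f(3) by (auto intro: tendsto_eventually)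
          next
            case False
            then have "f x = 0" using f(2)[of x] by simp
            then show ?thesis using f(3) by simp
          qed
        qed
        show "AE x in L. norm (min 1 (real k * f x)) \<le> 1" for k
          using f(2) by (auto simp: abs_le_iff intro!: order.trans[of _ 0])
      qed auto
      then show ?thesis by (simp add: sets_eq_imp_space_eq[OF \<open>sets L = sets borel\<close>])
    qed
    have "(\<integral>x. min 1 (real k * f x) \<partial>M) = (\<integral>x. min 1 (real k * f x) \<partial>N)" for k
      by (intro eq continuous_on_min continuous_on_mult continuous_on_const f(1))
    then have "measure M U = measure N U" using lim[OF M] lim[OF N] LIMSEQ_unique by force
    then show ?thesis using M N
      by (simp add: finite_borel_measure_def finite_measure.emeasure_eq_measure)
  qed
  show ?thesis
  proof (rule measure_eqI_generator_eq[where E="{U. open U}" and \<Omega>=UNIV and A="\<lambda>_. UNIV"])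
    show "Int_stable {U :: 'a set. open U}" by (auto simp: Int_stable_def)
    show "sets M = sigma_sets UNIV {U. open U}" "sets N = sigma_sets UNIV {U. open U}"
      using M N by (simp_all add: finite_borel_measure_def borel_def)
    show "emeasure M X = emeasure N X" if "X \<in> {U. open U}" for X using emeq that by simp
    show "{U. open U} \<subseteq> Pow (UNIV :: 'a set)" by simp
    show "range (\<lambda>_. UNIV) \<subseteq> {U :: 'a set. open U}" by simp
    show "(\<Union>i::nat. UNIV) = (UNIV :: 'a set)" by simp
    show "emeasure M UNIV \<noteq> \<infinity>" for i :: nat
      by (metis M finite_borel_measure_def finite_measure.emeasure_finite infinity_ennreal_def)
  qed
qed

text \<open>The closure in the second condition makes the separation stable under limits: a sequence that
is frequently in \<open>B i\<close> cannot converge to \<open>y\<close>.\<close>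

lemma separating_base:
  obtains B :: "nat \<Rightarrow> 'a::{t2_space, second_countable_topology} set"
  where "\<And>i. open (B i)" "\<And>x y. x \<noteq> y \<Longrightarrow> \<exists>i. x \<in> B i \<and> y \<notin> closure (B i)"
proof -
  obtain B :: "nat \<Rightarrow> 'a set" where B: "\<And>n. open (B n)"
      "\<And>U x. open U \<Longrightarrow> x \<in> U \<Longrightarrow> \<exists>i. x \<in> B i \<and> B i \<subseteq> U"
    using countable_base_sequence by metis
  have "\<exists>i. x \<in> B i \<and> y \<notin> closure (B i)" if "x \<noteq> y" for x y
  proof -
    obtain U V where UV: "open U" "open V" "x \<in> U" "y \<in> V" "U \<inter> V = {}"
      using hausdorff[OF \<open>x \<noteq> y\<close>] by blast
    obtain i where i: "x \<in> B i" "B i \<subseteq> U" using B(2)[OF UV(1,3)] by blast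
    then have "closure (B i) \<subseteq> - V" using UV by (intro closure_minimal) auto
    then show ?thesis using i UV(4) by blast
  qed
  then show ?thesis using that B(1) by blast
qed

text \<open>In base 3 with digits 0 and 1 there is no carry: the first digit that differs outweighs the whole
tail. Hence numbers that are close have the same leading digits.\<close>

lemma geometric_digits_gap:
  fixes b c :: "nat \<Rightarrow> real"
  assumes b: "\<And>i. b i \<in> {0, 1}" and c: "\<And>i. c i \<in> {0, 1}" and "b j \<noteq> c j"
  shows "\<bar>(\<Sum>i. b i * (1/3)^i) - (\<Sum>i. c i * (1/3)^i)\<bar> \<ge> (1/3)^j / 2"
proof -
  \<comment> \<open>the first digit that differs\<close>
  define k where "k = (LEAST i. b i \<noteq> c i)"
  have k: "b k \<noteq> c k" unfolding k_def by (rule LeastI[of _ j]) (rule assms)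
  have kmin: "b i = c i" if "i < k" for i using not_less_Least that unfolding k_def by blast
  have kj: "k \<le> j" unfolding k_def by (rule Least_le) (rule assms)
  define d where "d i = (b i - c i) * (1/3)^i" for i
  have bd: "\<bar>b i - c i\<bar> \<le> 1" for i using b[of i] c[of i] by auto
  have dle: "\<bar>d i\<bar> \<le> (1/3)^i" for i
    using bd[of i] by (simp add: d_def abs_mult mult_left_le_one_le)
  have sm: "summable d" "summable (\<lambda>i. b i * (1/3)^i)" "summable (\<lambda>i. c i * (1/3)^i)"
  proof -
    have "\<bar>b i * (1/3)^i\<bar> \<le> (1/3)^i" "\<bar>c i * (1/3)^i\<bar> \<le> (1/3)^i" for i
      using b[of i] c[of i] by auto
    then have "norm (b i * (1/3)^i) \<le> (1/3)^i" "norm (c i * (1/3)^i) \<le> (1/3)^i"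
        "norm (d i) \<le> (1/3)^i" for i
      using dle by simp_all
    note bounds = this
    have geo: "summable (\<lambda>i. (1/3::real)^i)" by simp
    show "summable d" "summable (\<lambda>i. b i * (1/3)^i)" "summable (\<lambda>i. c i * (1/3)^i)"
      by (rule summable_comparison_test'[OF geo, of 0], rule bounds)+
  qed
  have "(\<Sum>i. b i * (1/3)^i) - (\<Sum>i. c i * (1/3)^i) = suminf d"
    unfolding d_def using suminf_diff[OF sm(2,3)] by (simp add: algebra_simps)
  also have "\<dots> = (\<Sum>i. d (i + Suc k)) + (\<Sum>i<Suc k. d i)"
    by (rule suminf_split_initial_segment[OF sm(1)])
  also have "(\<Sum>i<Suc k. d i) = d k" using kmin by (simp add: d_def)
  finally have eq: "(\<Sum>i. b i * (1/3)^i) - (\<Sum>i. c i * (1/3)^i) = (\<Sum>i. d (i + Suc k)) + d k" .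
  have "\<bar>\<Sum>i. d (i + Suc k)\<bar> \<le> (\<Sum>i. (1/3)^(i + Suc k))"
  proof (rule order.trans[OF summable_rabs])
    have "summable (\<lambda>i. (1/3::real)^(i + Suc k))"
      using summable_ignore_initial_segment[of "\<lambda>i. (1/3::real)^i" "Suc k"] by simp
    note geo = this
    show sd: "summable (\<lambda>i. \<bar>d (i + Suc k)\<bar>)"
      by (rule summable_comparison_test'[OF geo, of 0]) (simp only: real_norm_def abs_abs dle)
    show "(\<Sum>i. \<bar>d (i + Suc k)\<bar>) \<le> (\<Sum>i. (1/3)^(i + Suc k))"
      by (rule suminf_le[OF _ sd geo]) (rule dle)
  qed
  also have "(\<Sum>i. (1/3::real)^(i + Suc k)) = (1/3)^k / 2"
  proof -
    have "(\<Sum>i. (1/3::real)^(i + Suc k)) = (\<Sum>i. (1/3)^i * (1/3)^Suc k)"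
      by (simp only: power_add)
    also have "\<dots> = (\<Sum>i. (1/3)^i) * (1/3)^Suc k"
      by (rule suminf_mult2[symmetric]) simp
    also have "\<dots> = (1/3)^k / 2" by (simp add: suminf_geometric)
    finally show ?thesis .
  qed
  finally have tail: "\<bar>\<Sum>i. d (i + Suc k)\<bar> \<le> (1/3)^k / 2" .
  have "\<bar>d k\<bar> = (1/3)^k" using k b[of k] c[of k] by (auto simp: d_def)
  moreover have "(1/3::real)^j \<le> (1/3)^k" using kj by (intro power_decreasing) auto
  ultimately show ?thesis using eq tail by linarith
qed

text \<open>The digits of the code \<open>s x\<close> record membership of \<open>x\<close> in the sets of a separating base. If
\<open>s (x n) - s (y n)\<close> tends to 0 then the digits of both sequences agree in the limit, so the
sequences have the same cluster points. Therefore \<open>f\<close>, regarded as a function of the code, is uniformly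
continuous; it extends to the closed range, and from there to the line by Tietze's theorem.\<close>

lemma real_code:
  assumes comp: "compact (UNIV :: 'a::{t2_space, second_countable_topology} set)"
  obtains s :: "'a::{t2_space, second_countable_topology} \<Rightarrow> real" where "s \<in> borel_measurable borel" "\<And>x. s x \<in> {0..2}"
    "\<And>f :: 'a::{t2_space, second_countable_topology} \<Rightarrow> real. continuous_on UNIV f \<Longrightarrow>
       \<exists>h b. continuous_on UNIV h \<and> (\<forall>t. \<bar>h t\<bar> \<le> b) \<and> (\<forall>x. h (s x) = f x)"
proof -
  obtain B :: "nat \<Rightarrow> 'a set" where B: "\<And>i. open (B i)"
      "\<And>x y. x \<noteq> y \<Longrightarrow> \<exists>i. x \<in> B i \<and> y \<notin> closure (B i)"
    using separating_base by metis
  define s :: "'a \<Rightarrow> real" where "s x = (\<Sum>i. indicator (B i) x * (1/3)^i)" for x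
  have sm: "summable (\<lambda>i. indicator (B i) x * (1/3::real)^i)" for x
    by (rule summable_comparison_test'[of "\<lambda>i. (1/3)^i"]) (auto split: split_indicator)
  have [measurable]: "B i \<in> sets borel" for i using B(1) by auto
  have meas: "s \<in> borel_measurable borel" unfolding s_def by measurable
  have range: "s x \<in> {0..2}" for x
  proof -
    have "s x \<le> (\<Sum>i. (1/3)^i)"
      unfolding s_def by (intro suminf_le sm) (auto split: split_indicator)
    also have "\<dots> \<le> 2" by (simp add: suminf_geometric)
    finally show ?thesis unfolding s_def by (auto intro!: suminf_nonneg sm)
  qed
  have gap: "x \<in> B i \<longleftrightarrow> y \<in> B i" if "\<bar>s x - s y\<bar> < (1/3)^i / 2" for x y i
  proof (rule ccontr)
    assume "\<not> ?thesis"
    then have ne: "indicator (B i) x \<noteq> (indicator (B i) y :: real)" by (auto simp: indicator_def)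
    have "(1/3)^i / 2 \<le> \<bar>s x - s y\<bar>"
      unfolding s_def by (rule geometric_digits_gap[where b="\<lambda>i. indicator (B i) x" and c="\<lambda>i. indicator (B i) y" and j=i])
         (use ne in \<open>auto simp: indicator_def\<close>)
    then show False using that by simp
  qed
  have "\<exists>h b. continuous_on UNIV h \<and> (\<forall>t. \<bar>h t\<bar> \<le> b) \<and> (\<forall>x. h (s x) = f x)"
    if f: "continuous_on UNIV f" for f :: "'a \<Rightarrow> real"
  proof -
    have key: "\<exists>\<delta>>0. \<forall>x y. \<bar>s x - s y\<bar> < \<delta> \<longrightarrow> \<bar>f x - f y\<bar> < \<epsilon>" if "\<epsilon> > 0" for \<epsilon>
    proof (rule ccontr)
      assume "\<not> ?thesis"
      then have "\<exists>x y. \<bar>s x - s y\<bar> < (1/3)^n / 2 \<and> \<not> \<bar>f x - f y\<bar> < \<epsilon>" for n :: nat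
        by (metis zero_less_divide_1_iff zero_less_numeral zero_less_power half_gt_zero)
      then obtain X Y where XY: "\<And>n. \<bar>s (X n) - s (Y n)\<bar> < (1/3)^n / 2"
          "\<And>n. \<not> \<bar>f (X n) - f (Y n)\<bar> < \<epsilon>" by metis
      have sc: "seq_compact (UNIV :: 'a set)" by (rule compact_imp_seq_compact[OF comp])
      obtain x r1 where r1: "strict_mono r1" "(X \<circ> r1) \<longlonglongrightarrow> x"
        using sc[unfolded seq_compact_def, rule_format, of X] by auto
      obtain y r2 where r2: "strict_mono r2" "((Y \<circ> r1) \<circ> r2) \<longlonglongrightarrow> y"
        using sc[unfolded seq_compact_def, rule_format, of "Y \<circ> r1"] by auto
      define r where "r = r1 \<circ> r2"
      have r: "strict_mono r" unfolding r_def using r1(1) r2(1) by (rule strict_mono_o)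
      have X: "(\<lambda>n. X (r n)) \<longlonglongrightarrow> x"
        using LIMSEQ_subseq_LIMSEQ[OF r1(2) r2(1)] by (simp add: r_def o_def)
      have Y: "(\<lambda>n. Y (r n)) \<longlonglongrightarrow> y" using r2(2) by (simp add: r_def o_def)
      have "x = y"
      proof (rule ccontr)
        assume "x \<noteq> y"
        then obtain i where i: "x \<in> B i" "y \<notin> closure (B i)" using B(2) by blast
        have e1: "eventually (\<lambda>n. X (r n) \<in> B i) sequentially"
          using topological_tendstoD[OF X B(1) i(1)] .
        have e2: "eventually (\<lambda>n. Y (r n) \<in> - closure (B i)) sequentially"
          using topological_tendstoD[OF Y, of "- closure (B i)"] i(2) by auto
        have e3: "eventually (\<lambda>n. n \<ge> i) sequentially" by (rule eventually_ge_at_top)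
        obtain n where n: "X (r n) \<in> B i" "Y (r n) \<notin> closure (B i)" "n \<ge> i"
          using eventually_happens[OF eventually_conj[OF e1 eventually_conj[OF e2 e3]]] by auto
        have "i \<le> r n" using n(3) seq_suble[OF r, of n] by simp
        then have "(1/3::real)^r n / 2 \<le> (1/3)^i / 2" by (simp add: power_decreasing)
        then have "X (r n) \<in> B i \<longleftrightarrow> Y (r n) \<in> B i"
          using gap XY(1)[of "r n"] by (meson order_less_le_trans)
        then show False using n closure_subset by blast
      qed
      have cf: "isCont f x" using f by (simp add: continuous_on_eq_continuous_at)
      have "(\<lambda>n. f (X (r n)) - f (Y (r n))) \<longlonglongrightarrow> f x - f x"
        using X Y \<open>x = y\<close> by (intro tendsto_diff isCont_tendsto_compose[OF cf]) auto
      then have "eventually (\<lambda>n. \<bar>f (X (r n)) - f (Y (r n))\<bar> < \<epsilon>) sequentially"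
        using that by (auto simp: tendsto_iff dist_real_def)
      then show False using XY(2) by (auto simp: eventually_sequentially)
    qed
    define g where "g t = f (SOME x. s x = t)" for t
    have sinj: "f x = f y" if "s x = s y" for x y
    proof (rule ccontr)
      assume "f x \<noteq> f y"
      then obtain \<delta> where "\<delta> > 0" "\<And>x' y'. \<bar>s x' - s y'\<bar> < \<delta> \<Longrightarrow> \<bar>f x' - f y'\<bar> < \<bar>f x - f y\<bar>"
        using key[of "\<bar>f x - f y\<bar>"] by auto
      from this(2)[of x y] this(1) show False using that by simp
    qed
    have gs: "g (s x) = f x" for x
      unfolding g_def by (rule sinj, rule someI) (rule refl)
    have "uniformly_continuous_on (range s) g"
      unfolding uniformly_continuous_on_def dist_real_def
    proof (intro allI impI)
      fix \<epsilon> :: real assume "\<epsilon> > 0"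
      then obtain \<delta> where "\<delta> > 0" "\<And>x' y'. \<bar>s x' - s y'\<bar> < \<delta> \<Longrightarrow> \<bar>f x' - f y'\<bar> < \<epsilon>"
        using key by metis
      then show "\<exists>\<delta>>0. \<forall>t\<in>range s. \<forall>t'\<in>range s. \<bar>t' - t\<bar> < \<delta> \<longrightarrow> \<bar>g t' - g t\<bar> < \<epsilon>"
        by (intro exI[of _ \<delta>]) (auto simp: gs)
    qed
    then obtain G where G: "uniformly_continuous_on (closure (range s)) G"
        "\<And>t. t \<in> range s \<Longrightarrow> g t = G t"
      using uniformly_continuous_on_extension_on_closure by metis
    have contG: "continuous_on (closure (range s)) G"
      using G(1) uniformly_continuous_imp_continuous by blast
    have "compact (closure (range s))"
    proof -
      have "range s \<subseteq> {0..2}" using range by blast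
      then have "bounded (range s)" using bounded_closed_interval bounded_subset by blast
      then show ?thesis by simp
    qed
    then have "bounded (G ` closure (range s))"
      using contG by (intro compact_imp_bounded compact_continuous_image)
    then obtain b where b: "b > 0" "\<forall>y\<in>G ` closure (range s). norm y \<le> b"
      unfolding bounded_pos by blast
    obtain h where h: "continuous_on UNIV h" "\<And>t. t \<in> closure (range s) \<Longrightarrow> h t = G t"
        "\<And>t. norm (h t) \<le> b"
    proof (rule Tietze[of "closure (range s)" G UNIV b])
      show "closedin (top_of_set UNIV) (closure (range s))" by simp
      show "norm (G t) \<le> b" if "t \<in> closure (range s)" for t using b that by blast
    qed (use contG b in auto)
    have "h (s x) = f x" for x
    proof -
      have "s x \<in> closure (range s)" using closure_subset[of "range s"] by blast
      then show ?thesis using h(2) gs G(2)[of "s x"] by simp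
    qed
    then show ?thesis using h(1,3) by auto
  qed
  then show ?thesis using that meas range by blast
qed


text \<open>The laws of the code \<open>s\<close> under \<open>\<mu> n\<close> live on a bounded interval, so Helly's theorem gives a limit law
\<open>N\<close>. It is concentrated on the closure \<open>C\<close> of the range of \<open>s\<close>, and each point of \<open>C\<close> decodes to a
unique point of the space; the limit is the image of \<open>N\<close> under this decoding.\<close>

lemma weakly_convergent_subsequence_prob:
  fixes \<mu> :: "nat \<Rightarrow> 'a::{t2_space, second_countable_topology} measure"
  assumes comp: "compact (UNIV :: 'a set)"
    and sets: "\<And>n. sets (\<mu> n) = sets borel" and prob: "\<And>n. prob_space (\<mu> n)"
  obtains r M where "strict_mono r" "sets M = sets borel" "prob_space M"
    "\<And>f :: 'a \<Rightarrow> real. continuous_on UNIV f \<Longrightarrow> (\<lambda>n. \<integral>x. f x \<partial>\<mu> (r n)) \<longlonglongrightarrow> (\<integral>x. f x \<partial>M)"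
proof -
  obtain s :: "'a \<Rightarrow> real" where s: "s \<in> borel_measurable borel" "\<And>x. s x \<in> {0..2}"
    "\<And>f :: 'a \<Rightarrow> real. continuous_on UNIV f \<Longrightarrow>
       \<exists>h b. continuous_on UNIV h \<and> (\<forall>t. \<bar>h t\<bar> \<le> b) \<and> (\<forall>x. h (s x) = f x)"
    using real_code[OF comp] by metis
  have sp: "space (\<mu> n) = UNIV" for n using sets_eq_imp_space_eq[OF sets[of n]] by simp
  have sm: "s \<in> measurable (\<mu> n) borel" for n using s(1) sets by (simp cong: measurable_cong_sets)
  define \<nu> where "\<nu> n = distr (\<mu> n) borel s" for n
  have rd: "real_distribution (\<nu> n)" for n
    unfolding \<nu>_def real_distribution_def real_distribution_axioms_def
    using prob_space.prob_space_distr[OF prob sm] by simp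
  have "tight \<nu>"
    unfolding tight_def
  proof (intro conjI allI impI rd)
    fix \<epsilon> :: real assume "\<epsilon> > 0"
    have "measure (\<nu> n) {-1<..2} = 1" for n
    proof -
      have "s x \<in> {-1<..2}" for x using s(2)[of x] by auto
      then have "s -` {-1<..2} \<inter> space (\<mu> n) = space (\<mu> n)" by auto
      then show ?thesis unfolding \<nu>_def using sm prob_space.prob_space[OF prob]
        by (subst measure_distr) auto
    qed
    then show "\<exists>a b. a < b \<and> (\<forall>n. 1 - \<epsilon> < measure (\<nu> n) {a<..b})"
      using \<open>\<epsilon> > 0\<close> by (intro exI[of _ "-1"] exI[of _ 2]) auto
  qed
  then obtain r N where r: "strict_mono r" and N: "real_distribution N"
      and conv: "weak_conv_m (\<nu> \<circ> id \<circ> r) N"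
    using tight_imp_convergent_subsubsequence[OF _ strict_mono_id] by blast
  interpret N: real_distribution N by (rule N)
  have cont_lim: "(\<lambda>n. \<integral>x. h (s x) \<partial>\<mu> (r n)) \<longlonglongrightarrow> (\<integral>t. h t \<partial>N)"
    if h: "continuous_on UNIV h" "\<And>t. \<bar>h t\<bar> \<le> b" for h :: "real \<Rightarrow> real" and b
  proof -
    have "(\<lambda>n. \<integral>t. h t \<partial>(\<nu> \<circ> id \<circ> r) n) \<longlonglongrightarrow> (\<integral>t. h t \<partial>N)"
      using h by (intro weak_conv_imp_integral_bdd_continuous_conv[where B=b] conv N)
        (auto simp: rd continuous_on_eq_continuous_at)
    moreover have "(\<integral>t. h t \<partial>\<nu> n) = (\<integral>x. h (s x) \<partial>\<mu> n)" for n
      unfolding \<nu>_def using sm borel_measurable_continuous_onI[OF h(1)] by (intro integral_distr) auto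
    ultimately show ?thesis by simp
  qed
  define C where "C = closure (range s)"
  have C: "closed C" "C \<noteq> {}" unfolding C_def by auto
  have AE_C: "AE t in N. t \<in> C"
  proof -
    \<comment> \<open>a continuous function that vanishes exactly on \<open>C\<close>\<close>
    define g where "g t = min 1 (infdist t C)" for t :: real
    have contg: "continuous_on UNIV g" unfolding g_def
      by (intro continuous_intros)
    have g: "0 \<le> g t" "\<bar>g t\<bar> \<le> 1" for t unfolding g_def by (auto simp: infdist_nonneg)
    have "g (s x) = 0" for x
    proof -
      have "s x \<in> C" unfolding C_def using closure_subset[of "range s"] by blast
      then show ?thesis unfolding g_def by (simp add: infdist_zero)
    qed
    then have "(\<lambda>n. 0) \<longlonglongrightarrow> (\<integral>t. g t \<partial>N)" using cont_lim[OF contg g(2)] by simp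
    then have "(\<integral>t. g t \<partial>N) = 0" by (simp add: LIMSEQ_const_iff)
    moreover have "integrable N g"
      using g borel_measurable_continuous_onI[OF contg]
      by (intro N.integrable_const_bound[where B=1]) auto
    ultimately have "AE t in N. g t = 0" using g(1) integral_nonneg_eq_0_iff_AE by blast
    then show ?thesis
    proof (rule AE_mp, intro AE_I2 impI)
      fix t assume "g t = 0"
      then have "infdist t C = 0" unfolding g_def by (auto simp: min_def split: if_splits)
      then show "t \<in> C" using in_closed_iff_infdist_zero[OF C] by blast
    qed
  qed
  \<comment> \<open>decoding: all continuous functions of the code have at \<open>t\<close> the value of the original function at one point\<close>
  have pt: "\<exists>x. \<forall>f h. continuous_on UNIV f \<longrightarrow> continuous_on UNIV h \<longrightarrow> (\<forall>y. h (s y) = f y) \<longrightarrow> h t = (f x :: real)"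
    if tC: "t \<in> C" for t
  proof -
    obtain X where X: "\<And>n. X n \<in> range s" "X \<longlonglongrightarrow> t"
      using tC unfolding C_def closure_sequential by blast
    have "\<forall>n. \<exists>y. X n = s y" using X(1) by auto
    then obtain Y where Y: "\<And>n. X n = s (Y n)" using choice by metis
    obtain x r' where r': "strict_mono r'" "(Y \<circ> r') \<longlonglongrightarrow> x"
      using compact_imp_seq_compact[OF comp, unfolded seq_compact_def, rule_format, of Y] by auto
    have "h t = f x" if f: "continuous_on UNIV f" and h: "continuous_on UNIV h"
        and hf: "\<And>y. h (s y) = f y" for f h :: "_ \<Rightarrow> real"
    proof -
      have "isCont f x" "isCont h t" using f h by (auto simp: continuous_on_eq_continuous_at)
      then have "(\<lambda>n. f (Y (r' n))) \<longlonglongrightarrow> f x" "(\<lambda>n. h (X (r' n))) \<longlonglongrightarrow> h t"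
        using r' LIMSEQ_subseq_LIMSEQ[OF X(2) r'(1)] by (auto intro: isCont_tendsto_compose simp: o_def)
      then show ?thesis using hf by (simp add: Y LIMSEQ_unique)
    qed
    then show ?thesis by blast
  qed
  define P where "P t x \<longleftrightarrow> (\<forall>f h. continuous_on UNIV f \<longrightarrow> continuous_on UNIV h \<longrightarrow>
      (\<forall>y. h (s y) = f y) \<longrightarrow> h t = (f x :: real))" for t :: real and x :: 'a
  define q where "q t = (if t \<in> C then (SOME x. P t x) else undefined)" for t
  have q: "h t = f (q t)" if "t \<in> C" "continuous_on UNIV f" "continuous_on UNIV h"
      "\<And>y. h (s y) = f y" for f h :: "_ \<Rightarrow> real" and t
  proof -
    have "\<exists>x. P t x" unfolding P_def by (rule pt[OF that(1)])
    then have "P t (q t)" unfolding q_def using that(1) someI_ex[of "P t"] by auto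
    then show ?thesis unfolding P_def using that by blast
  qed
  have qm: "q \<in> measurable borel borel"
  proof (rule borel_measurableI)
    fix U :: "'a set" assume "open U"
    then obtain f :: "'a \<Rightarrow> real" where f: "continuous_on UNIV f" "U = {x. f x > 0}"
      using open_eq_positivity_set[OF comp] by metis
    obtain h b where h: "continuous_on UNIV h" "\<And>x. h (s x) = f x" using s(3)[OF f(1)] by blast
    have [measurable]: "h \<in> borel_measurable borel" "C \<in> sets borel"
      using borel_measurable_continuous_onI[OF h(1)] C by auto
    \<comment> \<open>on \<open>C\<close>, the decoded point is in \<open>U\<close> iff the extension of the function that cuts out \<open>U\<close> is positive\<close>
    have "q -` U = C \<inter> {t. h t > 0} \<union> (if undefined \<in> U then - C else {})"
      using q[OF _ f(1) h] f(2) by (auto simp: q_def)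
    also have "\<dots> \<in> sets borel"
    proof -
      have "C \<inter> {t. h t > 0} \<in> sets borel" by measurable
      moreover have "- C \<in> sets borel" using C(1) by (intro borel_comp) simp
      ultimately show ?thesis by (auto intro: sets.Un)
    qed
    finally show "q -` U \<inter> space borel \<in> sets borel" by simp
  qed
  then have qm': "q \<in> measurable N borel" by simp
  show ?thesis
  proof (rule that[of r "distr N borel q"])
    show "prob_space (distr N borel q)" by (rule N.prob_space_distr[OF qm'])
    fix f :: "'a \<Rightarrow> real" assume f: "continuous_on UNIV f"
    obtain h b where h: "continuous_on UNIV h" "\<And>t. \<bar>h t\<bar> \<le> b" "\<And>x. h (s x) = f x"
      using s(3)[OF f] by blast
    have fm: "f \<in> borel_measurable borel" by (rule borel_measurable_continuous_onI[OF f])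
    have "(\<integral>x. f x \<partial>distr N borel q) = (\<integral>t. f (q t) \<partial>N)" by (rule integral_distr[OF qm' fm])
    also have "\<dots> = (\<integral>t. h t \<partial>N)"
    proof (rule integral_cong_AE)
      show "(\<lambda>t. f (q t)) \<in> borel_measurable N" using measurable_compose[OF qm' fm] .
      show "h \<in> borel_measurable N" using borel_measurable_continuous_onI[OF h(1)] by simp
      show "AE t in N. f (q t) = h t" using AE_C q[OF _ f h(1,3)] by auto
    qed
    finally show "(\<lambda>n. \<integral>x. f x \<partial>\<mu> (r n)) \<longlonglongrightarrow> (\<integral>x. f x \<partial>distr N borel q)"
      using cont_lim[OF h(1,2)] h(3) by simp
  qed (use r in auto)
qed

lemma scale_measure_eq_density: "scale_measure c M = density M (\<lambda>_. c)"
  by (rule measure_eqI) (auto simp: emeasure_density nn_integral_cmult_indicator)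

lemma integral_scale_measure:
  fixes f :: "'a \<Rightarrow> real"
  assumes "f \<in> borel_measurable M" "0 \<le> c"
  shows "(\<integral>x. f x \<partial>scale_measure (ennreal c) M) = c * (\<integral>x. f x \<partial>M)"
  unfolding scale_measure_eq_density using assms by (subst integral_real_density) auto

lemma weakly_convergent_subsequence:
  fixes \<mu> :: "nat \<Rightarrow> 'a::{t2_space, second_countable_topology} measure"
  assumes comp: "compact (UNIV :: 'a set)"
    and sets: "\<And>n. sets (\<mu> n) = sets borel" and mass: "\<And>n. emeasure (\<mu> n) UNIV = ennreal c"
  obtains r M where "strict_mono r" "sets M = sets borel" "emeasure M UNIV = ennreal c"
    "\<And>f :: 'a \<Rightarrow> real. continuous_on UNIV f \<Longrightarrow> (\<lambda>n. \<integral>x. f x \<partial>\<mu> (r n)) \<longlonglongrightarrow> (\<integral>x. f x \<partial>M)"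
proof (cases "c > 0")
  case False
  then have 0: "emeasure (\<mu> n) X = 0" for n X
    using mass[of n] emeasure_mono[of X UNIV "\<mu> n"] sets[of n] 
    by (cases "X \<in> sets (\<mu> n)") (auto simp: ennreal_neg emeasure_notin_sets)
  have all_eq: "\<mu> n = \<mu> 0" for n using 0 sets by (intro measure_eqI) auto
  have "(\<lambda>n. \<integral>x. f x \<partial>\<mu> (id n)) \<longlonglongrightarrow> (\<integral>x. f x \<partial>\<mu> 0)" for f :: "'a \<Rightarrow> real"
  proof -
    have "(\<integral>x. f x \<partial>\<mu> (id n)) = (\<integral>x. f x \<partial>\<mu> 0)" for n using all_eq[of n] by simp
    then have "(\<lambda>n. \<integral>x. f x \<partial>\<mu> (id n)) = (\<lambda>n. \<integral>x. f x \<partial>\<mu> 0)" by (rule ext)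
    then show ?thesis by (simp only: tendsto_const)
  qed
  then show ?thesis using that[of id "\<mu> 0"] sets mass strict_mono_id by blast
next
  case True
  define \<nu> where "\<nu> n = scale_measure (ennreal (1/c)) (\<mu> n)" for n
  have sp: "space (\<mu> n) = UNIV" for n using sets_eq_imp_space_eq[OF sets[of n]] by simp
  have "prob_space (\<nu> n)" for n
    using mass[of n] True unfolding \<nu>_def
    by (intro prob_spaceI) (simp add: sp space_scale_measure flip: ennreal_mult'')
  then obtain r M where r: "strict_mono r" and M: "sets M = sets borel" "prob_space M"
    and conv: "\<And>f :: 'a \<Rightarrow> real. continuous_on UNIV f \<Longrightarrow> (\<lambda>n. \<integral>x. f x \<partial>\<nu> (r n)) \<longlonglongrightarrow> (\<integral>x. f x \<partial>M)"
    using weakly_convergent_subsequence_prob[OF comp, of \<nu>] sets by (auto simp: \<nu>_def)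
  have spM: "space M = UNIV" using sets_eq_imp_space_eq[OF M(1)] by simp
  show ?thesis
  proof (rule that[of r "scale_measure (ennreal c) M"])
    show "emeasure (scale_measure (ennreal c) M) UNIV = ennreal c"
      using prob_space.emeasure_space_1[OF M(2)] spM by simp
    fix f :: "'a \<Rightarrow> real" assume f: "continuous_on UNIV f"
    have fm: "f \<in> borel_measurable L" if "sets L = sets borel" for L
      using borel_measurable_continuous_onI[OF f] that by (simp cong: measurable_cong_sets)
    have "(\<lambda>n. c * (\<integral>x. f x \<partial>\<nu> (r n))) \<longlonglongrightarrow> c * (\<integral>x. f x \<partial>M)"
      by (intro tendsto_mult_left conv f)
    then show "(\<lambda>n. \<integral>x. f x \<partial>\<mu> (r n)) \<longlonglongrightarrow> (\<integral>x. f x \<partial>scale_measure (ennreal c) M)"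
      using True unfolding \<nu>_def by (simp add: integral_scale_measure fm sets M(1))
  qed (use r M in auto)
qed

section \<open>Couplings\<close>

lemma finite_borel_measureD:
  assumes "finite_borel_measure M"
  shows "sets M = sets borel" "space M = UNIV" "finite_measure M" "emeasure M X \<noteq> \<infinity>"
  using assms sets_eq_imp_space_eq[of M borel] finite_measure.emeasure_finite[of M]
  unfolding finite_borel_measure_def by auto

lemma finite_borel_measureI:
  assumes "sets M = sets borel" "emeasure M UNIV \<noteq> \<infinity>"
  shows "finite_borel_measure M"
  using assms sets_eq_imp_space_eq[of M borel]
  unfolding finite_borel_measure_def by (auto intro!: finite_measureI)

lemma finite_borel_measure_mass:
  assumes "finite_borel_measure M"
  shows "emeasure M UNIV = ennreal (measure M UNIV)"
  using finite_measure.emeasure_eq_measure finite_borel_measureD[OF assms] by blast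

lemma finite_borel_measure_add:
  assumes "finite_borel_measure a" "finite_borel_measure b"
  shows "finite_borel_measure (add_measure a b)"
  using finite_borel_measureD[OF assms(1)] finite_borel_measureD[OF assms(2)]
  by (intro finite_borel_measureI) (auto simp: emeasure_add_measure)

lemma finite_borel_measure_scale:
  assumes "finite_borel_measure a"
  shows "finite_borel_measure (scale_measure (ennreal c) a)"
  using finite_borel_measureD[OF assms]
  by (intro finite_borel_measureI) (auto simp: ennreal_mult_eq_top_iff)

lemma nn_integral_add_measure:
  assumes s: "sets b = sets a" and f: "f \<in> borel_measurable a"
  shows "(\<integral>\<^sup>+x. f x \<partial>add_measure a b) = (\<integral>\<^sup>+x. f x \<partial>a) + (\<integral>\<^sup>+x. f x \<partial>b)"
  using f
proof (induction rule: borel_measurable_induct)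
  case (cong f g)
  then show ?case
    by (metis nn_integral_cong s sets_eq_imp_space_eq space_add_measure)
next
  case (set A)
  then show ?case using s by (simp add: emeasure_add_measure)
next
  case (mult u c)
  then have "u \<in> borel_measurable b" "u \<in> borel_measurable (add_measure a b)"
    using s by (simp_all cong: measurable_cong_sets)
  with mult show ?case by (simp add: nn_integral_cmult distrib_left)
next
  case (add u v)
  then have "u \<in> borel_measurable b" "u \<in> borel_measurable (add_measure a b)"
      "v \<in> borel_measurable b" "v \<in> borel_measurable (add_measure a b)"
    using s by (simp_all cong: measurable_cong_sets)
  with add show ?case by (simp add: nn_integral_add ac_simps)
next
  case (seq U)
  have m: "U i \<in> borel_measurable a" "U i \<in> borel_measurable b" "U i \<in> borel_measurable (add_measure a b)" for i
    using seq(1) s by (simp_all cong: measurable_cong_sets)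
  have "(\<integral>\<^sup>+x. (SUP i. U i) x \<partial>L) = (SUP i. \<integral>\<^sup>+x. U i x \<partial>L)" if "\<And>i. U i \<in> borel_measurable L" for L
    using nn_integral_monotone_convergence_SUP[OF \<open>incseq U\<close> that] by (simp add: SUP_apply image_comp)
  moreover have "incseq (\<lambda>i. \<integral>\<^sup>+x. U i x \<partial>L)" for L
    using \<open>incseq U\<close> by (auto simp: incseq_def le_fun_def intro!: nn_integral_mono)
  ultimately show ?case using m seq.IH by (simp add: ennreal_SUP_add)
qed

lemma integral_add_measure:
  fixes f :: "'a::topological_space \<Rightarrow> real"
  assumes "compact (UNIV :: 'a set)" "continuous_on UNIV f"
    "finite_borel_measure a" "finite_borel_measure b"
  shows "(\<integral>x. f x \<partial>add_measure a b) = (\<integral>x. f x \<partial>a) + (\<integral>x. f x \<partial>b)"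
proof -
  have i: "integrable a f" "integrable b f" "integrable (add_measure a b) f"
    using assms by (auto intro!: integrable_continuous_finite_borel finite_borel_measure_add)
  have s: "sets b = sets a" using assms(3,4) by (simp add: finite_borel_measure_def)
  have f: "(\<lambda>x. ennreal (f x)) \<in> borel_measurable a" "(\<lambda>x. ennreal (- f x)) \<in> borel_measurable a"
    using i(1) by auto
  have fin: "(\<integral>\<^sup>+x. ennreal (f x) \<partial>L) < \<infinity>" "(\<integral>\<^sup>+x. ennreal (- f x) \<partial>L) < \<infinity>" if "integrable L f" for L
    using that by (auto simp: real_integrable_def top.not_eq_extremum)
  show ?thesis
    unfolding real_lebesgue_integral_def[OF i(1)] real_lebesgue_integral_def[OF i(2)]
      real_lebesgue_integral_def[OF i(3)] nn_integral_add_measure[OF s f(1)] nn_integral_add_measure[OF s f(2)]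
    using fin[OF i(1)] fin[OF i(2)] by (simp add: enn2real_plus)
qed

lemma couplingsD:
  assumes "\<Lambda> \<in> couplings a b"
  shows "sets \<Lambda> = sets borel" "space \<Lambda> = UNIV"
    "fst \<in> measurable \<Lambda> borel" "snd \<in> measurable \<Lambda> borel"
    "distr \<Lambda> borel fst = a" "distr \<Lambda> borel snd = b"
    "emeasure \<Lambda> UNIV = emeasure a UNIV" "emeasure \<Lambda> UNIV = emeasure b UNIV"
proof -
  show s: "sets \<Lambda> = sets borel" "distr \<Lambda> borel fst = a" "distr \<Lambda> borel snd = b"
    using assms by (auto simp: couplings_def)
  show sp: "space \<Lambda> = UNIV" using sets_eq_imp_space_eq[OF s(1)] by simp
  have "(fst :: 'a \<times> 'a \<Rightarrow> 'a) \<in> measurable borel borel" "(snd :: 'a \<times> 'a \<Rightarrow> 'a) \<in> measurable borel borel"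
    by (intro borel_measurable_continuous_onI continuous_intros)+
  then show m: "fst \<in> measurable \<Lambda> borel" "snd \<in> measurable \<Lambda> borel"
    using s(1) by (simp_all cong: measurable_cong_sets)
  have "emeasure (distr \<Lambda> borel fst) UNIV = emeasure \<Lambda> UNIV" "emeasure (distr \<Lambda> borel snd) UNIV = emeasure \<Lambda> UNIV"
    using m by (simp_all add: emeasure_distr sp)
  then show "emeasure \<Lambda> UNIV = emeasure a UNIV" "emeasure \<Lambda> UNIV = emeasure b UNIV"
    using s(2,3) by simp_all
qed

lemma couplings_finite:
  assumes "\<Lambda> \<in> couplings a b" "finite_borel_measure a"
  shows "finite_borel_measure \<Lambda>"
  using couplingsD[OF assms(1)] finite_borel_measureD[OF assms(2)]
  by (intro finite_borel_measureI) auto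

lemma couplings_integral:
  fixes f :: "'a::second_countable_topology \<Rightarrow> real"
  assumes "\<Lambda> \<in> couplings a b" "continuous_on UNIV f"
  shows "(\<integral>z. f (fst z) \<partial>\<Lambda>) = (\<integral>x. f x \<partial>a)" "(\<integral>z. f (snd z) \<partial>\<Lambda>) = (\<integral>x. f x \<partial>b)"
  using couplingsD[OF assms(1)] integral_distr[of fst \<Lambda> borel f] integral_distr[of snd \<Lambda> borel f]
    borel_measurable_continuous_onI[OF assms(2)] by auto

text \<open>By Fubini's theorem, the two hypotheses on \<open>h\<close> say that the marginals are \<open>a\<close> and \<open>b\<close>.\<close>

lemma density_coupling:
  fixes a b :: "'a::second_countable_topology measure"
  assumes a: "finite_borel_measure a" and b: "finite_borel_measure b"
    and h: "h \<in> borel_measurable borel"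
    and 1: "AE x in a. (\<integral>\<^sup>+y. h (x, y) \<partial>b) = 1" and 2: "AE y in b. (\<integral>\<^sup>+x. h (x, y) \<partial>a) = 1"
  shows "density (a \<Otimes>\<^sub>M b) h \<in> couplings a b"
proof -
  note A = finite_borel_measureD[OF a] and B = finite_borel_measureD[OF b]
  interpret a: finite_measure a by (rule A)
  interpret b: finite_measure b by (rule B)
  interpret pair_sigma_finite a b ..
  have s: "sets (a \<Otimes>\<^sub>M b) = sets (borel :: ('a \<times> 'a) measure)"
    using sets_pair_measure_cong[OF A(1) B(1)] by (simp only: Binary_Product_Measure.borel_prod)
  have [measurable]: "h \<in> borel_measurable (a \<Otimes>\<^sub>M b)" using h s by (simp cong: measurable_cong_sets)
  have fs: "fst \<in> measurable (a \<Otimes>\<^sub>M b) borel" "snd \<in> measurable (a \<Otimes>\<^sub>M b) borel"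
    using measurable_fst[of a b] measurable_snd[of a b] A(1) B(1) by (simp_all cong: measurable_cong_sets)
  have "distr (density (a \<Otimes>\<^sub>M b) h) borel fst = a"
  proof (rule measure_eqI)
    fix X assume "X \<in> sets (distr (density (a \<Otimes>\<^sub>M b) h) borel fst)"
    then have X: "X \<in> sets borel" and [measurable]: "X \<in> sets a" using A by auto
    have "emeasure (distr (density (a \<Otimes>\<^sub>M b) h) borel fst) X
        = (\<integral>\<^sup>+z. h z * indicator (fst -` X \<inter> space (a \<Otimes>\<^sub>M b)) z \<partial>(a \<Otimes>\<^sub>M b))"
      using X fs measurable_sets[OF fs(1) X] by (simp add: emeasure_distr emeasure_density)
    also have "\<dots> = (\<integral>\<^sup>+z. h z * indicator X (fst z) \<partial>(a \<Otimes>\<^sub>M b))"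
      by (intro nn_integral_cong) (auto simp: indicator_def)
    also have "\<dots> = (\<integral>\<^sup>+x. \<integral>\<^sup>+y. h (x, y) * indicator X x \<partial>b \<partial>a)"
      by (subst b.nn_integral_fst[symmetric]) simp_all
    also have "\<dots> = (\<integral>\<^sup>+x. indicator X x \<partial>a)"
      using 1 by (intro nn_integral_cong_AE) (auto simp: nn_integral_multc)
    finally show "emeasure (distr (density (a \<Otimes>\<^sub>M b) h) borel fst) X = emeasure a X" by simp
  qed (simp add: A)
  moreover have "distr (density (a \<Otimes>\<^sub>M b) h) borel snd = b"
  proof (rule measure_eqI)
    fix X assume "X \<in> sets (distr (density (a \<Otimes>\<^sub>M b) h) borel snd)"
    then have X: "X \<in> sets borel" and [measurable]: "X \<in> sets b" using B by auto
    have "emeasure (distr (density (a \<Otimes>\<^sub>M b) h) borel snd) X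
        = (\<integral>\<^sup>+z. h z * indicator (snd -` X \<inter> space (a \<Otimes>\<^sub>M b)) z \<partial>(a \<Otimes>\<^sub>M b))"
      using X fs measurable_sets[OF fs(2) X] by (simp add: emeasure_distr emeasure_density)
    also have "\<dots> = (\<integral>\<^sup>+z. h z * indicator X (snd z) \<partial>(a \<Otimes>\<^sub>M b))"
      by (intro nn_integral_cong) (auto simp: indicator_def)
    also have "\<dots> = (\<integral>\<^sup>+y. \<integral>\<^sup>+x. h (x, y) * indicator X y \<partial>a \<partial>b)"
      by (subst nn_integral_snd[symmetric]) simp_all
    also have "\<dots> = (\<integral>\<^sup>+y. indicator X y \<partial>b)"
      using 2 by (intro nn_integral_cong_AE) (auto simp: nn_integral_multc)
    finally show "emeasure (distr (density (a \<Otimes>\<^sub>M b) h) borel snd) X = emeasure b X" by simp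
  qed (simp add: B)
  ultimately show ?thesis using s by (simp add: couplings_def)
qed

lemma couplings_nonempty:
  fixes a b :: "'a::second_countable_topology measure"
  assumes a: "finite_borel_measure a" and b: "finite_borel_measure b"
    and eq: "emeasure a UNIV = emeasure b UNIV"
  shows "couplings a b \<noteq> {}"
proof -
  note A = finite_borel_measureD[OF a] and B = finite_borel_measureD[OF b]
  have "AE x in M. inverse (emeasure M UNIV) * emeasure M UNIV = 1" if M: "finite_borel_measure M" for M :: "'a measure"
  proof (cases "emeasure M UNIV = 0")
    case True
    then show ?thesis
      using finite_borel_measureD[OF M] by (intro AE_I[of _ _ UNIV]) auto
  next
    case False
    then have "emeasure M UNIV / emeasure M UNIV = 1"
      using finite_borel_measureD(4)[OF M, of UNIV] by (simp add: less_top)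
    then show ?thesis by (simp add: divide_ennreal_def mult.commute)
  qed
  from this[OF a] this[OF b]
  have "density (a \<Otimes>\<^sub>M b) (\<lambda>_. inverse (emeasure a UNIV)) \<in> couplings a b"
    using A B eq by (intro density_coupling a b) (auto simp: eq)
  then show ?thesis by blast
qed

text \<open>The direct approach of the calculus of variations, in the form that both minimisations below use: \<open>S\<close>
is sequentially compact with respect to some convergence along which \<open>\<Phi>\<close> is continuous.\<close>

lemma attains_minimum_sequentially:
  fixes \<Phi> :: "'b \<Rightarrow> real"
  assumes ne: "S \<noteq> {}" and nn: "\<And>x. x \<in> S \<Longrightarrow> 0 \<le> \<Phi> x"
    and seq: "\<And>X. (\<And>n. X n \<in> S) \<Longrightarrow>
       \<exists>(r :: nat \<Rightarrow> nat) x. strict_mono r \<and> x \<in> S \<and> (\<lambda>n. \<Phi> (X (r n))) \<longlonglongrightarrow> \<Phi> x"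
  shows "\<exists>x\<in>S. \<forall>y\<in>S. \<Phi> x \<le> \<Phi> y"
proof -
  define m where "m = Inf (\<Phi> ` S)"
  have bdd: "bdd_below (\<Phi> ` S)" using nn by (intro bdd_belowI[of _ 0]) auto
  have m: "m \<le> \<Phi> y" if "y \<in> S" for y unfolding m_def using bdd that by (intro cInf_lower) auto
  have "\<exists>x\<in>S. \<Phi> x < m + 1 / real (Suc n)" for n
    using cInf_lessD[of "\<Phi> ` S" "m + 1 / real (Suc n)"] ne unfolding m_def by auto
  then have "\<forall>n. \<exists>x. x \<in> S \<and> \<Phi> x < m + 1 / real (Suc n)" by blast
  from choice[OF this] obtain X where "\<forall>n. X n \<in> S \<and> \<Phi> (X n) < m + 1 / real (Suc n)" ..
  then have X: "\<And>n. X n \<in> S" "\<And>n. \<Phi> (X n) < m + 1 / real (Suc n)" by simp_all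
  obtain r :: "nat \<Rightarrow> nat" and x where r: "strict_mono r" "x \<in> S" "(\<lambda>n. \<Phi> (X (r n))) \<longlonglongrightarrow> \<Phi> x" 
    using seq[of X, OF X(1)] by (elim exE conjE)
  have "(\<lambda>n. m + 1 / real (Suc n)) \<longlonglongrightarrow> m + 0"
    by (intro tendsto_add tendsto_const LIMSEQ_inverse_real_of_nat[unfolded inverse_eq_divide])
  from LIMSEQ_subseq_LIMSEQ[OF this r(1)] have "(\<lambda>n. m + 1 / real (Suc (r n))) \<longlonglongrightarrow> m" by (simp add: o_def)
  then have "\<Phi> x \<le> m"
    by (rule LIMSEQ_le[OF r(3)]) (intro exI allI impI less_imp_le X(2))
  then show ?thesis using r(2) m by (intro bexI[of _ x]) (auto intro: order_trans)
qed

text \<open>A weak limit of couplings couples the weak limits of the marginals, since the marginals are determined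
by the integrals of functions of one coordinate.\<close>

lemma couplings_weak_limit:
  fixes a b :: "'m::{t2_space, second_countable_topology} measure"
  assumes comp: "compact (UNIV :: 'm set)"
    and a: "finite_borel_measure a" and b: "finite_borel_measure b"
    and \<Lambda>: "\<And>n. \<Lambda> n \<in> couplings (a' n) (b' n)" and mass: "\<And>n. emeasure (a' n) UNIV = ennreal c"
    and a': "\<And>f :: 'm \<Rightarrow> real. continuous_on UNIV f \<Longrightarrow> (\<lambda>n. \<integral>x. f x \<partial>a' n) \<longlonglongrightarrow> (\<integral>x. f x \<partial>a)"
    and b': "\<And>f :: 'm \<Rightarrow> real. continuous_on UNIV f \<Longrightarrow> (\<lambda>n. \<integral>x. f x \<partial>b' n) \<longlonglongrightarrow> (\<integral>x. f x \<partial>b)"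
  obtains r \<Lambda>' where "strict_mono (r :: nat \<Rightarrow> nat)" "\<Lambda>' \<in> couplings a b"
    "\<And>f :: 'm \<times> 'm \<Rightarrow> real. continuous_on UNIV f \<Longrightarrow>
      (\<lambda>n. \<integral>z. f z \<partial>\<Lambda> (r n)) \<longlonglongrightarrow> (\<integral>z. f z \<partial>\<Lambda>')"
proof -
  have comp2: "compact (UNIV :: ('m \<times> 'm) set)"
    using compact_Times[OF comp comp] by simp
  obtain r \<Lambda>' where r: "strict_mono r" and s: "sets \<Lambda>' = sets (borel :: ('m \<times> 'm) measure)"
    and m: "emeasure \<Lambda>' UNIV = ennreal c"
    and lim: "\<And>f :: 'm \<times> 'm \<Rightarrow> real. continuous_on UNIV f \<Longrightarrow>
      (\<lambda>n. \<integral>z. f z \<partial>\<Lambda> (r n)) \<longlonglongrightarrow> (\<integral>z. f z \<partial>\<Lambda>')"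
    using weakly_convergent_subsequence[OF comp2, of \<Lambda> c] couplingsD(1,7)[OF \<Lambda>] mass by metis
  have sp: "space \<Lambda>' = UNIV" using sets_eq_imp_space_eq[OF s] by simp
  have marg: "distr \<Lambda>' borel \<pi> = \<alpha>"
    if \<pi>: "continuous_on UNIV \<pi>" and \<alpha>: "finite_borel_measure \<alpha>"
      and conv: "\<And>f :: 'm \<Rightarrow> real. continuous_on UNIV f \<Longrightarrow> (\<lambda>n. \<integral>z. f (\<pi> z) \<partial>\<Lambda> n) \<longlonglongrightarrow> (\<integral>x. f x \<partial>\<alpha>)"
    for \<pi> :: "'m \<times> 'm \<Rightarrow> 'm" and \<alpha>
  proof (rule finite_borel_measure_eqI[OF comp _ \<alpha>])
    have pm: "\<pi> \<in> measurable \<Lambda>' borel"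
      using borel_measurable_continuous_onI[OF \<pi>] s by (simp cong: measurable_cong_sets)
    show "finite_borel_measure (distr \<Lambda>' borel \<pi>)"
      using pm m by (intro finite_borel_measureI) (auto simp: emeasure_distr sp)
    fix f :: "'m \<Rightarrow> real" assume f: "continuous_on UNIV f"
    have "continuous_on UNIV (\<lambda>z. f (\<pi> z))"
      by (rule continuous_on_compose2[OF f \<pi>]) auto
    from lim[OF this] have "(\<lambda>n. \<integral>z. f (\<pi> z) \<partial>\<Lambda> (r n)) \<longlonglongrightarrow> (\<integral>z. f (\<pi> z) \<partial>\<Lambda>')" .
    moreover have "(\<lambda>n. \<integral>z. f (\<pi> z) \<partial>\<Lambda> (r n)) \<longlonglongrightarrow> (\<integral>x. f x \<partial>\<alpha>)"
      using LIMSEQ_subseq_LIMSEQ[OF conv[OF f] r] by (simp add: o_def)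
    ultimately have "(\<integral>z. f (\<pi> z) \<partial>\<Lambda>') = (\<integral>x. f x \<partial>\<alpha>)" by (rule LIMSEQ_unique)
    then show "(\<integral>x. f x \<partial>distr \<Lambda>' borel \<pi>) = (\<integral>x. f x \<partial>\<alpha>)"
      using integral_distr[OF pm borel_measurable_continuous_onI[OF f]] by simp
  qed
  have "distr \<Lambda>' borel fst = a" "distr \<Lambda>' borel snd = b"
    by (rule marg[OF _ a], auto intro!: continuous_intros simp: couplings_integral[OF \<Lambda>] a')
       (rule marg[OF _ b], auto intro!: continuous_intros simp: couplings_integral[OF \<Lambda>] b')
  then have "\<Lambda>' \<in> couplings a b" using s by (simp add: couplings_def)
  then show ?thesis using that r lim by blast
qed

section \<open>Minimisers for a continuous cost\<close>

lemma add_measure_prob_mass: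
  assumes "\<mu> \<in> borel_prob_measures" "finite_borel_measure a"
  shows "emeasure (add_measure \<mu> a) UNIV = ennreal (1 + measure a UNIV)"
proof -
  have "finite_borel_measure \<mu>" "emeasure \<mu> UNIV = 1" using assms(1) by (auto simp: borel_prob_measures_def)
  then show ?thesis
    using finite_borel_measureD[of \<mu>] finite_borel_measureD[OF assms(2)] finite_borel_measure_mass[OF assms(2)]
    by (simp add: emeasure_add_measure)
qed

lemma return_borel_prob: "return borel x \<in> borel_prob_measures"
  by (auto simp: borel_prob_measures_def intro!: finite_borel_measureI)

locale continuous_cost =
  fixes D :: "'m::{t2_space, second_countable_topology} \<Rightarrow> 'm \<Rightarrow> real"
  assumes compact_space: "compact (UNIV :: 'm set)"
    and nonneg: "0 \<le> D x y"
    and continuous: "continuous_on UNIV (\<lambda>z. D (fst z) (snd z))"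
begin

definition cost :: "real \<Rightarrow> ('m \<times> 'm) measure \<Rightarrow> real" where
  "cost p \<Lambda> = (\<integral>z. D (fst z) (snd z) powr p \<partial>\<Lambda>)"

lemma compact_space2: "compact (UNIV :: ('m \<times> 'm) set)"
  using compact_Times[OF compact_space compact_space] by simp

lemma continuous_powr: "0 < p \<Longrightarrow> continuous_on UNIV (\<lambda>z. D (fst z) (snd z) powr p)"
  using nonneg by (intro continuous_on_powr' continuous continuous_on_const) auto

lemma cost_nonneg: "0 \<le> cost p \<Lambda>"
  unfolding cost_def by (intro integral_nonneg_AE AE_I2) simp

lemma cost_1: "cost 1 \<Lambda> = (\<integral>z. D (fst z) (snd z) \<partial>\<Lambda>)"
  unfolding cost_def using nonneg by simp

lemma wasserstein_eq: "wasserstein D p a b = (LEAST c. c \<in> (\<lambda>\<Lambda>. cost p \<Lambda> powr (1 / p)) ` couplings a b)"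
  unfolding wasserstein_def cost_def by (simp add: case_prod_beta')

text \<open>The minimum is attained, so \<^const>\<open>wasserstein\<close>, which is defined by \<open>LEAST\<close>, has its intended value.\<close>

lemma wasserstein_min:
  assumes p: "0 < p" and a: "finite_borel_measure a" and b: "finite_borel_measure b"
    and eq: "emeasure a UNIV = emeasure b UNIV"
  shows "\<exists>\<Lambda>\<in>couplings a b. wasserstein D p a b = cost p \<Lambda> powr (1 / p)"
    and "\<And>\<Lambda>. \<Lambda> \<in> couplings a b \<Longrightarrow> wasserstein D p a b \<le> cost p \<Lambda> powr (1 / p)"
proof -
  have "\<exists>\<Lambda>\<in>couplings a b. \<forall>\<Lambda>'\<in>couplings a b. cost p \<Lambda> \<le> cost p \<Lambda>'"
  proof (rule attains_minimum_sequentially)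
    show "couplings a b \<noteq> {}" by (rule couplings_nonempty[OF a b eq])
    fix X :: "nat \<Rightarrow> ('m \<times> 'm) measure" assume X: "\<And>n. X n \<in> couplings a b"
    obtain r \<Lambda> where "strict_mono r" "\<Lambda> \<in> couplings a b"
      "\<And>f :: 'm \<times> 'm \<Rightarrow> real. continuous_on UNIV f \<Longrightarrow> (\<lambda>n. \<integral>z. f z \<partial>X (r n)) \<longlonglongrightarrow> (\<integral>z. f z \<partial>\<Lambda>)"
      by (rule couplings_weak_limit[OF compact_space a b, of X "\<lambda>_. a" "\<lambda>_. b" "measure a UNIV"])
         (auto simp: X finite_borel_measure_mass[OF a])
    then show "\<exists>r \<Lambda>. strict_mono r \<and> \<Lambda> \<in> couplings a b \<and> (\<lambda>n. cost p (X (r n))) \<longlonglongrightarrow> cost p \<Lambda>"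
      unfolding cost_def using continuous_powr[OF p] by blast
  qed (rule cost_nonneg)
  then obtain \<Lambda> where \<Lambda>: "\<Lambda> \<in> couplings a b" "\<And>\<Lambda>'. \<Lambda>' \<in> couplings a b \<Longrightarrow> cost p \<Lambda> \<le> cost p \<Lambda>'"
    by blast
  have le: "cost p \<Lambda> powr (1/p) \<le> cost p \<Lambda>' powr (1/p)" if "\<Lambda>' \<in> couplings a b" for \<Lambda>'
    using \<Lambda>(2)[OF that] cost_nonneg p by (intro powr_mono2) auto
  have W: "wasserstein D p a b = cost p \<Lambda> powr (1 / p)"
    unfolding wasserstein_eq using \<Lambda>(1) le by (intro Least_equality) auto
  show "\<exists>\<Lambda>\<in>couplings a b. wasserstein D p a b = cost p \<Lambda> powr (1 / p)" using W \<Lambda>(1) by blast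
  show "wasserstein D p a b \<le> cost p \<Lambda>' powr (1 / p)" if "\<Lambda>' \<in> couplings a b" for \<Lambda>'
    using W le[OF that] by simp
qed

text \<open>Minimising over \<open>\<mu>\<close> and over the coupling are done in one step, over the set of pairs: a minimising
sequence of pairs has a limit in this set by compactness.\<close>

lemma wasserstein_shift_min:
  assumes p: "0 < p" and a: "finite_borel_measure a" and b: "finite_borel_measure b"
    and eq: "emeasure a UNIV = emeasure b UNIV"
  shows "\<exists>\<mu>\<in>borel_prob_measures. \<forall>\<nu>\<in>borel_prob_measures.
     wasserstein D p (add_measure \<mu> a) (add_measure \<mu> b) \<le> wasserstein D p (add_measure \<nu> a) (add_measure \<nu> b)"
proof -
  have prob: "finite_borel_measure \<mu>" if "\<mu> \<in> borel_prob_measures" for \<mu> :: "'m measure"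
    using that by (simp add: borel_prob_measures_def)
  have fin: "finite_borel_measure (add_measure \<mu> a)" "finite_borel_measure (add_measure \<mu> b)"
    if "\<mu> \<in> borel_prob_measures" for \<mu>
    using finite_borel_measure_add[OF prob[OF that]] a b by auto
  have meq: "emeasure (add_measure \<mu> a) UNIV = emeasure (add_measure \<mu> b) UNIV"
    if "\<mu> \<in> borel_prob_measures" for \<mu>
    using add_measure_prob_mass[OF that a] add_measure_prob_mass[OF that b] eq by (simp add: measure_def)
  define S where "S = (SIGMA \<mu>:borel_prob_measures. couplings (add_measure \<mu> a) (add_measure \<mu> b))"
  have "\<exists>x\<in>S. \<forall>y\<in>S. cost p (snd x) \<le> cost p (snd y)"
  proof (rule attains_minimum_sequentially)
    show "S \<noteq> {}"
      using couplings_nonempty[OF fin meq] return_borel_prob unfolding S_def by blast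
    fix X :: "nat \<Rightarrow> 'm measure \<times> ('m \<times> 'm) measure" assume X: "\<And>n. X n \<in> S"
    define \<mu> where "\<mu> n = fst (X n)" for n
    define \<Lambda> where "\<Lambda> n = snd (X n)" for n
    have \<mu>: "\<mu> n \<in> borel_prob_measures" and \<Lambda>: "\<Lambda> n \<in> couplings (add_measure (\<mu> n) a) (add_measure (\<mu> n) b)" for n
      using X[of n] unfolding S_def \<mu>_def \<Lambda>_def by auto
    obtain r1 \<mu>' where r1: "strict_mono r1" and \<mu>': "sets \<mu>' = sets borel" "emeasure \<mu>' UNIV = ennreal 1"
      and lim1: "\<And>f :: 'm \<Rightarrow> real. continuous_on UNIV f \<Longrightarrow> (\<lambda>n. \<integral>x. f x \<partial>\<mu> (r1 n)) \<longlonglongrightarrow> (\<integral>x. f x \<partial>\<mu>')"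
      by (rule weakly_convergent_subsequence[OF compact_space, of \<mu> 1])
         (use \<mu> in \<open>auto simp: borel_prob_measures_def finite_borel_measure_def\<close>)
    have \<mu>'p: "\<mu>' \<in> borel_prob_measures"
      using \<mu>' by (auto simp: borel_prob_measures_def intro!: finite_borel_measureI)
    have conv: "(\<lambda>n. \<integral>x. f x \<partial>add_measure (\<mu> (r1 n)) c) \<longlonglongrightarrow> (\<integral>x. f x \<partial>add_measure \<mu>' c)"
      if c: "finite_borel_measure c" and f: "continuous_on UNIV f" for c and f :: "'m \<Rightarrow> real"
      using lim1[OF f]
      by (simp add: integral_add_measure[OF compact_space f prob[OF \<mu>] c]
           integral_add_measure[OF compact_space f prob[OF \<mu>'p] c] tendsto_add)
    obtain r2 \<Lambda>' where r2: "strict_mono r2" and \<Lambda>': "\<Lambda>' \<in> couplings (add_measure \<mu>' a) (add_measure \<mu>' b)"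
      and lim2: "\<And>f :: 'm \<times> 'm \<Rightarrow> real. continuous_on UNIV f \<Longrightarrow>
        (\<lambda>n. \<integral>z. f z \<partial>\<Lambda> (r1 (r2 n))) \<longlonglongrightarrow> (\<integral>z. f z \<partial>\<Lambda>')"
      by (rule couplings_weak_limit[OF compact_space fin[OF \<mu>'p], of "\<lambda>n. \<Lambda> (r1 n)"
            "\<lambda>n. add_measure (\<mu> (r1 n)) a" "\<lambda>n. add_measure (\<mu> (r1 n)) b" "1 + measure a UNIV"])
         (use \<Lambda> conv[OF a] conv[OF b] add_measure_prob_mass[OF \<mu> a] in auto)
    have "(\<lambda>n. cost p (snd (X ((r1 \<circ> r2) n)))) \<longlonglongrightarrow> cost p (snd (\<mu>', \<Lambda>'))"
      using lim2[OF continuous_powr[OF p]] by (simp add: cost_def \<Lambda>_def)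
    moreover have "strict_mono (r1 \<circ> r2)" by (rule strict_mono_o[OF r1 r2])
    moreover have "(\<mu>', \<Lambda>') \<in> S" using \<mu>'p \<Lambda>' by (simp add: S_def)
    ultimately show "\<exists>r x. strict_mono r \<and> x \<in> S \<and> (\<lambda>n. cost p (snd (X (r n)))) \<longlonglongrightarrow> cost p (snd x)"
      by blast
  qed (rule cost_nonneg)
  then obtain \<mu> \<Lambda> where "(\<mu>, \<Lambda>) \<in> S" and min: "\<And>\<nu> \<Lambda>'. (\<nu>, \<Lambda>') \<in> S \<Longrightarrow> cost p \<Lambda> \<le> cost p \<Lambda>'"
    by force
  then have \<mu>: "\<mu> \<in> borel_prob_measures" and \<Lambda>: "\<Lambda> \<in> couplings (add_measure \<mu> a) (add_measure \<mu> b)"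
    by (auto simp: S_def)
  show ?thesis
  proof (intro bexI ballI)
    show "\<mu> \<in> borel_prob_measures" by (rule \<mu>)
    fix \<nu> :: "'m measure" assume \<nu>: "\<nu> \<in> borel_prob_measures"
    obtain \<Lambda>' where \<Lambda>': "\<Lambda>' \<in> couplings (add_measure \<nu> a) (add_measure \<nu> b)"
        "wasserstein D p (add_measure \<nu> a) (add_measure \<nu> b) = cost p \<Lambda>' powr (1/p)"
      using wasserstein_min(1)[OF p fin[OF \<nu>] meq[OF \<nu>]] by blast
    have "wasserstein D p (add_measure \<mu> a) (add_measure \<mu> b) \<le> cost p \<Lambda> powr (1/p)"
      by (rule wasserstein_min(2)[OF p fin[OF \<mu>] meq[OF \<mu>] \<Lambda>])
    also have "\<dots> \<le> cost p \<Lambda>' powr (1/p)"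
      using min[of \<nu> \<Lambda>'] \<nu> \<Lambda>'(1) p cost_nonneg by (intro powr_mono2) (auto simp: S_def)
    finally show "wasserstein D p (add_measure \<mu> a) (add_measure \<mu> b)
        \<le> wasserstein D p (add_measure \<nu> a) (add_measure \<nu> b)" using \<Lambda>'(2) by simp
  qed
qed

text \<open>Jensen's inequality for the power \<open>p\<close>, for a measure of arbitrary finite mass. It is proved by
integrating the tangent of \<open>x powr p\<close> at the mean value of \<open>D\<close>.\<close>

lemma cost_1_le_cost:
  assumes p: "1 \<le> p" and \<Lambda>: "finite_borel_measure \<Lambda>"
  shows "cost 1 \<Lambda> \<le> measure \<Lambda> UNIV powr (1 - 1/p) * cost p \<Lambda> powr (1/p)"
proof (cases "cost 1 \<Lambda> > 0")
  case False
  have "0 \<le> measure \<Lambda> UNIV powr (1 - 1/p) * cost p \<Lambda> powr (1/p)" by simp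
  then show ?thesis using False by linarith
next
  case True
  interpret finite_measure \<Lambda> using \<Lambda> by (simp add: finite_borel_measure_def)
  define N where "N = measure \<Lambda> UNIV"
  have sp: "space \<Lambda> = UNIV" using finite_borel_measureD[OF \<Lambda>] by simp
  have i1: "integrable \<Lambda> (\<lambda>z. D (fst z) (snd z))"
    by (rule integrable_continuous_finite_borel[OF compact_space2 continuous \<Lambda>])
  have ip: "integrable \<Lambda> (\<lambda>z. D (fst z) (snd z) powr p)"
    using p by (intro integrable_continuous_finite_borel[OF compact_space2 continuous_powr \<Lambda>]) auto
  have "N \<noteq> 0"
  proof
    assume "N = 0"
    then have "emeasure \<Lambda> UNIV = 0" unfolding N_def by (simp add: emeasure_eq_measure)
    then have "AE z in \<Lambda>. D (fst z) (snd z) = 0"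
      using sp finite_borel_measureD(1)[OF \<Lambda>] by (intro AE_I[of _ _ UNIV]) auto
    then have "cost 1 \<Lambda> = 0" unfolding cost_1 by (rule integral_eq_zero_AE)
    then show False using True by simp
  qed
  then have N: "N > 0" unfolding N_def using measure_nonneg[of \<Lambda> UNIV] by linarith
  \<comment> \<open>the mean value of \<open>D\<close>\<close>
  define s where "s = cost 1 \<Lambda> / N"
  have s: "s > 0" using True N by (simp add: s_def)
  have tangent: "s powr p + p * s powr (p - 1) * (x - s) \<le> x powr p" if "x \<ge> 0" for x
  proof (cases "x = 0")
    case True
    have "s powr (p - 1) * s = s powr p" using powr_mult_base[of s "p - 1"] s by (simp add: mult.commute)
    then have "p * s powr (p - 1) * (x - s) = - p * s powr p" using True by simp
    moreover have "1 * s powr p \<le> p * s powr p" using p by (intro mult_right_mono) auto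
    moreover have "x powr p = 0" using True by simp
    ultimately show ?thesis by linarith
  next
    case False
    have cv: "convex_on {0<..} (\<lambda>x. x powr p)" using p by (rule powr_convex)
    have der: "((\<lambda>x. x powr p) has_real_derivative p * s powr (p - 1)) (at s within {0<..})"
      by (rule has_field_derivative_at_within[OF has_real_derivative_powr[OF s]])
    have "x powr p \<ge> s powr p + p * s powr (p - 1) * (x - s)"
      using convex_on_imp_above_tangent[OF cv _ _ _ der, of x] s that False
      by (simp add: interior_open)
    then show ?thesis .
  qed
  have "N * s powr p = (\<integral>z. s powr p + p * s powr (p - 1) * (D (fst z) (snd z) - s) \<partial>\<Lambda>)"
    using i1 N by (simp add: sp flip: N_def cost_1) (simp add: s_def)
  also have "\<dots> \<le> cost p \<Lambda>"
    unfolding cost_def using i1 ip nonneg tangent by (intro integral_mono) auto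
  finally have "(N * s powr p) powr (1/p) \<le> cost p \<Lambda> powr (1/p)"
    using N p by (intro powr_mono2) auto
  moreover have "(N * s powr p) powr (1/p) = N powr (1/p) * s"
    using N s p by (simp add: powr_mult powr_powr)
  ultimately have le: "N powr (1/p) * s \<le> cost p \<Lambda> powr (1/p)" by simp
  have "cost 1 \<Lambda> = N powr 1 * s" using N by (simp add: s_def)
  also have "\<dots> = N powr (1 - 1/p) * (N powr (1/p) * s)"
    by (simp flip: powr_add mult.assoc)
  also have "\<dots> \<le> N powr (1 - 1/p) * cost p \<Lambda> powr (1/p)"
    using le by (intro mult_left_mono) auto
  finally show ?thesis unfolding N_def .
qed

end

section \<open>Cancelling common mass in a finite transport problem\<close>

text \<open>Think of \<open>\<gamma> u v\<close> as the mass sent from \<open>u\<close> to \<open>v\<close>. At \<open>i\<close>, an amount \<open>w\<close> of the incoming mass is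
sent on directly, without a stop at \<open>i\<close>: it is taken in equal proportion from all sources and
distributed in equal proportion to all targets. This lowers the mass at \<open>i\<close> by \<open>w\<close> on both
sides and by the triangle inequality does not increase the cost. Without a loop at \<open>i\<close> the new flow
is nonnegative.\<close>

lemma flow_bypass_point:
  fixes \<gamma> :: "'b \<Rightarrow> 'b \<Rightarrow> real" and d :: "'b \<Rightarrow> 'b \<Rightarrow> real"
  assumes F: "finite F" "i \<in> F" and \<gamma>: "\<And>u v. 0 \<le> \<gamma> u v"
    and tri: "\<And>u v w. d u w \<le> d u v + d v w"
    and loop: "\<gamma> i i = 0" and w: "0 < w" and "0 \<le> \<alpha>" "0 \<le> \<beta>"
    and out: "(\<Sum>v\<in>F. \<gamma> i v) = w + \<alpha>" and inn: "(\<Sum>u\<in>F. \<gamma> u i) = w + \<beta>"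
  shows "\<exists>\<gamma>'. (\<forall>u\<in>F. \<forall>v\<in>F. 0 \<le> \<gamma>' u v)
    \<and> (\<forall>u\<in>F. (\<Sum>v\<in>F. \<gamma>' u v) = (\<Sum>v\<in>F. \<gamma> u v) - (if u = i then w else 0))
    \<and> (\<forall>v\<in>F. (\<Sum>u\<in>F. \<gamma>' u v) = (\<Sum>u\<in>F. \<gamma> u v) - (if v = i then w else 0))
    \<and> (\<Sum>u\<in>F. \<Sum>v\<in>F. \<gamma>' u v * d u v) \<le> (\<Sum>u\<in>F. \<Sum>v\<in>F. \<gamma> u v * d u v)"
proof -
  \<comment> \<open>the proportions of the sources and of the targets of the flow through \<open>i\<close>\<close>
  define p where "p u = \<gamma> u i / (w + \<beta>)" for u
  define q where "q v = \<gamma> i v / (w + \<alpha>)" for v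
  have pos: "w + \<alpha> > 0" "w + \<beta> > 0" using assms by auto
  have pq: "0 \<le> p u" "0 \<le> q u" for u using \<gamma> pos by (auto simp: p_def q_def)
  have pqi: "p i = 0" "q i = 0" using loop by (auto simp: p_def q_def)
  have sp: "(\<Sum>u\<in>F. p u) = 1" using inn pos unfolding p_def sum_divide_distrib[symmetric] by simp
  have sq: "(\<Sum>v\<in>F. q v) = 1" using out pos unfolding q_def sum_divide_distrib[symmetric] by simp
  have wp: "w * p u \<le> \<gamma> u i" for u
  proof -
    have "w * p u \<le> (w + \<beta>) * p u" using pq assms by (intro mult_right_mono) auto
    then show ?thesis using pos by (simp add: p_def)
  qed
  have wq: "w * q v \<le> \<gamma> i v" for v
  proof -
    have "w * q v \<le> (w + \<alpha>) * q v" using pq assms by (intro mult_right_mono) auto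
    then show ?thesis using pos by (simp add: q_def)
  qed
  define \<gamma>' where "\<gamma>' u v = \<gamma> u v - (if v = i then w * p u else 0) - (if u = i then w * q v else 0)
      + w * p u * q v" for u v
  have "0 \<le> \<gamma>' u v" for u v
    using wp[of u] wq[of v] \<gamma>[of u v] pq w pqi by (auto simp: \<gamma>'_def)
  moreover have "(\<Sum>v\<in>F. \<gamma>' u v) = (\<Sum>v\<in>F. \<gamma> u v) - (if u = i then w else 0)" for u
  proof -
    have "(\<Sum>v\<in>F. \<gamma>' u v) = (\<Sum>v\<in>F. \<gamma> u v) - (\<Sum>v\<in>F. if v = i then w * p u else 0)
        - (\<Sum>v\<in>F. if u = i then w * q v else 0) + (\<Sum>v\<in>F. w * p u * q v)"
      unfolding \<gamma>'_def by (simp add: sum.distrib sum_subtractf)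
    also have "(\<Sum>v\<in>F. if v = i then w * p u else 0) = w * p u" using F by simp
    also have "(\<Sum>v\<in>F. if u = i then w * q v else 0) = (if u = i then w else 0)"
      using sq by (simp flip: sum_distrib_left)
    also have "(\<Sum>v\<in>F. w * p u * q v) = w * p u" using sq by (simp flip: sum_distrib_left)
    finally show ?thesis by simp
  qed
  moreover have "(\<Sum>u\<in>F. \<gamma>' u v) = (\<Sum>u\<in>F. \<gamma> u v) - (if v = i then w else 0)" for v
  proof -
    have "(\<Sum>u\<in>F. \<gamma>' u v) = (\<Sum>u\<in>F. \<gamma> u v) - (\<Sum>u\<in>F. if v = i then w * p u else 0)
        - (\<Sum>u\<in>F. if u = i then w * q v else 0) + (\<Sum>u\<in>F. w * p u * q v)"
      unfolding \<gamma>'_def by (simp add: sum.distrib sum_subtractf)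
    also have "(\<Sum>u\<in>F. if u = i then w * q v else 0) = w * q v" using F by simp
    also have "(\<Sum>u\<in>F. if v = i then w * p u else 0) = (if v = i then w else 0)"
      using sp by (simp flip: sum_distrib_left)
    also have "(\<Sum>u\<in>F. w * p u * q v) = w * q v"
      using sp by (simp flip: sum_distrib_left sum_distrib_right)
    finally show ?thesis by simp
  qed
  moreover have "(\<Sum>u\<in>F. \<Sum>v\<in>F. \<gamma>' u v * d u v) \<le> (\<Sum>u\<in>F. \<Sum>v\<in>F. \<gamma> u v * d u v)"
  proof -
    have "\<gamma>' u v * d u v = \<gamma> u v * d u v - (if v = i then w * p u * d u i else 0)
        - (if u = i then w * q v * d i v else 0) + w * (p u * q v * d u v)" for u v
      by (simp add: \<gamma>'_def algebra_simps)
    then have "(\<Sum>u\<in>F. \<Sum>v\<in>F. \<gamma>' u v * d u v) = (\<Sum>u\<in>F. \<Sum>v\<in>F. \<gamma> u v * d u v)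
        - (\<Sum>u\<in>F. \<Sum>v\<in>F. if v = i then w * p u * d u i else 0)
        - (\<Sum>u\<in>F. \<Sum>v\<in>F. if u = i then w * q v * d i v else 0)
        + (\<Sum>u\<in>F. \<Sum>v\<in>F. w * (p u * q v * d u v))"
      by (simp only: sum.distrib sum_subtractf)
    also have "(\<Sum>u\<in>F. \<Sum>v\<in>F. if v = i then w * p u * d u i else 0) = w * (\<Sum>u\<in>F. p u * d u i)"
      using F by (simp add: sum_distrib_left mult.assoc)
    also have "(\<Sum>u\<in>F. \<Sum>v\<in>F. if u = i then w * q v * d i v else 0) = w * (\<Sum>v\<in>F. q v * d i v)"
      using F by (subst sum.swap) (simp add: sum_distrib_left mult.assoc)
    also have "(\<Sum>u\<in>F. \<Sum>v\<in>F. w * (p u * q v * d u v)) = w * (\<Sum>u\<in>F. \<Sum>v\<in>F. p u * q v * d u v)"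
      by (simp only: sum_distrib_left)
    finally have eq: "(\<Sum>u\<in>F. \<Sum>v\<in>F. \<gamma>' u v * d u v) = (\<Sum>u\<in>F. \<Sum>v\<in>F. \<gamma> u v * d u v)
        - w * (\<Sum>u\<in>F. p u * d u i) - w * (\<Sum>v\<in>F. q v * d i v) + w * (\<Sum>u\<in>F. \<Sum>v\<in>F. p u * q v * d u v)" .
    have "(\<Sum>u\<in>F. \<Sum>v\<in>F. p u * q v * d u v) \<le> (\<Sum>u\<in>F. \<Sum>v\<in>F. p u * q v * (d u i + d i v))"
      using pq tri by (intro sum_mono mult_left_mono) auto
    also have "\<dots> = (\<Sum>u\<in>F. \<Sum>v\<in>F. (p u * d u i) * q v) + (\<Sum>u\<in>F. \<Sum>v\<in>F. p u * (q v * d i v))"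
      by (simp add: algebra_simps sum.distrib)
    also have "\<dots> = (\<Sum>u\<in>F. p u * d u i) + (\<Sum>v\<in>F. q v * d i v)"
      using sp sq by (simp flip: sum_product)
    finally have "w * (\<Sum>u\<in>F. \<Sum>v\<in>F. p u * q v * d u v) \<le> w * ((\<Sum>u\<in>F. p u * d u i) + (\<Sum>v\<in>F. q v * d i v))"
      using w by (intro mult_left_mono) auto
    then show ?thesis unfolding eq by (simp add: distrib_left)
  qed
  ultimately show ?thesis by blast
qed

text \<open>A loop at \<open>i\<close> is common mass that does not move; it is removed first, as far as \<open>w\<close> allows.\<close>

lemma flow_cancel_point:
  fixes \<gamma> :: "'b \<Rightarrow> 'b \<Rightarrow> real" and d :: "'b \<Rightarrow> 'b \<Rightarrow> real"
  assumes F: "finite F" "i \<in> F" and \<gamma>: "\<forall>u\<in>F. \<forall>v\<in>F. 0 \<le> \<gamma> u v"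
    and tri: "\<And>u v w. d u w \<le> d u v + d v w" and d: "\<And>u v. 0 \<le> d u v"
    and w: "0 \<le> w" and "0 \<le> \<alpha>" "0 \<le> \<beta>"
    and out: "(\<Sum>v\<in>F. \<gamma> i v) = w + \<alpha>" and inn: "(\<Sum>u\<in>F. \<gamma> u i) = w + \<beta>"
  shows "\<exists>\<gamma>'. (\<forall>u\<in>F. \<forall>v\<in>F. 0 \<le> \<gamma>' u v)
    \<and> (\<forall>u\<in>F. (\<Sum>v\<in>F. \<gamma>' u v) = (\<Sum>v\<in>F. \<gamma> u v) - (if u = i then w else 0))
    \<and> (\<forall>v\<in>F. (\<Sum>u\<in>F. \<gamma>' u v) = (\<Sum>u\<in>F. \<gamma> u v) - (if v = i then w else 0))
    \<and> (\<Sum>u\<in>F. \<Sum>v\<in>F. \<gamma>' u v * d u v) \<le> (\<Sum>u\<in>F. \<Sum>v\<in>F. \<gamma> u v * d u v)"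
proof -
  define k where "k = min (\<gamma> i i) w"
  define \<gamma>0 where "\<gamma>0 u v = (if u \<in> F \<and> v \<in> F then \<gamma> u v - (if u = i then if v = i then k else 0 else 0) else 0)" for u v
  have k: "0 \<le> k" "k \<le> \<gamma> i i" "k \<le> w" using \<gamma> F w by (auto simp: k_def)
  have nn: "0 \<le> \<gamma>0 u v" for u v using \<gamma> k by (auto simp: \<gamma>0_def)
  have row: "(\<Sum>v\<in>F. \<gamma>0 u v) = (\<Sum>v\<in>F. \<gamma> u v) - (if u = i then k else 0)" if "u \<in> F" for u
    using F that by (simp add: \<gamma>0_def sum_subtractf)
  have col: "(\<Sum>u\<in>F. \<gamma>0 u v) = (\<Sum>u\<in>F. \<gamma> u v) - (if v = i then k else 0)" if "v \<in> F" for v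
    using F that by (simp add: \<gamma>0_def sum_subtractf)
  have cost: "(\<Sum>u\<in>F. \<Sum>v\<in>F. \<gamma>0 u v * d u v) \<le> (\<Sum>u\<in>F. \<Sum>v\<in>F. \<gamma> u v * d u v)"
    using d k by (intro sum_mono mult_right_mono) (auto simp: \<gamma>0_def)
  show ?thesis
  proof (cases "k = w")
    case True
    then show ?thesis using nn row col cost by (intro exI[of _ \<gamma>0]) auto
  next
    case False
    then have kw: "k = \<gamma> i i" "0 < w - k" using k by (auto simp: k_def min_def split: if_splits)
    have "\<exists>\<gamma>'. (\<forall>u\<in>F. \<forall>v\<in>F. 0 \<le> \<gamma>' u v)
      \<and> (\<forall>u\<in>F. (\<Sum>v\<in>F. \<gamma>' u v) = (\<Sum>v\<in>F. \<gamma>0 u v) - (if u = i then w - k else 0))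
      \<and> (\<forall>v\<in>F. (\<Sum>u\<in>F. \<gamma>' u v) = (\<Sum>u\<in>F. \<gamma>0 u v) - (if v = i then w - k else 0))
      \<and> (\<Sum>u\<in>F. \<Sum>v\<in>F. \<gamma>' u v * d u v) \<le> (\<Sum>u\<in>F. \<Sum>v\<in>F. \<gamma>0 u v * d u v)"
      by (rule flow_bypass_point[OF F nn tri _ kw(2) \<open>0 \<le> \<alpha>\<close> \<open>0 \<le> \<beta>\<close>])
         (use F out inn row[OF F(2)] col[OF F(2)] kw(1) in \<open>simp_all add: \<gamma>0_def\<close>)
    then obtain \<gamma>' where \<gamma>': "\<forall>u\<in>F. \<forall>v\<in>F. 0 \<le> \<gamma>' u v"
      "\<forall>u\<in>F. (\<Sum>v\<in>F. \<gamma>' u v) = (\<Sum>v\<in>F. \<gamma>0 u v) - (if u = i then w - k else 0)"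
      "\<forall>v\<in>F. (\<Sum>u\<in>F. \<gamma>' u v) = (\<Sum>u\<in>F. \<gamma>0 u v) - (if v = i then w - k else 0)"
      "(\<Sum>u\<in>F. \<Sum>v\<in>F. \<gamma>' u v * d u v) \<le> (\<Sum>u\<in>F. \<Sum>v\<in>F. \<gamma>0 u v * d u v)" by blast
    show ?thesis
      by (intro exI[of _ \<gamma>'] conjI \<gamma>'(1) order_trans[OF \<gamma>'(4) cost]) (use \<gamma>'(2,3) row col in auto)
  qed
qed

text \<open>The common mass \<open>\<nu>\<close> is removed at one point after the other.\<close>

lemma flow_cancel:
  fixes \<gamma> :: "'b \<Rightarrow> 'b \<Rightarrow> real" and d :: "'b \<Rightarrow> 'b \<Rightarrow> real"
  assumes F: "finite F" and tri: "\<And>u v w. d u w \<le> d u v + d v w" and d: "\<And>u v. 0 \<le> d u v"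
    and a: "\<And>u. 0 \<le> a u" and b: "\<And>u. 0 \<le> b u" and \<nu>: "\<And>u. 0 \<le> \<nu> u"
    and \<gamma>: "\<forall>u\<in>F. \<forall>v\<in>F. 0 \<le> \<gamma> u v"
    and row: "\<forall>u\<in>F. (\<Sum>v\<in>F. \<gamma> u v) = \<nu> u + a u" and col: "\<forall>v\<in>F. (\<Sum>u\<in>F. \<gamma> u v) = \<nu> v + b v"
  shows "\<exists>\<gamma>'. (\<forall>u\<in>F. \<forall>v\<in>F. 0 \<le> \<gamma>' u v)
    \<and> (\<forall>u\<in>F. (\<Sum>v\<in>F. \<gamma>' u v) = a u) \<and> (\<forall>v\<in>F. (\<Sum>u\<in>F. \<gamma>' u v) = b v)
    \<and> (\<Sum>u\<in>F. \<Sum>v\<in>F. \<gamma>' u v * d u v) \<le> (\<Sum>u\<in>F. \<Sum>v\<in>F. \<gamma> u v * d u v)"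
proof -
  have "Z \<subseteq> F \<Longrightarrow> \<exists>\<gamma>'. (\<forall>u\<in>F. \<forall>v\<in>F. 0 \<le> \<gamma>' u v)
    \<and> (\<forall>u\<in>F. (\<Sum>v\<in>F. \<gamma>' u v) = (if u \<in> Z then 0 else \<nu> u) + a u)
    \<and> (\<forall>v\<in>F. (\<Sum>u\<in>F. \<gamma>' u v) = (if v \<in> Z then 0 else \<nu> v) + b v)
    \<and> (\<Sum>u\<in>F. \<Sum>v\<in>F. \<gamma>' u v * d u v) \<le> (\<Sum>u\<in>F. \<Sum>v\<in>F. \<gamma> u v * d u v)" if "finite Z" for Z
    using that
  proof (induction Z rule: finite_induct)
    case empty
    then show ?case using \<gamma> row col by (intro exI[of _ \<gamma>]) auto
  next
    case (insert i Z)
    then obtain \<gamma>1 where \<gamma>1: "\<forall>u\<in>F. \<forall>v\<in>F. 0 \<le> \<gamma>1 u v"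
      "\<forall>u\<in>F. (\<Sum>v\<in>F. \<gamma>1 u v) = (if u \<in> Z then 0 else \<nu> u) + a u"
      "\<forall>v\<in>F. (\<Sum>u\<in>F. \<gamma>1 u v) = (if v \<in> Z then 0 else \<nu> v) + b v"
      "(\<Sum>u\<in>F. \<Sum>v\<in>F. \<gamma>1 u v * d u v) \<le> (\<Sum>u\<in>F. \<Sum>v\<in>F. \<gamma> u v * d u v)" by auto
    have i: "i \<in> F" "i \<notin> Z" using insert by auto
    obtain \<gamma>' where \<gamma>': "\<forall>u\<in>F. \<forall>v\<in>F. 0 \<le> \<gamma>' u v"
      "\<forall>u\<in>F. (\<Sum>v\<in>F. \<gamma>' u v) = (\<Sum>v\<in>F. \<gamma>1 u v) - (if u = i then \<nu> i else 0)"
      "\<forall>v\<in>F. (\<Sum>u\<in>F. \<gamma>' u v) = (\<Sum>u\<in>F. \<gamma>1 u v) - (if v = i then \<nu> i else 0)"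
      "(\<Sum>u\<in>F. \<Sum>v\<in>F. \<gamma>' u v * d u v) \<le> (\<Sum>u\<in>F. \<Sum>v\<in>F. \<gamma>1 u v * d u v)"
      using flow_cancel_point[where d=d, OF F i(1) \<gamma>1(1) tri d \<nu>[of i] a[of i] b[of i]] \<gamma>1(2,3) i
      by auto
    show ?case
      by (intro exI[of _ \<gamma>'] conjI \<gamma>'(1) order_trans[OF \<gamma>'(4) \<gamma>1(4)]) (use \<gamma>'(2,3) \<gamma>1(2,3) i in auto)
  qed
  from this[OF F] show ?thesis by simp
qed

section \<open>Discretisation and the lower bound\<close>

lemma coupling_scale:
  assumes "\<Lambda> \<in> couplings a b"
  shows "scale_measure c \<Lambda> \<in> couplings (scale_measure c a) (scale_measure c b)"
proof -
  note L = couplingsD[OF assms]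
  have "distr (scale_measure c \<Lambda>) borel f = scale_measure c (distr \<Lambda> borel f)"
    if "f \<in> measurable \<Lambda> borel" for f :: "'a \<times> 'a \<Rightarrow> 'a"
    using that by (intro measure_eqI) (auto simp: emeasure_distr space_scale_measure cong: measurable_cong_sets)
  then show ?thesis using L by (simp add: couplings_def)
qed

lemma scale_add_measure:
  assumes "sets b = sets a"
  shows "scale_measure c (add_measure a b) = add_measure (scale_measure c a) (scale_measure c b)"
  using assms by (intro measure_eqI) (auto simp: emeasure_add_measure distrib_left)

text \<open>A Borel map with finite range stands for a finite Borel partition, with one point chosen for each cell.\<close>

definition finite_borel_map :: "('a::topological_space \<Rightarrow> 'a) \<Rightarrow> bool" where
  "finite_borel_map T \<longleftrightarrow> finite (range T) \<and> (\<forall>S. T -` S \<in> sets borel)"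

definition cell :: "('a \<Rightarrow> 'a) \<Rightarrow> 'a measure \<Rightarrow> 'a \<Rightarrow> real" where
  "cell T a u = measure a {x. T x = u}"

definition cell2 :: "('a \<Rightarrow> 'a) \<Rightarrow> ('a \<times> 'a) measure \<Rightarrow> 'a \<Rightarrow> 'a \<Rightarrow> real" where
  "cell2 T \<Lambda> u v = measure \<Lambda> {z. T (fst z) = u \<and> T (snd z) = v}"

lemma finite_borel_map_sets:
  assumes "finite_borel_map T"
  shows "{x. T x = u} \<in> sets borel" 
    and "{z. T (fst z) = u} \<in> sets (borel :: ('a::second_countable_topology \<times> 'a) measure)"
    and "{z. T (snd z) = u} \<in> sets (borel :: ('a \<times> 'a) measure)"
    and "{z. T (fst z) = u \<and> T (snd z) = v} \<in> sets (borel :: ('a \<times> 'a) measure)"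
proof -
  have "T -` {u} \<in> sets borel" for u using assms by (simp add: finite_borel_map_def)
  then show *: "{x. T x = u} \<in> sets borel" for u by (simp add: vimage_def)
  have m: "(fst :: 'a \<times> 'a \<Rightarrow> 'a) \<in> measurable borel borel" "(snd :: 'a \<times> 'a \<Rightarrow> 'a) \<in> measurable borel borel"
    by (intro borel_measurable_continuous_onI continuous_intros)+
  show 1: "{z. T (fst z) = u} \<in> sets (borel :: ('a \<times> 'a) measure)" 
    using measurable_sets[OF m(1) *[of u]] by (simp add: vimage_def)
  have 2: "{z. T (snd z) = v} \<in> sets (borel :: ('a \<times> 'a) measure)" for v
    using measurable_sets[OF m(2) *[of v]] by (simp add: vimage_def)
  show "{z. T (snd z) = u} \<in> sets (borel :: ('a \<times> 'a) measure)" by (rule 2)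
  show "{z. T (fst z) = u \<and> T (snd z) = v} \<in> sets (borel :: ('a \<times> 'a) measure)"
    using sets.Int[OF 1 2[of v]] by (simp add: Collect_conj_eq)
qed

lemma cell2_sums:
  fixes T :: "'a::second_countable_topology \<Rightarrow> 'a"
  assumes T: "finite_borel_map T" and \<Lambda>: "\<Lambda> \<in> couplings a b" and a: "finite_borel_measure a"
  shows "(\<Sum>v\<in>range T. cell2 T \<Lambda> u v) = cell T a u" "(\<Sum>u\<in>range T. cell2 T \<Lambda> u v) = cell T b v"
proof -
  note L = couplingsD[OF \<Lambda>] and S = finite_borel_map_sets[OF T]
  interpret finite_measure \<Lambda> using couplings_finite[OF \<Lambda> a] by (simp add: finite_borel_measure_def)
  have fin: "finite (range T)" using T by (simp add: finite_borel_map_def)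
  have "(\<Sum>v\<in>range T. cell2 T \<Lambda> u v) = measure \<Lambda> (\<Union>v\<in>range T. {z. T (fst z) = u \<and> T (snd z) = v})"
    unfolding cell2_def using L(1) S(4)
    by (intro finite_measure_finite_Union[symmetric] fin) (auto simp: disjoint_family_on_def)
  also have "(\<Union>v\<in>range T. {z. T (fst z) = u \<and> T (snd z) = v}) = fst -` {x. T x = u} \<inter> space \<Lambda>"
    using L(2) by auto
  also have "measure \<Lambda> \<dots> = cell T a u"
    unfolding cell_def using measure_distr[OF L(3) S(1)] L(5) by simp
  finally show "(\<Sum>v\<in>range T. cell2 T \<Lambda> u v) = cell T a u" .
  have "(\<Sum>u\<in>range T. cell2 T \<Lambda> u v) = measure \<Lambda> (\<Union>u\<in>range T. {z. T (fst z) = u \<and> T (snd z) = v})"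
    unfolding cell2_def using L(1) S(4)
    by (intro finite_measure_finite_Union[symmetric] fin) (auto simp: disjoint_family_on_def)
  also have "(\<Union>u\<in>range T. {z. T (fst z) = u \<and> T (snd z) = v}) = snd -` {x. T x = v} \<inter> space \<Lambda>"
    using L(2) by auto
  also have "measure \<Lambda> \<dots> = cell T b v"
    unfolding cell_def using measure_distr[OF L(4) S(1)] L(6) by simp
  finally show "(\<Sum>u\<in>range T. cell2 T \<Lambda> u v) = cell T b v" .
qed

lemma nn_integral_cells:
  fixes T :: "'a::second_countable_topology \<Rightarrow> 'a"
  assumes T: "finite_borel_map T" and L: "finite_borel_measure L" and r: "\<And>u. u \<in> range T \<Longrightarrow> 0 \<le> r u"
  shows "(\<integral>\<^sup>+x. ennreal (r (T x)) \<partial>L) = ennreal (\<Sum>u\<in>range T. r u * cell T L u)"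
proof -
  interpret finite_measure L by (rule finite_borel_measureD[OF L])
  have fin: "finite (range T)" using T by (simp add: finite_borel_map_def)
  have "ennreal (r (T x)) = (\<Sum>u\<in>range T. ennreal (r u) * indicator {x. T x = u} x)" for x
  proof -
    have "(\<Sum>u\<in>range T. ennreal (r u) * indicator {x. T x = u} x) = (\<Sum>u\<in>range T. if u = T x then ennreal (r u) else 0)"
      by (intro sum.cong) (auto simp: indicator_def)
    then show ?thesis using fin by simp
  qed
  then have "(\<integral>\<^sup>+x. ennreal (r (T x)) \<partial>L) = (\<integral>\<^sup>+x. (\<Sum>u\<in>range T. ennreal (r u) * indicator {x. T x = u} x) \<partial>L)"
    by simp
  also have "\<dots> = (\<Sum>u\<in>range T. ennreal (r u) * ennreal (cell T L u))"
    using finite_borel_map_sets(1)[OF T] finite_borel_measureD(1)[OF L]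
    by (subst nn_integral_sum) (auto simp: nn_integral_cmult cell_def emeasure_eq_measure)
  also have "\<dots> = (\<Sum>u\<in>range T. ennreal (r u * cell T L u))"
    using r by (intro sum.cong refl ennreal_mult[symmetric]) (auto simp: cell_def)
  also have "\<dots> = ennreal (\<Sum>u\<in>range T. r u * cell T L u)"
    using r by (intro sum_ennreal) (auto simp: cell_def)
  finally show ?thesis .
qed

text \<open>Inside each product of two cells the mass \<open>\<gamma> u v\<close> is spread proportionally to the product
measure of \<open>a\<close> and \<open>b\<close>. The row and column sums of \<open>\<gamma>\<close> make this a coupling.\<close>

lemma coupling_with_cells:
  fixes a b :: "'a::second_countable_topology measure" and \<gamma> :: "'a \<Rightarrow> 'a \<Rightarrow> real"
  assumes T: "finite_borel_map T" and a: "finite_borel_measure a" and b: "finite_borel_measure b"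
    and \<gamma>: "\<forall>u\<in>range T. \<forall>v\<in>range T. 0 \<le> \<gamma> u v"
    and row: "\<forall>u\<in>range T. (\<Sum>v\<in>range T. \<gamma> u v) = cell T a u"
    and col: "\<forall>v\<in>range T. (\<Sum>u\<in>range T. \<gamma> u v) = cell T b v"
  obtains \<Lambda> where "\<Lambda> \<in> couplings a b" "\<forall>u\<in>range T. \<forall>v\<in>range T. cell2 T \<Lambda> u v = \<gamma> u v"
proof -
  note A = finite_borel_measureD[OF a] and B = finite_borel_measureD[OF b] and S = finite_borel_map_sets[OF T]
  interpret a: finite_measure a by (rule A)
  interpret b: finite_measure b by (rule B)
  interpret ab: pair_sigma_finite a b ..
  define F where "F = range T"
  have fin: "finite F" using T by (simp add: finite_borel_map_def F_def)
  have TF: "T x \<in> F" for x by (simp add: F_def)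
  have \<gamma>: "0 \<le> \<gamma> u v" if "u \<in> F" "v \<in> F" for u v using \<gamma> that unfolding F_def by blast
  have row: "(\<Sum>v\<in>F. \<gamma> u v) = cell T a u" if "u \<in> F" for u using row that unfolding F_def by blast
  have col: "(\<Sum>u\<in>F. \<gamma> u v) = cell T b v" if "v \<in> F" for v using col that unfolding F_def by blast
  have ca: "\<gamma> u v = 0" if "cell T a u = 0" "u \<in> F" "v \<in> F" for u v
    using row[OF that(2)] that(1,3) \<gamma>[OF that(2)] fin by (simp add: sum_nonneg_eq_0_iff)
  have cb: "\<gamma> u v = 0" if "cell T b v = 0" "u \<in> F" "v \<in> F" for u v
    using col[OF that(3)] that(1,2) \<gamma>[OF _ that(3)] fin by (simp add: sum_nonneg_eq_0_iff)
  have cnn: "0 \<le> cell T L u" for L u by (simp add: cell_def)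
  have ec: "emeasure a {x. T x = u} = ennreal (cell T a u)" "emeasure b {x. T x = u} = ennreal (cell T b u)" for u
    by (simp_all add: cell_def a.emeasure_eq_measure b.emeasure_eq_measure)
  \<comment> \<open>On null cells this is 0 by division by 0, in agreement with \<open>ca\<close> and \<open>cb\<close>.\<close>
  define \<rho> where "\<rho> u v = \<gamma> u v / (cell T a u * cell T b v)" for u v
  have \<rho>: "0 \<le> \<rho> u v" if "u \<in> F" "v \<in> F" for u v using \<gamma>[OF that] cnn by (simp add: \<rho>_def)
  define h where "h z = (\<Sum>u\<in>F. \<Sum>v\<in>F. ennreal (\<rho> u v) * indicator {z. T (fst z) = u \<and> T (snd z) = v} z)"
    for z :: "'a \<times> 'a"
  have hm: "h \<in> borel_measurable borel"
    unfolding h_def using S(4) by (intro borel_measurable_sum borel_measurable_times) auto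
  have h: "h (x, y) = ennreal (\<rho> (T x) (T y))" for x y
  proof -
    have "h (x, y) = (\<Sum>u\<in>F. if u = T x then (\<Sum>v\<in>F. if v = T y then ennreal (\<rho> u v) else 0) else 0)"
      unfolding h_def by (intro sum.cong refl) (auto simp: indicator_def intro!: sum.cong sum.neutral)
    then show ?thesis using fin TF by simp
  qed
  have cells_pos: "AE x in L. cell T L (T x) \<noteq> 0" if L: "finite_borel_measure L" for L
  proof -
    have "emeasure L {x. T x = u} = ennreal (cell T L u)" for u
      using finite_borel_measureD(3)[OF L] by (simp add: cell_def finite_measure.emeasure_eq_measure)
    then have "AE x in L. cell T L u = 0 \<longrightarrow> T x \<noteq> u" for u
      using S(1) finite_borel_measureD[OF L]
      by (cases "cell T L u = 0") (auto intro!: AE_I[of _ _ "{x. T x = u}"])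
    then have "AE x in L. \<forall>u\<in>F. cell T L u = 0 \<longrightarrow> T x \<noteq> u"
      using fin by (intro AE_finite_allI) auto
    then show ?thesis using TF by (auto elim!: AE_mp)
  qed
  have inner: "(\<integral>\<^sup>+y. ennreal (\<rho> u (T y)) \<partial>b) = 1" if u: "u \<in> F" "cell T a u \<noteq> 0" for u
  proof -
    have "(\<integral>\<^sup>+y. ennreal (\<rho> u (T y)) \<partial>b) = ennreal (\<Sum>v\<in>F. \<rho> u v * cell T b v)"
      unfolding F_def by (rule nn_integral_cells[OF T b]) (use \<rho> u in \<open>simp add: F_def\<close>)
    also have "(\<Sum>v\<in>F. \<rho> u v * cell T b v) = (\<Sum>v\<in>F. \<gamma> u v / cell T a u)"
      using cb u by (intro sum.cong) (auto simp: \<rho>_def)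
    finally show ?thesis using row u by (simp flip: sum_divide_distrib)
  qed
  have inner2: "(\<integral>\<^sup>+x. ennreal (\<rho> (T x) v) \<partial>a) = 1" if v: "v \<in> F" "cell T b v \<noteq> 0" for v
  proof -
    have "(\<integral>\<^sup>+x. ennreal (\<rho> (T x) v) \<partial>a) = ennreal (\<Sum>u\<in>F. \<rho> u v * cell T a u)"
      unfolding F_def by (rule nn_integral_cells[OF T a, of "\<lambda>u. \<rho> u v"]) (use \<rho> v in \<open>simp add: F_def\<close>)
    also have "(\<Sum>u\<in>F. \<rho> u v * cell T a u) = (\<Sum>u\<in>F. \<gamma> u v / cell T b v)"
      using ca v by (intro sum.cong) (auto simp: \<rho>_def)
    finally show ?thesis using col v by (simp flip: sum_divide_distrib)
  qed
  have cpl: "density (a \<Otimes>\<^sub>M b) h \<in> couplings a b"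
  proof (rule density_coupling[OF a b hm])
    show "AE x in a. (\<integral>\<^sup>+y. h (x, y) \<partial>b) = 1"
      using cells_pos[OF a] by (rule AE_mp) (intro AE_I2 impI, simp add: h inner TF)
    show "AE y in b. (\<integral>\<^sup>+x. h (x, y) \<partial>a) = 1"
      using cells_pos[OF b] by (rule AE_mp) (intro AE_I2 impI, simp add: h inner2 TF)
  qed
  have s: "sets (a \<Otimes>\<^sub>M b) = sets (borel :: ('a \<times> 'a) measure)"
    using sets_pair_measure_cong[OF A(1) B(1)] by (simp only: Binary_Product_Measure.borel_prod)
  have "cell2 T (density (a \<Otimes>\<^sub>M b) h) u v = \<gamma> u v" if uv: "u \<in> F" "v \<in> F" for u v
  proof -
    have "emeasure (density (a \<Otimes>\<^sub>M b) h) {z. T (fst z) = u \<and> T (snd z) = v}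
        = (\<integral>\<^sup>+z. h z * indicator {z. T (fst z) = u \<and> T (snd z) = v} z \<partial>(a \<Otimes>\<^sub>M b))"
    proof (rule emeasure_density)
      show "h \<in> borel_measurable (a \<Otimes>\<^sub>M b)" using hm s by (simp cong: measurable_cong_sets)
      show "{z. T (fst z) = u \<and> T (snd z) = v} \<in> sets (a \<Otimes>\<^sub>M b)" using S(4) s by simp
    qed
    also have "\<dots> = (\<integral>\<^sup>+z. ennreal (\<rho> u v) * indicator ({x. T x = u} \<times> {y. T y = v}) z \<partial>(a \<Otimes>\<^sub>M b))"
    proof (intro nn_integral_cong)
      fix z
      show "h z * indicator {z. T (fst z) = u \<and> T (snd z) = v} z
          = ennreal (\<rho> u v) * indicator ({x. T x = u} \<times> {y. T y = v}) z"
        by (cases z) (simp add: h indicator_def)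
    qed
    also have "\<dots> = ennreal (\<rho> u v) * (ennreal (cell T a u) * ennreal (cell T b v))"
      using S(1) A(1) B(1) by (subst nn_integral_cmult) (auto simp: b.emeasure_pair_measure_Times ec)
    also have "\<dots> = ennreal (\<rho> u v * (cell T a u * cell T b v))"
      using \<rho>[OF uv] cnn by (simp add: ennreal_mult)
    also have "\<rho> u v * (cell T a u * cell T b v) = \<gamma> u v"
      using ca[OF _ uv] cb[OF _ uv] by (auto simp: \<rho>_def)
    finally show ?thesis using \<gamma>[OF uv] by (simp add: cell2_def measure_def)
  qed
  then show ?thesis using that cpl by (auto simp: F_def)
qed

locale continuous_quasimetric = continuous_cost D
  for D :: "'m::{t2_space, second_countable_topology} \<Rightarrow> 'm \<Rightarrow> real" +
  assumes self: "D x x = 0" and triangle: "D x z \<le> D x y + D y z"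
begin

text \<open>Finitely many sets \<open>U c\<close> of points \<open>\<epsilon>\<close>-close to their centre \<open>c\<close> cover the space; \<open>T\<close> sends a point to the
centre of the first of these sets that contains it.\<close>

lemma discretisation:
  assumes "0 < \<epsilon>"
  obtains T where "finite_borel_map T" "\<And>x. D x (T x) < \<epsilon>" "\<And>x. D (T x) x < \<epsilon>"
proof -
  define U where "U c = {x. D x c < \<epsilon> \<and> D c x < \<epsilon>}" for c
  have c1: "continuous_on UNIV (\<lambda>x. D x c)" "continuous_on UNIV (\<lambda>x. D c x)" for c
  proof -
    have "continuous_on UNIV (\<lambda>x. (x, c))" "continuous_on UNIV (\<lambda>x. (c, x))"
      by (intro continuous_intros)+
    then show "continuous_on UNIV (\<lambda>x. D x c)" "continuous_on UNIV (\<lambda>x. D c x)"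
      using continuous_on_compose2[OF continuous, of UNIV "\<lambda>x. (x, c)"]
        continuous_on_compose2[OF continuous, of UNIV "\<lambda>x. (c, x)"] by simp_all
  qed
  have U: "open (U c)" for c
    unfolding U_def Collect_conj_eq using c1
    by (intro open_Int open_Collect_less) (auto intro: continuous_intros)
  have UU: "x \<in> U x" for x using assms self by (simp add: U_def)
  obtain C where C: "finite C" "UNIV \<subseteq> (\<Union>c\<in>C. U c)"
    by (rule compactE_image[OF compact_space, of UNIV U]) (use U UU in auto)
  obtain cs where cs: "set cs = C" using finite_list[OF C(1)] by blast
  have ex: "\<exists>i<length cs. x \<in> U (cs ! i)" for x
  proof -
    have "x \<in> (\<Union>c\<in>C. U c)" using C(2) by blast
    then obtain c where "c \<in> set cs" "x \<in> U c" using cs by blast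
    then show ?thesis unfolding in_set_conv_nth by blast
  qed
  define k where "k x = (LEAST i. i < length cs \<and> x \<in> U (cs ! i))" for x
  have k: "k x < length cs" "x \<in> U (cs ! k x)" for x
    using LeastI_ex[of "\<lambda>i. i < length cs \<and> x \<in> U (cs ! i)"] ex[of x] unfolding k_def by auto
  have kset: "{x. k x = i} \<in> sets borel" for i
  proof (cases "i < length cs")
    case True
    have "k x = i \<longleftrightarrow> x \<in> U (cs ! i) \<and> (\<forall>j<i. x \<notin> U (cs ! j))" for x
    proof
      assume "k x = i"
      then show "x \<in> U (cs ! i) \<and> (\<forall>j<i. x \<notin> U (cs ! j))"
          using k[of x] not_less_Least[of _ "\<lambda>i. i < length cs \<and> x \<in> U (cs ! i)"] unfolding k_def[symmetric]
        by (auto dest: order.strict_trans)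
    next
      assume "x \<in> U (cs ! i) \<and> (\<forall>j<i. x \<notin> U (cs ! j))"
      then show "k x = i" unfolding k_def using True
        by (intro Least_equality) (auto simp: not_less[symmetric])
    qed
    then have "{x. k x = i} = U (cs ! i) \<inter> (\<Inter>j\<in>{..<i}. - U (cs ! j))" by auto
    moreover have "(\<Inter>j\<in>{..<i}. - U (cs ! j)) \<in> sets borel"
      using U by (cases "i = 0") (auto intro!: sets.finite_INT borel_comp)
    ultimately show ?thesis using U by auto
  next
    case False
    then have "{x. k x = i} = {}" using k by auto
    then show ?thesis by simp
  qed
  define T where "T x = cs ! k x" for x
  have "finite (range T)"
    by (rule finite_subset[of _ "set cs"]) (auto simp: T_def k)
  moreover have "T -` S \<in> sets borel" for S
  proof -
    have "T -` S = (\<Union>i\<in>{i. i < length cs \<and> cs ! i \<in> S}. {x. k x = i})"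
      using k(1) by (auto simp: T_def)
    moreover have "(\<Union>i\<in>{i. i < length cs \<and> cs ! i \<in> S}. {x. k x = i}) \<in> sets borel"
      by (rule sets.finite_UN) (simp_all add: kset)
    ultimately show ?thesis by simp
  qed
  ultimately show ?thesis
    using that[of T] k by (auto simp: finite_borel_map_def U_def T_def)
qed

lemma discretised_cost:
  assumes T: "finite_borel_map T" and \<epsilon>: "\<And>x. D x (T x) < \<epsilon>" "\<And>x. D (T x) x < \<epsilon>"
    and \<Lambda>: "finite_borel_measure \<Lambda>"
  shows "\<bar>cost 1 \<Lambda> - (\<Sum>u\<in>range T. \<Sum>v\<in>range T. cell2 T \<Lambda> u v * D u v)\<bar> \<le> 2 * \<epsilon> * measure \<Lambda> UNIV"
proof -
  note L = finite_borel_measureD[OF \<Lambda>]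
  interpret finite_measure \<Lambda> by (rule L)
  have fin: "finite (range T)" using T by (simp add: finite_borel_map_def)
  let ?C = "\<lambda>u v. {z. T (fst z) = u \<and> T (snd z) = v}"
  have S: "?C u v \<in> sets \<Lambda>" for u v using finite_borel_map_sets(4)[OF T] L(1) by simp
  define D' where "D' z = D (T (fst z)) (T (snd z))" for z
  have D': "D' z = (\<Sum>u\<in>range T. \<Sum>v\<in>range T. D u v * indicator (?C u v) z)" for z
  proof -
    have "(\<Sum>u\<in>range T. \<Sum>v\<in>range T. D u v * indicator (?C u v) z)
      = (\<Sum>u\<in>range T. if u = T (fst z) then (\<Sum>v\<in>range T. if v = T (snd z) then D u v else 0) else 0)"
      by (intro sum.cong refl) (auto simp: indicator_def intro!: sum.cong sum.neutral)
    then show ?thesis using fin by (simp add: D'_def)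
  qed
  have iu: "integrable \<Lambda> (\<lambda>z. D u v * indicator (?C u v) z)" for u v
    using S by (intro integrable_mult_right) (auto simp: less_top[symmetric])
  have i': "integrable \<Lambda> D'"
    unfolding D'[abs_def] by (intro Bochner_Integration.integrable_sum iu)
  have i: "integrable \<Lambda> (\<lambda>z. D (fst z) (snd z))"
    by (rule integrable_continuous_finite_borel[OF compact_space2 continuous \<Lambda>])
  have "(\<integral>z. D' z \<partial>\<Lambda>) = (\<Sum>u\<in>range T. \<Sum>v\<in>range T. \<integral>z. D u v * indicator (?C u v) z \<partial>\<Lambda>)"
  proof -
    have "(\<integral>z. D' z \<partial>\<Lambda>) = (\<Sum>u\<in>range T. \<integral>z. (\<Sum>v\<in>range T. D u v * indicator (?C u v) z) \<partial>\<Lambda>)"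
      unfolding D'[abs_def] by (intro Bochner_Integration.integral_sum Bochner_Integration.integrable_sum iu)
    also have "\<dots> = (\<Sum>u\<in>range T. \<Sum>v\<in>range T. \<integral>z. D u v * indicator (?C u v) z \<partial>\<Lambda>)"
      by (rule sum.cong[OF refl], rule Bochner_Integration.integral_sum, rule iu)
    finally show ?thesis .
  qed
  also have "\<dots> = (\<Sum>u\<in>range T. \<Sum>v\<in>range T. cell2 T \<Lambda> u v * D u v)"
    by (simp add: cell2_def L(2) mult.commute)
  finally have int': "(\<integral>z. D' z \<partial>\<Lambda>) = (\<Sum>u\<in>range T. \<Sum>v\<in>range T. cell2 T \<Lambda> u v * D u v)" .
  have le: "D x y \<le> D (T x) (T y) + 2 * \<epsilon>" "D (T x) (T y) \<le> D x y + 2 * \<epsilon>" for x y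
    using triangle[of x y "T x"] triangle[of "T x" y "T y"] triangle[of "T x" "T y" x] triangle[of x "T y" y]
      \<epsilon>[of x] \<epsilon>[of y] by linarith+
  have le': "D (fst z) (snd z) \<le> D' z + 2 * \<epsilon>" "D' z \<le> D (fst z) (snd z) + 2 * \<epsilon>" for z
    using le by (simp_all add: D'_def)
  have "(\<integral>z. D (fst z) (snd z) \<partial>\<Lambda>) \<le> (\<integral>z. D' z + 2 * \<epsilon> \<partial>\<Lambda>)"
    using i i' by (intro integral_mono le') auto
  moreover have "(\<integral>z. D' z \<partial>\<Lambda>) \<le> (\<integral>z. D (fst z) (snd z) + 2 * \<epsilon> \<partial>\<Lambda>)"
    using i i' by (intro integral_mono le') auto
  ultimately show ?thesis using i i' unfolding int'[symmetric] cost_1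
    by (simp add: L(2) abs_le_iff algebra_simps)
qed

text \<open>Adding \<open>\<mu>\<close> on both sides does not lower the cost for \<open>p = 1\<close>. Discretise the given coupling, cancel the
part of \<open>\<mu>\<close> in the finite problem, and lift the result to a coupling of \<open>a\<close> and \<open>b\<close>; the error is
proportional to the mesh \<open>\<epsilon>\<close>.\<close>

lemma wasserstein_1_le_shifted_cost:
  assumes a: "finite_borel_measure a" and b: "finite_borel_measure b" and \<mu>: "finite_borel_measure \<mu>"
    and eq: "emeasure a UNIV = emeasure b UNIV"
    and \<Lambda>: "\<Lambda> \<in> couplings (add_measure \<mu> a) (add_measure \<mu> b)"
  shows "wasserstein D 1 a b \<le> cost 1 \<Lambda>"
proof -
  note A = finite_borel_measureD[OF a] and B = finite_borel_measureD[OF b] and M = finite_borel_measureD[OF \<mu>]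
  have fa: "finite_borel_measure (add_measure \<mu> a)" by (rule finite_borel_measure_add[OF \<mu> a])
  have f\<Lambda>: "finite_borel_measure \<Lambda>" by (rule couplings_finite[OF \<Lambda> fa])
  define K where "K = 2 * (measure a UNIV + measure \<Lambda> UNIV)"
  have K: "0 \<le> K" by (simp add: K_def)
  have bound: "wasserstein D 1 a b \<le> cost 1 \<Lambda> + K * \<epsilon>" if \<epsilon>: "\<epsilon> > 0" for \<epsilon>
  proof -
    obtain T where T: "finite_borel_map T" "\<And>x. D x (T x) < \<epsilon>" "\<And>x. D (T x) x < \<epsilon>"
      using discretisation[OF \<epsilon>] by blast
    have fin: "finite (range T)" using T(1) by (simp add: finite_borel_map_def)
    have cadd: "cell T (add_measure \<mu> c) u = cell T \<mu> u + cell T c u" if c: "finite_borel_measure c" for c u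
    proof -
      have "emeasure (add_measure \<mu> c) {x. T x = u} = emeasure \<mu> {x. T x = u} + emeasure c {x. T x = u}"
        using finite_borel_map_sets(1)[OF T(1)] M finite_borel_measureD[OF c] by (intro emeasure_add_measure) auto
      then show ?thesis
        using M(4) finite_borel_measureD(4)[OF c] 
        by (simp add: cell_def measure_def enn2real_plus less_top)
    qed
    have nn: "0 \<le> cell T c u" "0 \<le> cell2 T \<Lambda> u v" for c u v by (simp_all add: cell_def cell2_def)
    have "\<exists>\<gamma>. (\<forall>u\<in>range T. \<forall>v\<in>range T. 0 \<le> \<gamma> u v)
      \<and> (\<forall>u\<in>range T. (\<Sum>v\<in>range T. \<gamma> u v) = cell T a u) \<and> (\<forall>v\<in>range T. (\<Sum>u\<in>range T. \<gamma> u v) = cell T b v)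
      \<and> (\<Sum>u\<in>range T. \<Sum>v\<in>range T. \<gamma> u v * D u v) \<le> (\<Sum>u\<in>range T. \<Sum>v\<in>range T. cell2 T \<Lambda> u v * D u v)"
      by (rule flow_cancel[where \<nu>="cell T \<mu>"])
         (use fin triangle nonneg nn cell2_sums[OF T(1) \<Lambda> fa] cadd a b in auto)
    then obtain \<gamma> where \<gamma>: "\<forall>u\<in>range T. \<forall>v\<in>range T. 0 \<le> \<gamma> u v"
      "\<forall>u\<in>range T. (\<Sum>v\<in>range T. \<gamma> u v) = cell T a u" "\<forall>v\<in>range T. (\<Sum>u\<in>range T. \<gamma> u v) = cell T b v"
      and le: "(\<Sum>u\<in>range T. \<Sum>v\<in>range T. \<gamma> u v * D u v) \<le> (\<Sum>u\<in>range T. \<Sum>v\<in>range T. cell2 T \<Lambda> u v * D u v)"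
      by blast
    obtain \<Lambda>' where \<Lambda>': "\<Lambda>' \<in> couplings a b" "\<forall>u\<in>range T. \<forall>v\<in>range T. cell2 T \<Lambda>' u v = \<gamma> u v"
      using coupling_with_cells[OF T(1) a b \<gamma>] by blast
    have f\<Lambda>': "finite_borel_measure \<Lambda>'" by (rule couplings_finite[OF \<Lambda>'(1) a])
    have mass: "measure \<Lambda>' UNIV = measure a UNIV" using couplingsD(7)[OF \<Lambda>'(1)] by (simp add: measure_def)
    have "wasserstein D 1 a b \<le> cost 1 \<Lambda>'"
      using wasserstein_min(2)[OF _ a b eq \<Lambda>'(1), of 1] cost_nonneg by simp
    also have "\<dots> \<le> (\<Sum>u\<in>range T. \<Sum>v\<in>range T. \<gamma> u v * D u v) + 2 * \<epsilon> * measure a UNIV"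
      using discretised_cost[OF T f\<Lambda>'] \<Lambda>'(2) mass by simp
    also have "\<dots> \<le> cost 1 \<Lambda> + 2 * \<epsilon> * measure \<Lambda> UNIV + 2 * \<epsilon> * measure a UNIV"
      using discretised_cost[OF T f\<Lambda>] le by simp
    finally show ?thesis by (simp add: K_def algebra_simps)
  qed
  show ?thesis
  proof (rule field_le_epsilon)
    fix e :: real assume e: "0 < e"
    have "wasserstein D 1 a b \<le> cost 1 \<Lambda> + K * (e / (K + 1))"
      using K e by (intro bound) auto
    also have "K * (e / (K + 1)) \<le> e" using K e by (simp add: field_simps)
    finally show "wasserstein D 1 a b \<le> cost 1 \<Lambda> + e" by simp
  qed
qed

text \<open>Multiplied by \<open>n\<close>, an optimal coupling for the shifted measures has the marginals \<open>n \<mu> + a\<close> and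
\<open>n \<mu> + b\<close>, to which the cancellation of common mass applies.\<close>

lemma wasserstein_shift_lower_bound:
  assumes p: "1 \<le> p" and n: "n \<ge> (1::nat)" and a: "finite_borel_measure a" and b: "finite_borel_measure b"
    and eq: "emeasure a UNIV = emeasure b UNIV" and \<mu>: "\<mu> \<in> borel_prob_measures"
  shows "wasserstein D 1 a b \<le> (1 + measure a UNIV / real n) powr (1 - 1/p) *
     (real n * wasserstein D p (add_measure \<mu> (scale_measure (ennreal (1 / real n)) a))
        (add_measure \<mu> (scale_measure (ennreal (1 / real n)) b)))"
proof -
  let ?s = "scale_measure (ennreal (1 / real n))" and ?t = "scale_measure (ennreal (real n))"
  have f\<mu>: "finite_borel_measure \<mu>" using \<mu> by (simp add: borel_prob_measures_def)
  have f: "finite_borel_measure (add_measure \<mu> (?s a))" "finite_borel_measure (add_measure \<mu> (?s b))"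
    by (intro finite_borel_measure_add finite_borel_measure_scale f\<mu> a b)+
  have ma: "emeasure (add_measure \<mu> (?s a)) UNIV = ennreal (1 + measure a UNIV / real n)"
    using add_measure_prob_mass[OF \<mu> finite_borel_measure_scale[OF a]] by simp
  have "emeasure (add_measure \<mu> (?s b)) UNIV = ennreal (1 + measure b UNIV / real n)"
    using add_measure_prob_mass[OF \<mu> finite_borel_measure_scale[OF b]] by simp
  then have meq: "emeasure (add_measure \<mu> (?s a)) UNIV = emeasure (add_measure \<mu> (?s b)) UNIV"
    using ma eq by (simp add: measure_def)
  obtain \<Lambda> where \<Lambda>: "\<Lambda> \<in> couplings (add_measure \<mu> (?s a)) (add_measure \<mu> (?s b))"
    and W: "wasserstein D p (add_measure \<mu> (?s a)) (add_measure \<mu> (?s b)) = cost p \<Lambda> powr (1/p)"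
    using wasserstein_min(1)[OF _ f meq, of p] p by auto
  have f\<Lambda>: "finite_borel_measure \<Lambda>" by (rule couplings_finite[OF \<Lambda> f(1)])
  have m\<Lambda>: "measure \<Lambda> UNIV = 1 + measure a UNIV / real n"
    using couplingsD(7)[OF \<Lambda>] ma by (simp add: measure_def del: ennreal_plus)
  have resc: "?t (add_measure \<mu> (?s c)) = add_measure (?t \<mu>) c" if "finite_borel_measure c" for c
    using n f\<mu> that by (subst scale_add_measure)
      (simp_all add: finite_borel_measure_def scale_scale_measure flip: ennreal_mult)
  have "?t \<Lambda> \<in> couplings (add_measure (?t \<mu>) a) (add_measure (?t \<mu>) b)"
    using coupling_scale[OF \<Lambda>, of "ennreal (real n)"] resc[OF a] resc[OF b] by simp
  then have "wasserstein D 1 a b \<le> cost 1 (?t \<Lambda>)"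
    by (rule wasserstein_1_le_shifted_cost[OF a b finite_borel_measure_scale[OF f\<mu>] eq])
  also have "\<dots> = real n * cost 1 \<Lambda>"
    unfolding cost_1 using borel_measurable_continuous_onI[OF continuous] couplingsD(1)[OF \<Lambda>]
    by (intro integral_scale_measure) (simp_all cong: measurable_cong_sets)
  also have "\<dots> \<le> real n * (measure \<Lambda> UNIV powr (1 - 1/p) * cost p \<Lambda> powr (1/p))"
    by (intro mult_left_mono cost_1_le_cost p f\<Lambda>) auto
  finally show ?thesis unfolding W m\<Lambda> by (simp add: mult_ac)
qed

end

section \<open>Transport in short steps and the upper bound\<close>

primrec sum_measures :: "(nat \<Rightarrow> 'a::topological_space measure) \<Rightarrow> nat \<Rightarrow> 'a measure" where
  "sum_measures M 0 = null_measure borel"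
| "sum_measures M (Suc n) = add_measure (sum_measures M n) (M n)"

lemma sets_sum_measures [simp]: "sets (sum_measures M n) = sets borel"
  by (induction n) simp_all

lemma emeasure_sum_measures:
  assumes "\<And>l. sets (M l) = sets borel" "X \<in> sets borel"
  shows "emeasure (sum_measures M n) X = (\<Sum>l<n. emeasure (M l) X)"
  using assms by (induction n) (simp_all add: emeasure_add_measure)

definition restricted_push :: "'a measure \<Rightarrow> 'a set \<Rightarrow> ('a \<Rightarrow> 'b::topological_space) \<Rightarrow> 'b measure" where
  "restricted_push M A f = distr (density M (indicator A)) borel f"

lemma sets_restricted_push [simp]: "sets (restricted_push M A f) = sets borel"
  by (simp add: restricted_push_def)

lemma emeasure_restricted_push:
  assumes "sets M = sets borel" "A \<in> sets borel" "f \<in> measurable borel borel" "X \<in> sets borel"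
  shows "emeasure (restricted_push M A f) X = emeasure M (A \<inter> f -` X)"
proof -
  have sp: "space M = UNIV" using sets_eq_imp_space_eq[OF assms(1)] by simp
  have f: "f \<in> measurable (density M (indicator A)) borel" using assms(1,3) by (simp cong: measurable_cong_sets)
  have X: "f -` X \<in> sets M" using measurable_sets[OF assms(3,4)] assms(1) by simp
  have "emeasure (restricted_push M A f) X = (\<integral>\<^sup>+x. indicator A x * indicator (f -` X) x \<partial>M)"
    unfolding restricted_push_def using X assms f
    by (subst emeasure_distr[OF f assms(4)]) (simp add: sp emeasure_density)
  also have "\<dots> = (\<integral>\<^sup>+x. indicator (A \<inter> f -` X) x \<partial>M)"
    by (intro nn_integral_cong) (auto simp: indicator_def)
  also have "\<dots> = emeasure M (A \<inter> f -` X)"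
    using X assms(1,2) by (intro nn_integral_indicator) auto
  finally show ?thesis .
qed

lemma sum_Suc_eq_sum_minus_first:
  fixes t :: "nat \<Rightarrow> ennreal"
  assumes "t L = 0"
  shows "(\<Sum>l<L. t (Suc l)) + t 0 = (\<Sum>l<L. t l)"
proof -
  have "(\<Sum>l<L. t l) = (\<Sum>l<Suc L. t l)" using assms by simp
  also have "\<dots> = t 0 + (\<Sum>l<L. t (Suc l))" by (rule sum.lessThan_Suc_shift)
  finally show ?thesis by (simp add: add.commute)
qed

context continuous_quasimetric
begin

text \<open>The relay. A portion of mass on its way from \<open>x\<close> to \<open>y\<close> passes the points \<open>f 0 = x\<close>, then the chain
from \<open>T x\<close> to \<open>T y\<close>, then \<open>f N = y\<close>. The background measure \<open>\<mu>0\<close> puts a copy of the portion at each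
intermediate point, and \<open>\<Gamma>0\<close> moves the copy at \<open>f l\<close> to \<open>f (l + 1)\<close> for all \<open>l < N\<close>. Then the start points
of these moves carry \<open>\<mu>0\<close> and \<open>a\<close>, the end points carry \<open>\<mu>0\<close> and \<open>b\<close>, and each move has length at most
\<open>h\<close>. The hypothesis \<open>mass\<close> says that \<open>\<mu>0\<close> has mass at most 1; the missing mass is put at one point and
stays there.\<close>

lemma shift_along_chains:
  fixes K :: "'m \<Rightarrow> 'm \<Rightarrow> nat" and Z :: "'m \<Rightarrow> 'm \<Rightarrow> nat \<Rightarrow> 'm"
  assumes a: "finite_borel_measure a" and \<Lambda>: "\<Lambda> \<in> couplings a b"
    and T: "finite_borel_map T" and T1: "\<And>x. D x (T x) \<le> h" and T2: "\<And>x. D (T x) x \<le> h" and h: "0 \<le> h"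
    and Z0: "\<And>u v. Z u v 0 = u" and ZK: "\<And>u v. Z u v (K u v) = v"
    and Zs: "\<And>u v i. i < K u v \<Longrightarrow> D (Z u v i) (Z u v (Suc i)) \<le> h"
    and mass: "(\<Sum>u\<in>range T. \<Sum>v\<in>range T. cell2 T \<Lambda> u v * real (K u v + 1)) \<le> 1"
  shows "\<exists>\<mu>\<in>borel_prob_measures. \<exists>\<Gamma>\<in>couplings (add_measure \<mu> a) (add_measure \<mu> b).
           AE z in \<Gamma>. D (fst z) (snd z) \<le> h"
proof -
  note Lm = couplingsD[OF \<Lambda>] and S = finite_borel_map_sets[OF T]
  interpret \<Lambda>: finite_measure \<Lambda> using couplings_finite[OF \<Lambda> a] by (simp add: finite_borel_measure_def)
  define F where "F = range T"
  have fin: "finite F" using T by (simp add: finite_borel_map_def F_def)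
  have TF: "T x \<in> F" for x by (simp add: F_def)
  define C where "C u v = {z. T (fst z) = u \<and> T (snd z) = v}" for u v
  have CS: "C u v \<in> sets borel" for u v using S(4) by (simp add: C_def)
  define N where "N z = K (T (fst z)) (T (snd z)) + 2" for z :: "'m \<times> 'm"
  define f where "f l z = (if l = 0 then fst z
      else if l < N z then Z (T (fst z)) (T (snd z)) (l - 1) else snd z)" for l and z :: "'m \<times> 'm"
  \<comment> \<open>a common bound for the numbers of steps\<close>
  define L where "L = Max ((\<lambda>(u, v). K u v) ` (F \<times> F)) + 2"
  have NL: "N z \<le> L" for z
    using fin TF by (auto simp: N_def L_def intro!: Max_ge)
  have meas_fst: "fst \<in> measurable (borel :: ('m \<times> 'm) measure) borel"
    and meas_snd: "snd \<in> measurable (borel :: ('m \<times> 'm) measure) borel"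
    by (intro borel_measurable_continuous_onI continuous_intros)+
  have by_cells: "{z. Q (T (fst z)) (T (snd z)) z} \<in> sets borel"
    if "\<And>u v. {z. Q u v z} \<in> sets borel" for Q :: "'m \<Rightarrow> 'm \<Rightarrow> 'm \<times> 'm \<Rightarrow> bool"
  proof -
    have "{z. Q (T (fst z)) (T (snd z)) z} = (\<Union>u\<in>F. \<Union>v\<in>F. C u v \<inter> {z. Q u v z})"
      using TF by (auto simp: C_def)
    moreover have "(\<Union>u\<in>F. \<Union>v\<in>F. C u v \<inter> {z. Q u v z}) \<in> sets borel"
      by (intro sets.finite_UN fin sets.Int CS that)
    ultimately show ?thesis by simp
  qed
  have fm: "f l \<in> measurable borel borel" for l
  proof (rule measurableI)
    fix X :: "'m set" assume X: "X \<in> sets borel"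
    have "fst -` X \<in> sets (borel :: ('m \<times> 'm) measure)" "snd -` X \<in> sets (borel :: ('m \<times> 'm) measure)"
      using measurable_sets[OF meas_fst X] measurable_sets[OF meas_snd X] by simp_all
    then have "{z. (if l = 0 then fst z else if l < K u v + 2 then Z u v (l - 1) else snd z) \<in> X} \<in> sets borel" for u v
      by (cases "l = 0"; cases "l < K u v + 2"; cases "Z u v (l - 1) \<in> X") (simp_all add: vimage_def)
    then have "{z. (if l = 0 then fst z else if l < K (T (fst z)) (T (snd z)) + 2
        then Z (T (fst z)) (T (snd z)) (l - 1) else snd z) \<in> X} \<in> sets borel"
      by (rule by_cells[of "\<lambda>u v z. (if l = 0 then fst z else if l < K u v + 2 then Z u v (l - 1) else snd z) \<in> X"])
    then show "f l -` X \<inter> space borel \<in> sets borel"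
      by (simp only: f_def N_def vimage_def space_borel Int_UNIV_right)
  qed simp
  have NS: "{z. R (N z)} \<in> sets borel" for R
    unfolding N_def by (rule by_cells[of "\<lambda>u v _. R (K u v + 2)"]) simp
  have step: "D (f l z) (f (Suc l) z) \<le> h" if lN: "l < N z" for l z
  proof -
    consider "l = 0" | "0 < l" "Suc l < N z" | "0 < l" "Suc l = N z" using lN by linarith
    then show ?thesis
    proof cases
      case 1
      then show ?thesis using T1 by (simp add: f_def N_def Z0)
    next
      case 2
      then obtain j where "l = Suc j" by (cases l) auto
      then show ?thesis using 2 Zs by (simp add: f_def N_def)
    next
      case 3
      then have "l - 1 = K (T (fst z)) (T (snd z))" by (simp add: N_def)
      then show ?thesis using 3 T2 ZK by (simp add: f_def)
    qed
  qed
  define \<mu>0 where "\<mu>0 = sum_measures (\<lambda>l. restricted_push \<Lambda> {z. Suc l < N z} (f (Suc l))) L"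
  define \<Gamma>0 where "\<Gamma>0 = sum_measures (\<lambda>l. restricted_push \<Lambda> {z. l < N z} (\<lambda>z. (f l z, f (Suc l) z))) L"
  have pm: "(\<lambda>z. (f l z, f (Suc l) z)) \<in> measurable borel borel" for l
    using fm by (intro borel_measurable_Pair)
  have em\<mu>: "emeasure \<mu>0 X = (\<Sum>l<L. emeasure \<Lambda> ({z. Suc l < N z} \<inter> f (Suc l) -` X))" if "X \<in> sets borel" for X
    unfolding \<mu>0_def using that
    by (simp add: emeasure_sum_measures emeasure_restricted_push[OF Lm(1) NS fm])
  have em\<Gamma>: "emeasure \<Gamma>0 X = (\<Sum>l<L. emeasure \<Lambda> ({z. l < N z} \<inter> (\<lambda>z. (f l z, f (Suc l) z)) -` X))"
    if "X \<in> sets borel" for X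
    unfolding \<Gamma>0_def using that
    by (simp add: emeasure_sum_measures emeasure_restricted_push[OF Lm(1) NS pm])
  have s0: "sets \<mu>0 = sets borel" "sets \<Gamma>0 = sets borel" by (simp_all add: \<mu>0_def \<Gamma>0_def)
  have vS: "f l -` X \<in> sets borel" if "X \<in> sets borel" for X l
    using measurable_sets[OF fm that, of l] by simp
  have marg1: "emeasure \<Gamma>0 (fst -` X) = emeasure \<mu>0 X + emeasure a X" if X: "X \<in> sets borel" for X
  proof -
    \<comment> \<open>\<open>t 0\<close> is the mass at the start points, the other terms make up the background measure\<close>
    define t where "t l = emeasure \<Lambda> ({z. l < N z} \<inter> f l -` X)" for l
    have e: "{z. L < N z} = {}" using NL by (auto simp: not_less)
    have "t L = 0" unfolding t_def e by simp
    moreover have "t 0 = emeasure a X"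
    proof -
      have "{z. 0 < N z} \<inter> f 0 -` X = fst -` X \<inter> space \<Lambda>" by (auto simp: N_def f_def Lm(2))
      then show ?thesis unfolding t_def using emeasure_distr[OF Lm(3) X] Lm(5) by simp
    qed
    moreover have "emeasure \<Gamma>0 (fst -` X) = (\<Sum>l<L. t l)"
      using em\<Gamma>[of "fst -` X"] measurable_sets[OF meas_fst X] by (simp add: t_def vimage_def)
    moreover have "emeasure \<mu>0 X = (\<Sum>l<L. t (Suc l))" using em\<mu>[OF X] by (simp add: t_def)
    ultimately show ?thesis using sum_Suc_eq_sum_minus_first[of t L] by simp
  qed
  have marg2: "emeasure \<Gamma>0 (snd -` X) = emeasure \<mu>0 X + emeasure b X" if X: "X \<in> sets borel" for X
  proof -
    have sX: "snd -` X \<in> sets (borel :: ('m \<times> 'm) measure)" using measurable_sets[OF meas_snd X] by simp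
    have "emeasure \<Lambda> ({z. l < N z} \<inter> f (Suc l) -` X)
      = emeasure \<Lambda> ({z. Suc l < N z} \<inter> f (Suc l) -` X) + emeasure \<Lambda> ({z. Suc l = N z} \<inter> snd -` X)" for l
    proof -
      have "{z. l < N z} \<inter> f (Suc l) -` X = ({z. Suc l < N z} \<inter> f (Suc l) -` X) \<union> ({z. Suc l = N z} \<inter> snd -` X)"
        by (auto simp: f_def)
      moreover have "{z. Suc l < N z} \<inter> f (Suc l) -` X \<in> sets \<Lambda>" "{z. Suc l = N z} \<inter> snd -` X \<in> sets \<Lambda>"
        using Lm(1) NS vS[OF X] sX by auto
      ultimately show ?thesis by (subst plus_emeasure) auto
    qed
    moreover have "emeasure \<Gamma>0 (snd -` X) = (\<Sum>l<L. emeasure \<Lambda> ({z. l < N z} \<inter> f (Suc l) -` X))"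
      using em\<Gamma>[OF sX] by (simp add: vimage_def)
    ultimately have "emeasure \<Gamma>0 (snd -` X) = emeasure \<mu>0 X + (\<Sum>l<L. emeasure \<Lambda> ({z. Suc l = N z} \<inter> snd -` X))"
      using em\<mu>[OF X] by (simp add: sum.distrib)
    also have "(\<Sum>l<L. emeasure \<Lambda> ({z. Suc l = N z} \<inter> snd -` X))
        = emeasure \<Lambda> (\<Union>l\<in>{..<L}. {z. Suc l = N z} \<inter> snd -` X)"
      using Lm(1) NS sX by (intro sum_emeasure) (auto simp: disjoint_family_on_def)
    also have "(\<Union>l\<in>{..<L}. {z. Suc l = N z} \<inter> snd -` X) = snd -` X \<inter> space \<Lambda>"
    proof -
      have "\<exists>l\<in>{..<L}. Suc l = N z" for z
        using NL[of z] by (intro bexI[of _ "N z - 1"]) (auto simp: N_def)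
      then have "z \<in> (\<Union>l\<in>{..<L}. {z. Suc l = N z} \<inter> snd -` X)" if "snd z \<in> X" for z
        using that by blast
      then show ?thesis using Lm(2) by auto
    qed
    also have "emeasure \<Lambda> \<dots> = emeasure b X" using emeasure_distr[OF Lm(4) X] Lm(6) by simp
    finally show ?thesis .
  qed
  have mass0: "emeasure \<mu>0 UNIV \<le> 1"
  proof -
    have "emeasure \<mu>0 UNIV = (\<Sum>l<L. emeasure \<Lambda> {z. Suc l < N z})" using em\<mu>[of UNIV] by simp
    also have "\<dots> = ennreal (\<Sum>l<L. measure \<Lambda> {z. Suc l < N z})"
      by (simp add: \<Lambda>.emeasure_eq_measure sum_ennreal)
    also have "(\<Sum>l<L. measure \<Lambda> {z. Suc l < N z}) = (\<Sum>l<L. \<Sum>q\<in>F \<times> F. if l < K (fst q) (snd q) + 1 then cell2 T \<Lambda> (fst q) (snd q) else 0)"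
    proof (rule sum.cong[OF refl])
      fix l
      let ?I = "{q \<in> F \<times> F. l < K (fst q) (snd q) + 1}"
      have "{z. Suc l < N z} = (\<Union>q\<in>?I. C (fst q) (snd q))"
        using TF by (auto simp: N_def C_def)
      moreover have "measure \<Lambda> (\<Union>q\<in>?I. C (fst q) (snd q)) = (\<Sum>q\<in>?I. measure \<Lambda> (C (fst q) (snd q)))"
        using fin CS Lm(1)
        by (intro \<Lambda>.finite_measure_finite_Union) (auto simp: disjoint_family_on_def C_def)
      moreover have "\<dots> = (\<Sum>q\<in>F \<times> F. if l < K (fst q) (snd q) + 1 then cell2 T \<Lambda> (fst q) (snd q) else 0)"
        using fin by (simp add: sum.inter_filter[symmetric] cell2_def C_def)
      ultimately show "measure \<Lambda> {z. Suc l < N z} = (\<Sum>q\<in>F \<times> F. if l < K (fst q) (snd q) + 1 then cell2 T \<Lambda> (fst q) (snd q) else 0)"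
        by simp
    qed
    also have "\<dots> = (\<Sum>q\<in>F \<times> F. \<Sum>l<L. if l < K (fst q) (snd q) + 1 then cell2 T \<Lambda> (fst q) (snd q) else 0)"
      by (rule sum.swap)
    also have "\<dots> = (\<Sum>q\<in>F \<times> F. cell2 T \<Lambda> (fst q) (snd q) * real (K (fst q) (snd q) + 1))"
    proof (rule sum.cong[OF refl])
      fix q assume "q \<in> F \<times> F"
      then have "K (fst q) (snd q) \<le> Max ((\<lambda>(u, v). K u v) ` (F \<times> F))"
        using fin by (intro Max_ge) (auto simp: case_prod_beta')
      then have "{l \<in> {..<L}. l < K (fst q) (snd q) + 1} = {..<K (fst q) (snd q) + 1}"
        by (auto simp: L_def)
      then have "(\<Sum>l<L. if l < K (fst q) (snd q) + 1 then cell2 T \<Lambda> (fst q) (snd q) else 0)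
          = (\<Sum>l<K (fst q) (snd q) + 1. cell2 T \<Lambda> (fst q) (snd q))"
        by (simp only: sum.inter_filter[OF finite_lessThan, symmetric])
      then show "(\<Sum>l<L. if l < K (fst q) (snd q) + 1 then cell2 T \<Lambda> (fst q) (snd q) else 0)
          = cell2 T \<Lambda> (fst q) (snd q) * real (K (fst q) (snd q) + 1)"
        by (simp add: mult.commute)
    qed
    also have "\<dots> = (\<Sum>u\<in>F. \<Sum>v\<in>F. cell2 T \<Lambda> u v * real (K u v + 1))"
      by (simp only: sum.cartesian_product case_prod_beta')
    finally show ?thesis using mass by (simp add: F_def)
  qed
  define r where "r = 1 - emeasure \<mu>0 UNIV"
  have r: "emeasure \<mu>0 UNIV + r = 1" unfolding r_def using mass0 by (rule add_diff_inverse_ennreal)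
  define x0 :: 'm where "x0 = undefined"
  define \<mu> where "\<mu> = add_measure \<mu>0 (scale_measure r (return borel x0))"
  define \<Gamma> where "\<Gamma> = add_measure \<Gamma>0 (scale_measure r (return borel (x0, x0)))"
  have e\<mu>: "emeasure \<mu> X = emeasure \<mu>0 X + r * indicator X x0" if "X \<in> sets borel" for X
    unfolding \<mu>_def using that s0 by (simp add: emeasure_add_measure)
  have e\<Gamma>: "emeasure \<Gamma> X = emeasure \<Gamma>0 X + r * indicator X (x0, x0)" if "X \<in> sets borel" for X
    unfolding \<Gamma>_def using that s0 by (simp add: emeasure_add_measure)
  have s\<mu>: "sets \<mu> = sets borel" and s\<Gamma>: "sets \<Gamma> = sets borel" by (simp_all add: \<mu>_def \<Gamma>_def s0)
  have \<mu>p: "\<mu> \<in> borel_prob_measures"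
    using e\<mu>[of UNIV] r s\<mu> by (auto simp: borel_prob_measures_def intro!: finite_borel_measureI)
  have sp\<Gamma>: "space \<Gamma> = UNIV" using sets_eq_imp_space_eq[OF s\<Gamma>] by simp
  have mf: "fst \<in> measurable \<Gamma> borel" "snd \<in> measurable \<Gamma> borel"
    using meas_fst meas_snd s\<Gamma> by (simp_all cong: measurable_cong_sets)
  have sb: "sets b = sets borel" using Lm(6) by (metis sets_distr)
  have sa: "sets a = sets borel" using Lm(5) by (metis sets_distr)
  have "distr \<Gamma> borel fst = add_measure \<mu> a"
  proof (rule measure_eqI)
    fix X assume "X \<in> sets (distr \<Gamma> borel fst)"
    then have X: "X \<in> sets borel" by simp
    have "emeasure (distr \<Gamma> borel fst) X = emeasure \<Gamma> (fst -` X)"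
      using X mf by (simp add: emeasure_distr sp\<Gamma>)
    also have "\<dots> = emeasure \<mu>0 X + emeasure a X + r * indicator X x0"
      using e\<Gamma>[of "fst -` X"] marg1[OF X] measurable_sets[OF meas_fst X] by (simp add: indicator_def)
    also have "\<dots> = emeasure (add_measure \<mu> a) X"
      using e\<mu>[OF X] X s\<mu> sa by (simp add: emeasure_add_measure ac_simps)
    finally show "emeasure (distr \<Gamma> borel fst) X = emeasure (add_measure \<mu> a) X" .
  qed (simp add: s\<mu>)
  moreover have "distr \<Gamma> borel snd = add_measure \<mu> b"
  proof (rule measure_eqI)
    fix X assume "X \<in> sets (distr \<Gamma> borel snd)"
    then have X: "X \<in> sets borel" by simp
    have "emeasure (distr \<Gamma> borel snd) X = emeasure \<Gamma> (snd -` X)"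
      using X mf by (simp add: emeasure_distr sp\<Gamma>)
    also have "\<dots> = emeasure \<mu>0 X + emeasure b X + r * indicator X x0"
      using e\<Gamma>[of "snd -` X"] marg2[OF X] measurable_sets[OF meas_snd X] by (simp add: indicator_def)
    also have "\<dots> = emeasure (add_measure \<mu> b) X"
      using e\<mu>[OF X] X s\<mu> sb by (simp add: emeasure_add_measure ac_simps)
    finally show "emeasure (distr \<Gamma> borel snd) X = emeasure (add_measure \<mu> b) X" .
  qed (simp add: s\<mu>)
  ultimately have \<Gamma>c: "\<Gamma> \<in> couplings (add_measure \<mu> a) (add_measure \<mu> b)"
    using s\<Gamma> by (simp add: couplings_def)
  have DS: "{z. \<not> D (fst z) (snd z) \<le> h} \<in> sets borel"
    using continuous by (intro borel_open) (auto simp: not_le intro!: open_Collect_less continuous_intros)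
  have "emeasure \<Gamma>0 {z. \<not> D (fst z) (snd z) \<le> h} = (\<Sum>l<L. 0)"
    unfolding em\<Gamma>[OF DS]
  proof (rule sum.cong[OF refl])
    fix l
    have "{z. l < N z} \<inter> (\<lambda>z. (f l z, f (Suc l) z)) -` {z. \<not> D (fst z) (snd z) \<le> h} = {}"
      using step by auto
    then show "emeasure \<Lambda> ({z. l < N z} \<inter> (\<lambda>z. (f l z, f (Suc l) z)) -` {z. \<not> D (fst z) (snd z) \<le> h}) = 0"
      by (simp only: emeasure_empty)
  qed
  then have "emeasure \<Gamma> {z. \<not> D (fst z) (snd z) \<le> h} = 0"
    using e\<Gamma>[OF DS] self[of x0] h by simp
  then have "AE z in \<Gamma>. D (fst z) (snd z) \<le> h"
    using DS s\<Gamma> by (intro AE_I[of _ _ "{z. \<not> D (fst z) (snd z) \<le> h}"]) auto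
  then show ?thesis using \<mu>p \<Gamma>c by blast
qed

end

text \<open>The axiom \<open>chain\<close> is an approximate form of being a length space: points can be joined by chains of
steps of length about \<open>h\<close> whose number is about \<open>D x y / h\<close>.\<close>

locale length_quasimetric = continuous_quasimetric D
  for D :: "'m::{t2_space, second_countable_topology} \<Rightarrow> 'm \<Rightarrow> real" +
  assumes chain: "0 < h \<Longrightarrow> h < h' \<Longrightarrow> \<exists>(k::nat) z. z 0 = x \<and> z k = y \<and>
     (\<forall>i<k. D (z i) (z (Suc i)) \<le> h') \<and> real k \<le> D x y / h + 1"
begin

text \<open>The chains have steps of length at most \<open>H'/n\<close>, and there are at most \<open>D u v / (H/n) + 1\<close> of
them between \<open>u\<close> and \<open>v\<close>. The hypothesis \<open>small\<close> leaves room for the discretisation error when the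
intermediate points are given mass in total at most 1.\<close>

lemma wasserstein_shift_upper_bound:
  assumes p: "1 \<le> p" and n: "n \<ge> (1::nat)" and a: "finite_borel_measure a" and b: "finite_borel_measure b"
    and eq: "emeasure a UNIV = emeasure b UNIV"
    and H: "wasserstein D 1 a b < H" "H < H'" and small: "wasserstein D 1 a b / H + 2 * measure a UNIV / real n < 1"
  shows "\<exists>\<mu>\<in>borel_prob_measures. real n * wasserstein D p (add_measure \<mu> (scale_measure (ennreal (1 / real n)) a))
        (add_measure \<mu> (scale_measure (ennreal (1 / real n)) b))
      \<le> H' * (1 + measure a UNIV / real n) powr (1/p)"
proof -
  let ?s = "scale_measure (ennreal (1 / real n))"
  define W m where "W = wasserstein D 1 a b" and "m = measure a UNIV"
  have m: "0 \<le> m" by (simp add: m_def)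
  have fs: "finite_borel_measure (?s a)" "finite_borel_measure (?s b)"
    by (intro finite_borel_measure_scale a b)+
  obtain \<Lambda>1 where \<Lambda>1: "\<Lambda>1 \<in> couplings a b" and W1: "W = cost 1 \<Lambda>1"
    using wasserstein_min(1)[OF _ a b eq, of 1] cost_nonneg unfolding W_def by auto
  have W0: "0 \<le> W" using W1 cost_nonneg by simp
  have Hpos: "0 < H" using W0 H by (simp add: W_def)
  have f\<Lambda>1: "finite_borel_measure \<Lambda>1" by (rule couplings_finite[OF \<Lambda>1 a])
  have m\<Lambda>1: "measure \<Lambda>1 UNIV = m" using couplingsD(7)[OF \<Lambda>1] by (simp add: measure_def m_def)
  define \<delta> where "\<delta> = 1 - (W / H + 2 * m / real n)"
  have \<delta>: "\<delta> > 0" using small by (simp add: \<delta>_def W_def m_def)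
  \<comment> \<open>The first bound makes the way to a centre one step, the second keeps the discretisation error below \<open>\<delta>\<close>.\<close>
  define \<epsilon> where "\<epsilon> = min (H' / real n) (\<delta> * H / (2 * (m + 1)))"
  have \<epsilon>: "\<epsilon> > 0" "\<epsilon> \<le> H' / real n" "\<epsilon> \<le> \<delta> * H / (2 * (m + 1))"
    using H Hpos n \<delta> m by (auto simp: \<epsilon>_def)
  obtain T where T: "finite_borel_map T" "\<And>x. D x (T x) < \<epsilon>" "\<And>x. D (T x) x < \<epsilon>"
    using discretisation[OF \<epsilon>(1)] by blast
  have "\<forall>q. \<exists>kz. snd kz 0 = fst q \<and> snd kz (fst kz) = snd q \<and>
     (\<forall>i<fst kz. D (snd kz i) (snd kz (Suc i)) \<le> H' / real n) \<and> real (fst kz) \<le> D (fst q) (snd q) / (H / real n) + 1"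
  proof
    fix q :: "'m \<times> 'm"
    have "0 < H / real n" "H / real n < H' / real n"
      using Hpos n H by (auto simp: divide_strict_right_mono)
    from chain[OF this, of "fst q" "snd q"] obtain k :: nat and z where "z 0 = fst q" "z k = snd q"
      "\<forall>i<k. D (z i) (z (Suc i)) \<le> H' / real n" "real k \<le> D (fst q) (snd q) / (H / real n) + 1" by blast
    then show "\<exists>kz. snd kz 0 = fst q \<and> snd kz (fst kz) = snd q \<and>
     (\<forall>i<fst kz. D (snd kz i) (snd kz (Suc i)) \<le> H' / real n) \<and> real (fst kz) \<le> D (fst q) (snd q) / (H / real n) + 1"
      by (intro exI[of _ "(k, z)"]) simp
  qed
  from choice[OF this] obtain KZ where KZ: "\<forall>q. snd (KZ q) 0 = fst q \<and> snd (KZ q) (fst (KZ q)) = snd q \<and>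
     (\<forall>i<fst (KZ q). D (snd (KZ q) i) (snd (KZ q) (Suc i)) \<le> H' / real n) \<and>
     real (fst (KZ q)) \<le> D (fst q) (snd q) / (H / real n) + 1" ..
  define K where "K u v = fst (KZ (u, v))" for u v
  define Z where "Z u v = snd (KZ (u, v))" for u v
  have Z: "Z u v 0 = u" "Z u v (K u v) = v" "\<And>i. i < K u v \<Longrightarrow> D (Z u v i) (Z u v (Suc i)) \<le> H' / real n"
    and K: "real (K u v) \<le> D u v / (H / real n) + 1" for u v
    using KZ[rule_format, of "(u, v)"] by (auto simp: K_def Z_def)
  let ?\<Lambda> = "?s \<Lambda>1"
  have \<Lambda>: "?\<Lambda> \<in> couplings (?s a) (?s b)" by (rule coupling_scale[OF \<Lambda>1])
  have c2: "cell2 T ?\<Lambda> u v = cell2 T \<Lambda>1 u v / real n" for u v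
    by (simp add: cell2_def)
  have c2nn: "0 \<le> cell2 T \<Lambda>1 u v" for u v by (simp add: cell2_def)
  have total: "(\<Sum>u\<in>range T. \<Sum>v\<in>range T. cell2 T \<Lambda>1 u v) = m"
  proof -
    have "(\<Sum>u\<in>range T. \<Sum>v\<in>range T. cell2 T \<Lambda>1 u v) = (\<Sum>u\<in>range T. cell T a u)"
      by (simp add: cell2_sums(1)[OF T(1) \<Lambda>1 a])
    also have "\<dots> = measure a (\<Union>u\<in>range T. {x. T x = u})"
      unfolding cell_def using T(1) finite_borel_map_sets(1)[OF T(1)] finite_borel_measureD[OF a]
      by (intro finite_measure.finite_measure_finite_Union[symmetric])
         (auto simp: finite_borel_map_def disjoint_family_on_def)
    also have "(\<Union>u\<in>range T. {x. T x = u}) = UNIV" by auto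
    finally show ?thesis by (simp add: m_def)
  qed
  have "(\<Sum>u\<in>range T. \<Sum>v\<in>range T. cell2 T ?\<Lambda> u v * real (K u v + 1))
      \<le> (\<Sum>u\<in>range T. \<Sum>v\<in>range T. cell2 T \<Lambda>1 u v * D u v / H + 2 / real n * cell2 T \<Lambda>1 u v)"
  proof (intro sum_mono)
    fix u v
    have "cell2 T ?\<Lambda> u v * real (K u v + 1) \<le> cell2 T ?\<Lambda> u v * (D u v / (H / real n) + 2)"
      using K[of u v] c2nn c2 by (intro mult_left_mono) auto
    also have "\<dots> = cell2 T \<Lambda>1 u v * D u v / H + 2 / real n * cell2 T \<Lambda>1 u v"
      using n Hpos by (simp add: c2 field_simps)
    finally show "cell2 T ?\<Lambda> u v * real (K u v + 1) \<le> cell2 T \<Lambda>1 u v * D u v / H + 2 / real n * cell2 T \<Lambda>1 u v" .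
  qed
  also have "\<dots> = (\<Sum>u\<in>range T. \<Sum>v\<in>range T. cell2 T \<Lambda>1 u v * D u v) / H + 2 / real n * m"
    unfolding total[symmetric] by (simp add: sum.distrib sum_divide_distrib sum_distrib_left)
  also have "\<dots> \<le> (W + 2 * \<epsilon> * m) / H + 2 / real n * m"
    using discretised_cost[OF T f\<Lambda>1] Hpos W1 m\<Lambda>1 by (intro add_mono divide_right_mono) auto
  also have "\<dots> \<le> 1"
  proof -
    have "2 * \<epsilon> * m \<le> 2 * \<epsilon> * (m + 1)" using \<epsilon>(1) by simp
    also have "\<dots> \<le> \<delta> * H" using \<epsilon>(3) m by (simp add: field_simps)
    finally have "2 * \<epsilon> * m / H \<le> \<delta>" using Hpos by (simp add: divide_le_eq)
    then show ?thesis by (simp add: \<delta>_def add_divide_distrib)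
  qed
  finally have mass: "(\<Sum>u\<in>range T. \<Sum>v\<in>range T. cell2 T ?\<Lambda> u v * real (K u v + 1)) \<le> 1" .
  have h0: "0 \<le> H' / real n" using H Hpos by simp
  have "\<exists>\<mu>\<in>borel_prob_measures. \<exists>\<Gamma>\<in>couplings (add_measure \<mu> (?s a)) (add_measure \<mu> (?s b)).
           AE z in \<Gamma>. D (fst z) (snd z) \<le> H' / real n"
  proof (rule shift_along_chains[OF fs(1) \<Lambda> T(1) _ _ h0 Z mass])
    show "D x (T x) \<le> H' / real n" "D (T x) x \<le> H' / real n" for x
      using T(2,3)[of x] \<epsilon>(2) by linarith+
  qed
  then obtain \<mu> \<Gamma> where \<mu>: "\<mu> \<in> borel_prob_measures"
    and \<Gamma>: "\<Gamma> \<in> couplings (add_measure \<mu> (?s a)) (add_measure \<mu> (?s b))"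
    and AE: "AE z in \<Gamma>. D (fst z) (snd z) \<le> H' / real n" by blast
  have f\<mu>: "finite_borel_measure \<mu>" using \<mu> by (simp add: borel_prob_measures_def)
  have fadd: "finite_borel_measure (add_measure \<mu> (?s a))" "finite_borel_measure (add_measure \<mu> (?s b))"
    by (intro finite_borel_measure_add f\<mu> fs)+
  have f\<Gamma>: "finite_borel_measure \<Gamma>" by (rule couplings_finite[OF \<Gamma> fadd(1)])
  interpret \<Gamma>: finite_measure \<Gamma> using f\<Gamma> by (simp add: finite_borel_measure_def)
  have meq: "emeasure (add_measure \<mu> (?s a)) UNIV = emeasure (add_measure \<mu> (?s b)) UNIV"
    using couplingsD(7,8)[OF \<Gamma>] by simp
  have m\<Gamma>: "measure \<Gamma> (space \<Gamma>) = 1 + m / real n"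
    using couplingsD(2,7)[OF \<Gamma>] add_measure_prob_mass[OF \<mu> fs(1)]
    by (simp add: measure_def m_def enn2real_mult del: ennreal_plus)
  have "cost p \<Gamma> \<le> (\<integral>z. (H' / real n) powr p \<partial>\<Gamma>)"
    unfolding cost_def
  proof (rule integral_mono_AE)
    show "integrable \<Gamma> (\<lambda>z. D (fst z) (snd z) powr p)"
      using p by (intro integrable_continuous_finite_borel[OF compact_space2 continuous_powr f\<Gamma>]) auto
    show "AE z in \<Gamma>. D (fst z) (snd z) powr p \<le> (H' / real n) powr p"
      using AE by (rule AE_mp) (use p nonneg in \<open>auto intro!: AE_I2 powr_mono2\<close>)
  qed auto
  also have "\<dots> = (1 + m / real n) * (H' / real n) powr p" using m\<Gamma> by simp
  finally have "cost p \<Gamma> powr (1/p) \<le> ((1 + m / real n) * (H' / real n) powr p) powr (1/p)"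
    using p cost_nonneg by (intro powr_mono2) auto
  also have "\<dots> = (1 + m / real n) powr (1/p) * (H' / real n)"
    using p m h0 n H Hpos by (simp add: powr_mult powr_powr)
  finally have "wasserstein D p (add_measure \<mu> (?s a)) (add_measure \<mu> (?s b)) \<le> (1 + m / real n) powr (1/p) * (H' / real n)"
    using wasserstein_min(2)[OF _ fadd meq \<Gamma>, of p] p by simp
  then have "real n * wasserstein D p (add_measure \<mu> (?s a)) (add_measure \<mu> (?s b))
      \<le> real n * ((1 + m / real n) powr (1/p) * (H' / real n))"
    by (intro mult_left_mono) auto
  also have "\<dots> = H' * (1 + m / real n) powr (1/p)" using n by simp
  finally show ?thesis using \<mu> by (auto simp: m_def)
qed

end

section \<open>The limit for length quasimetrics\<close>

context length_quasimetric
begin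

text \<open>Letting \<open>H\<close> and \<open>H'\<close> decrease to \<open>W\<^sub>1\<close> in the upper bound, both bounds have the limit \<open>W\<^sub>1\<close>.\<close>

theorem minimal_shift_limit:
  fixes lp lm :: "'m measure" and p :: real
  defines "F \<equiv> \<lambda>(n::nat) \<mu>. wasserstein D p
      (add_measure \<mu> (scale_measure (ennreal (1 / real n)) lp))
      (add_measure \<mu> (scale_measure (ennreal (1 / real n)) lm))"
  assumes p: "1 < p" and lp: "finite_borel_measure lp" and lm: "finite_borel_measure lm"
    and eq: "emeasure lp UNIV = emeasure lm UNIV"
  shows "\<forall>n\<ge>1. \<exists>\<mu>. is_arg_min (F n) (\<lambda>\<mu>. \<mu> \<in> borel_prob_measures) \<mu>"
    and "(\<lambda>n. real n * (LEAST c. c \<in> F n ` borel_prob_measures)) \<longlonglongrightarrow> wasserstein D 1 lp lm"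
proof -
  define m where "m = measure lp UNIV"
  define W where "W = wasserstein D 1 lp lm"
  define q where "q n = (LEAST c. c \<in> F n ` borel_prob_measures)" for n
  have m: "0 \<le> m" by (simp add: m_def)
  have W: "0 \<le> W" using wasserstein_min(1)[OF _ lp lm eq, of 1] cost_nonneg by (auto simp: W_def)
  have min: "\<exists>\<mu>\<in>borel_prob_measures. \<forall>\<nu>\<in>borel_prob_measures. F n \<mu> \<le> F n \<nu>" for n
    unfolding F_def using p eq
    by (intro wasserstein_shift_min finite_borel_measure_scale lp lm) auto
  show "\<forall>n\<ge>1. \<exists>\<mu>. is_arg_min (F n) (\<lambda>\<mu>. \<mu> \<in> borel_prob_measures) \<mu>"
  proof (intro allI impI)
    fix n :: nat
    obtain \<mu> where "\<mu> \<in> borel_prob_measures" "\<And>\<nu>. \<nu> \<in> borel_prob_measures \<Longrightarrow> F n \<mu> \<le> F n \<nu>"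
      using min[of n] by blast
    then show "\<exists>\<mu>. is_arg_min (F n) (\<lambda>\<mu>. \<mu> \<in> borel_prob_measures) \<mu>"
      by (intro exI[of _ \<mu>]) (auto simp: is_arg_min_def not_less)
  qed
  have q: "\<exists>\<mu>\<in>borel_prob_measures. q n = F n \<mu>" "\<nu> \<in> borel_prob_measures \<Longrightarrow> q n \<le> F n \<nu>" for n \<nu>
  proof -
    obtain \<mu> where \<mu>: "\<mu> \<in> borel_prob_measures" "\<And>\<nu>. \<nu> \<in> borel_prob_measures \<Longrightarrow> F n \<mu> \<le> F n \<nu>"
      using min[of n] by blast
    have "q n = F n \<mu>" unfolding q_def using \<mu> by (intro Least_equality) auto
    then show "\<exists>\<mu>\<in>borel_prob_measures. q n = F n \<mu>" "\<nu> \<in> borel_prob_measures \<Longrightarrow> q n \<le> F n \<nu>"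
      using \<mu> by auto
  qed
  define e where "e n = 1 + m / real n" for n
  have e: "e \<longlonglongrightarrow> 1"
    unfolding e_def using tendsto_add[OF tendsto_const[of 1] lim_const_over_n[of m]] by simp
  have ep: "0 < e n" for n using m by (simp add: e_def add_pos_nonneg)
  have epowr: "(\<lambda>n. e n powr s) \<longlonglongrightarrow> 1" for s
    using tendsto_powr[OF e tendsto_const[of s]] by simp
  have lower: "W / e n powr (1 - 1/p) \<le> real n * q n" if n: "n \<ge> 1" for n
  proof -
    obtain \<mu> where \<mu>: "\<mu> \<in> borel_prob_measures" "q n = F n \<mu>" using q(1) by blast
    have "W \<le> e n powr (1 - 1/p) * (real n * q n)"
      using wasserstein_shift_lower_bound[OF _ n lp lm eq \<mu>(1), of p] p \<mu>(2)
      by (simp add: W_def e_def m_def F_def)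
    then show ?thesis using ep[of n] by (simp add: divide_le_eq mult.commute)
  qed
  have upper: "real n * q n \<le> H' * e n powr (1/p)"
    if n: "n \<ge> 1" and H: "W < H" "H < H'" and small: "W / H + 2 * m / real n < 1" for n H H'
  proof -
    obtain \<mu> where \<mu>: "\<mu> \<in> borel_prob_measures" "real n * F n \<mu> \<le> H' * e n powr (1/p)"
      using wasserstein_shift_upper_bound[OF _ n lp lm eq, where H=H and H'=H' and p=p] p H small
      by (auto simp: W_def e_def m_def F_def)
    have "real n * q n \<le> real n * F n \<mu>" using q(2)[OF \<mu>(1)] by (intro mult_left_mono) auto
    then show ?thesis using \<mu>(2) by simp
  qed
  have "(\<lambda>n. real n * q n) \<longlonglongrightarrow> W"
  proof (rule order_tendstoI)
    fix c assume c: "c < W"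
    have "(\<lambda>n. W / e n powr (1 - 1/p)) \<longlonglongrightarrow> W / 1"
      by (intro tendsto_divide tendsto_const epowr) simp
    then have "eventually (\<lambda>n. c < W / e n powr (1 - 1/p)) sequentially"
      using c by (simp add: order_tendsto_iff)
    then show "eventually (\<lambda>n. c < real n * q n) sequentially"
      using eventually_ge_at_top[of 1]
      by eventually_elim (use lower in \<open>blast intro: less_le_trans\<close>)
  next
    fix c assume c: "W < c"
    \<comment> \<open>two numbers strictly between \<open>W\<close> and \<open>c\<close>\<close>
    define H H' where "H = W + (c - W) / 3" and "H' = W + 2 * (c - W) / 3"
    have H: "W < H" "H < H'" "H' < c" using c by (auto simp: H_def H'_def field_simps)
    have "(\<lambda>n. W / H + 2 * m / real n) \<longlonglongrightarrow> W / H + 0"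
      by (intro tendsto_add tendsto_const lim_const_over_n)
    moreover have "W / H + 0 < 1" using H W by simp
    ultimately have e1: "eventually (\<lambda>n. W / H + 2 * m / real n < 1) sequentially"
      by (rule order_tendstoD(2))
    have "(\<lambda>n. H' * e n powr (1/p)) \<longlonglongrightarrow> H' * 1"
      by (intro tendsto_mult tendsto_const epowr)
    then have e2: "eventually (\<lambda>n. H' * e n powr (1/p) < c) sequentially"
      using H(3) by (intro order_tendstoD(2)) auto
    show "eventually (\<lambda>n. real n * q n < c) sequentially"
      using e1 e2 eventually_ge_at_top[of 1]
      by eventually_elim (use upper[OF _ H(1,2)] in \<open>blast intro: le_less_trans\<close>)
  qed
  then show "(\<lambda>n. real n * (LEAST c. c \<in> F n ` borel_prob_measures)) \<longlonglongrightarrow> wasserstein D 1 lp lm"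
    by (simp add: q_def W_def)
qed

end

section \<open>The speed of curves\<close>

locale riemannian_atlas =
  fixes A :: "('m::{t2_space, second_countable_topology}, 'e::euclidean_space) chart set"
    and g :: "('m, 'e) chart \<Rightarrow> 'm \<Rightarrow> 'e \<Rightarrow> 'e \<Rightarrow> real"
  assumes atlas: "smooth_atlas A" and metric: "riemannian_metric A g"
begin

lemma chartD:
  assumes "(U, \<phi>) \<in> A"
  shows "open U" "open (\<phi> ` U)" "continuous_on U \<phi>" "continuous_on (\<phi> ` U) (inv_into U \<phi>)"
    "\<And>x. x \<in> U \<Longrightarrow> inv_into U \<phi> (\<phi> x) = x" "\<And>z. z \<in> \<phi> ` U \<Longrightarrow> \<phi> (inv_into U \<phi> z) = z"
    "\<And>z. z \<in> \<phi> ` U \<Longrightarrow> inv_into U \<phi> z \<in> U"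
proof -
  have "is_chart (U, \<phi>)" using assms atlas by (auto simp: smooth_atlas_def)
  then have "open U \<and> open (\<phi> ` U) \<and> homeomorphism U (\<phi> ` U) \<phi> (inv_into U \<phi>)"
    by (simp add: is_chart_def)
  then show "open U" "open (\<phi> ` U)" "continuous_on U \<phi>" "continuous_on (\<phi> ` U) (inv_into U \<phi>)"
    "\<And>x. x \<in> U \<Longrightarrow> inv_into U \<phi> (\<phi> x) = x" "\<And>z. z \<in> \<phi> ` U \<Longrightarrow> \<phi> (inv_into U \<phi> z) = z"
    "\<And>z. z \<in> \<phi> ` U \<Longrightarrow> inv_into U \<phi> z \<in> U"
    by (auto simp: homeomorphism_def inv_into_into)
qed

lemma chart_at: obtains U \<phi> where "(U, \<phi>) \<in> A" "x \<in> U"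
proof -
  have "x \<in> (\<Union>c\<in>A. fst c)" using atlas by (simp add: smooth_atlas_def)
  then show ?thesis using that by force
qed

lemma transition:
  assumes "(U, \<phi>) \<in> A" "(V, \<psi>) \<in> A"
  shows "\<And>x. x \<in> U \<inter> V \<Longrightarrow>
      ((\<psi> \<circ> inv_into U \<phi>) has_derivative frechet_derivative (\<psi> \<circ> inv_into U \<phi>) (at (\<phi> x))) (at (\<phi> x))"
    and "\<And>v. continuous_on (\<phi> ` (U \<inter> V)) (\<lambda>z. frechet_derivative (\<psi> \<circ> inv_into U \<phi>) (at z) v)"
proof -
  have "smooth_on (\<psi> \<circ> inv_into U \<phi>) (\<phi> ` (U \<inter> V))"
    using atlas assms unfolding smooth_atlas_def by fast
  then have "Ck_on (Suc 0) (\<psi> \<circ> inv_into U \<phi>) (\<phi> ` (U \<inter> V))" unfolding smooth_on_def by blast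
  then have *: "\<forall>x\<in>\<phi> ` (U \<inter> V). (\<psi> \<circ> inv_into U \<phi>) differentiable (at x)"
    "\<forall>v. continuous_on (\<phi> ` (U \<inter> V)) (\<lambda>z. frechet_derivative (\<psi> \<circ> inv_into U \<phi>) (at z) v)"
    by simp_all
  show "((\<psi> \<circ> inv_into U \<phi>) has_derivative frechet_derivative (\<psi> \<circ> inv_into U \<phi>) (at (\<phi> x))) (at (\<phi> x))"
    if "x \<in> U \<inter> V" for x
    using *(1) that by (simp add: frechet_derivative_works[symmetric])
  show "continuous_on (\<phi> ` (U \<inter> V)) (\<lambda>z. frechet_derivative (\<psi> \<circ> inv_into U \<phi>) (at z) v)" for v
    using *(2) by blast
qed

lemma metric_bilinear: "(U, \<phi>) \<in> A \<Longrightarrow> x \<in> U \<Longrightarrow> bilinear (g (U, \<phi>) x)"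
  using metric unfolding riemannian_metric_def by fastforce

lemma metric_nonneg:
  assumes "(U, \<phi>) \<in> A" "x \<in> U"
  shows "0 \<le> g (U, \<phi>) x v v"
proof (cases "v = 0")
  case True
  then show ?thesis using bilinear_lzero[OF metric_bilinear[OF assms]] by simp
next
  case False
  then have "0 < g (U, \<phi>) x v v" using metric assms unfolding riemannian_metric_def by fastforce
  then show ?thesis by simp
qed

lemma metric_continuous:
  assumes "(U, \<phi>) \<in> A"
  shows "continuous_on (\<phi> ` U) (\<lambda>z. g (U, \<phi>) (inv_into U \<phi> z) u v)"
proof -
  have "smooth_on (\<lambda>z. g (U, \<phi>) (inv_into U \<phi> z) u v) (\<phi> ` U)"
    using metric assms unfolding riemannian_metric_def by fast
  then have "Ck_on 0 (\<lambda>z. g (U, \<phi>) (inv_into U \<phi> z) u v) (\<phi> ` U)" unfolding smooth_on_def by blast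
  then show ?thesis by simp
qed

lemma metric_transform:
  assumes "(U, \<phi>) \<in> A" "(V, \<psi>) \<in> A" "x \<in> U \<inter> V"
  shows "g (U, \<phi>) x u u = g (V, \<psi>) x (frechet_derivative (\<psi> \<circ> inv_into U \<phi>) (at (\<phi> x)) u)
     (frechet_derivative (\<psi> \<circ> inv_into U \<phi>) (at (\<phi> x)) u)"
proof -
  have "\<forall>(U, \<phi>)\<in>A. \<forall>(V, \<psi>)\<in>A. \<forall>x\<in>U \<inter> V. \<forall>u v.
        let J = frechet_derivative (\<psi> \<circ> inv_into U \<phi>) (at (\<phi> x))
        in g (U, \<phi>) x u v = g (V, \<psi>) x (J u) (J v)"
    using metric unfolding riemannian_metric_def by (elim conjE)
  from bspec[OF this assms(1)] have "\<forall>(V, \<psi>)\<in>A. \<forall>x\<in>U \<inter> V. \<forall>u v.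
        let J = frechet_derivative (\<psi> \<circ> inv_into U \<phi>) (at (\<phi> x))
        in g (U, \<phi>) x u v = g (V, \<psi>) x (J u) (J v)" by simp
  from bspec[OF this assms(2)] show ?thesis using assms(3) by (simp add: Let_def)
qed

lemma metric_expand:
  assumes "(U, \<phi>) \<in> A" "x \<in> U"
  shows "g (U, \<phi>) x u v = (\<Sum>i\<in>Basis. \<Sum>j\<in>Basis. (u \<bullet> i) * (v \<bullet> j) * g (U, \<phi>) x i j)"
proof -
  have bl: "bilinear (g (U, \<phi>) x)" by (rule metric_bilinear[OF assms])
  have l: "linear (\<lambda>w. g (U, \<phi>) x w y)" "linear (g (U, \<phi>) x y)" for y using bl by (auto simp: bilinear_def)
  have "g (U, \<phi>) x u v = g (U, \<phi>) x (\<Sum>i\<in>Basis. (u \<bullet> i) *\<^sub>R i) v" by (simp add: euclidean_representation)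
  also have "\<dots> = (\<Sum>i\<in>Basis. (u \<bullet> i) * g (U, \<phi>) x i v)"
    using linear_sum[OF l(1)[of v], of "\<lambda>i. (u \<bullet> i) *\<^sub>R i" Basis] by (simp add: linear_scale[OF l(1)[of v]])
  also have "\<dots> = (\<Sum>i\<in>Basis. \<Sum>j\<in>Basis. (u \<bullet> i) * (v \<bullet> j) * g (U, \<phi>) x i j)"
  proof (rule sum.cong[OF refl])
    fix i :: 'e
    have "g (U, \<phi>) x i v = g (U, \<phi>) x i (\<Sum>j\<in>Basis. (v \<bullet> j) *\<^sub>R j)" by (simp add: euclidean_representation)
    also have "\<dots> = (\<Sum>j\<in>Basis. (v \<bullet> j) * g (U, \<phi>) x i j)"
      using linear_sum[OF l(2)[of i], of "\<lambda>j. (v \<bullet> j) *\<^sub>R j" Basis] by (simp add: linear_scale[OF l(2)[of i]])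
    finally show "(u \<bullet> i) * g (U, \<phi>) x i v = (\<Sum>j\<in>Basis. (u \<bullet> i) * (v \<bullet> j) * g (U, \<phi>) x i j)"
      by (simp add: sum_distrib_left mult.assoc)
  qed
  finally show ?thesis .
qed

text \<open>By the chain rule the velocity transforms with the derivative of the transition map, under
which the metric is invariant. The statement is about one-sided derivatives too, as these occur
at the end points of the pieces of a curve.\<close>

lemma change_of_chart:
  assumes c: "(U, \<phi>) \<in> A" "(V, \<psi>) \<in> A" and t: "t \<in> S" "\<gamma> t \<in> U \<inter> V"
    and cont: "continuous (at t within S) \<gamma>"
    and d: "((\<phi> \<circ> \<gamma>) has_vector_derivative v) (at t within S)"
  shows "\<exists>w. ((\<psi> \<circ> \<gamma>) has_vector_derivative w) (at t within S) \<and> g (U, \<phi>) (\<gamma> t) v v = g (V, \<psi>) (\<gamma> t) w w"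
proof -
  let ?tr = "\<psi> \<circ> inv_into U \<phi>"
  let ?J = "frechet_derivative ?tr (at (\<phi> (\<gamma> t)))"
  have "(?tr has_derivative ?J) (at ((\<phi> \<circ> \<gamma>) t) within (\<phi> \<circ> \<gamma>) ` S)"
    using transition(1)[OF c t(2)] by (simp add: has_derivative_at_withinI)
  then have dw: "((?tr \<circ> (\<phi> \<circ> \<gamma>)) has_vector_derivative ?J v) (at t within S)"
    by (rule vector_derivative_diff_chain_within[OF d])
  have "open (U \<inter> V)" using chartD(1)[OF c(1)] chartD(1)[OF c(2)] by auto
  then have "eventually (\<lambda>s. \<gamma> s \<in> U \<inter> V) (at t within S)"
    by (rule topological_tendstoD[OF cont[unfolded continuous_within] _ t(2)])
  then have ev: "eventually (\<lambda>s. (?tr \<circ> (\<phi> \<circ> \<gamma>)) s = (\<psi> \<circ> \<gamma>) s) (at t within S)"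
    by eventually_elim (simp add: chartD(5)[OF c(1)])
  have dd: "((\<psi> \<circ> \<gamma>) has_vector_derivative (?J v)) (at t within S)"
    unfolding has_vector_derivative_def
    by (rule has_derivative_transform_eventually[OF dw[unfolded has_vector_derivative_def] ev _ t(1)])
       (use t(2) in \<open>simp add: chartD(5)[OF c(1)]\<close>)
  have gg: "g (U, \<phi>) (\<gamma> t) v v = g (V, \<psi>) (\<gamma> t) (?J v) (?J v)"
    by (rule metric_transform[OF c t(2)])
  show ?thesis
    by (rule exI[where x="?J v"]) (rule conjI[OF dd gg])
qed

lemma curve_speed_chart:
  assumes c: "(U, \<phi>) \<in> A" and t: "\<gamma> t \<in> U" and cont: "isCont \<gamma> t"
    and d: "((\<phi> \<circ> \<gamma>) has_vector_derivative v) (at t)"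
  shows "curve_speed A g \<gamma> t = sqrt (g (U, \<phi>) (\<gamma> t) v v)"
proof -
  define c' where "c' = (SOME c. c \<in> A \<and> \<gamma> t \<in> fst c)"
  have "\<exists>c. c \<in> A \<and> \<gamma> t \<in> fst c" using c t by force
  from someI_ex[OF this] have "c' \<in> A \<and> \<gamma> t \<in> fst c'" unfolding c'_def .
  then obtain V \<psi> where V: "c' = (V, \<psi>)" "(V, \<psi>) \<in> A" "\<gamma> t \<in> V" by (cases c') auto
  obtain w where w: "((\<psi> \<circ> \<gamma>) has_vector_derivative w) (at t)" "g (U, \<phi>) (\<gamma> t) v v = g (V, \<psi>) (\<gamma> t) w w"
    using change_of_chart[OF c V(2), where S=UNIV and t=t and \<gamma>=\<gamma> and v=v] t V(3) cont d by auto
  have "curve_speed A g \<gamma> t = sqrt (g c' (\<gamma> t) (vector_derivative (snd c' \<circ> \<gamma>) (at t)) (vector_derivative (snd c' \<circ> \<gamma>) (at t)))"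
    unfolding curve_speed_def c'_def Let_def by simp
  then show ?thesis using V(1) w vector_derivative_at[OF w(1)] by simp
qed

lemma curve_speed_nonneg: "0 \<le> curve_speed A g \<gamma> t"
proof -
  define c' where "c' = (SOME c. c \<in> A \<and> \<gamma> t \<in> fst c)"
  obtain U \<phi> where c: "(U, \<phi>) \<in> A" "\<gamma> t \<in> U" by (rule chart_at)
  have "\<exists>c. c \<in> A \<and> \<gamma> t \<in> fst c" using c by force
  from someI_ex[OF this] have "c' \<in> A \<and> \<gamma> t \<in> fst c'" unfolding c'_def .
  then obtain V \<psi> where V: "c' = (V, \<psi>)" "(V, \<psi>) \<in> A" "\<gamma> t \<in> V" by (cases c') auto
  show ?thesis
    unfolding curve_speed_def Let_def c'_def[symmetric] V(1) using metric_nonneg[OF V(2,3)] by simp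
qed

lemma curve_speed_cong:
  assumes "open S" "t \<in> S" "\<And>s. s \<in> S \<Longrightarrow> \<gamma> s = \<gamma>' s"
  shows "curve_speed A g \<gamma> t = curve_speed A g \<gamma>' t"
proof -
  have "((f \<circ> \<gamma>) has_vector_derivative v) (at t) \<longleftrightarrow> ((f \<circ> \<gamma>') has_vector_derivative v) (at t)" for f :: "'m \<Rightarrow> 'e" and v
    using has_vector_derivative_transform_within_open[of "f \<circ> \<gamma>" v t S "f \<circ> \<gamma>'"]
      has_vector_derivative_transform_within_open[of "f \<circ> \<gamma>'" v t S "f \<circ> \<gamma>"] assms by auto
  then have "vector_derivative (f \<circ> \<gamma>) (at t) = vector_derivative (f \<circ> \<gamma>') (at t)" for f :: "'m \<Rightarrow> 'e"
    unfolding vector_derivative_def by simp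
  then show ?thesis unfolding curve_speed_def using assms(2,3) by simp
qed

lemma C1_curve_onD:
  assumes "C1_curve_on A \<gamma> a b" "(U, \<phi>) \<in> A"
  shows "\<exists>v. continuous_on {t\<in>{a..b}. \<gamma> t \<in> U} v \<and>
    (\<forall>t. t \<in> {a..b} \<longrightarrow> \<gamma> t \<in> U \<longrightarrow> ((\<phi> \<circ> \<gamma>) has_vector_derivative v t) (at t within {a..b}))"
  using assms unfolding C1_curve_on_def by fast

text \<open>In each chart the speed is a continuous expression in the velocity, and these expressions agree where
charts overlap. At the end points the one-sided velocity provides the continuous extension.\<close>

lemma C1_curve_speed_continuous:
  assumes ab: "a < b" and C1: "C1_curve_on A \<gamma> a b"
  shows "\<exists>s. continuous_on {a..b} s \<and> (\<forall>t\<in>{a<..<b}. curve_speed A g \<gamma> t = s t)"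
proof -
  have cont: "continuous_on {a..b} \<gamma>" using C1 by (simp add: C1_curve_on_def)
  define c where "c t = (SOME c. c \<in> A \<and> \<gamma> t \<in> fst c)" for t
  define vd where "vd t = vector_derivative (snd (c t) \<circ> \<gamma>) (at t within {a..b})" for t
  define s where "s t = sqrt (g (c t) (\<gamma> t) (vd t) (vd t))" for t
  have s_eq: "s t = sqrt (g (U, \<phi>) (\<gamma> t) v v)"
    if U: "(U, \<phi>) \<in> A" "\<gamma> t \<in> U" and t: "t \<in> {a..b}"
      and d: "((\<phi> \<circ> \<gamma>) has_vector_derivative v) (at t within {a..b})" for U \<phi> t v
  proof -
    have "\<exists>c. c \<in> A \<and> \<gamma> t \<in> fst c" using U by force
    from someI_ex[OF this] have "c t \<in> A \<and> \<gamma> t \<in> fst (c t)" unfolding c_def .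
    then obtain V \<psi> where V: "c t = (V, \<psi>)" "(V, \<psi>) \<in> A" "\<gamma> t \<in> V" by (cases "c t") auto
    have ct: "continuous (at t within {a..b}) \<gamma>" using cont t by (simp add: continuous_on_eq_continuous_within)
    obtain w where w: "((\<psi> \<circ> \<gamma>) has_vector_derivative w) (at t within {a..b})"
        "g (U, \<phi>) (\<gamma> t) v v = g (V, \<psi>) (\<gamma> t) w w"
      using change_of_chart[OF U(1) V(2) t _ ct d] U(2) V(3) by auto
    have "vd t = w" unfolding vd_def V(1)
      using vector_derivative_within_closed_interval[OF ab t w(1)] by simp
    then show ?thesis using w(2) V(1) by (simp add: s_def)
  qed
  have "continuous (at t0 within {a..b}) s" if t0: "t0 \<in> {a..b}" for t0
  proof -
    obtain U \<phi> where U: "(U, \<phi>) \<in> A" "\<gamma> t0 \<in> U" by (rule chart_at)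
    define R where "R = {t\<in>{a..b}. \<gamma> t \<in> U}"
    obtain v where v: "continuous_on R v"
      "\<And>t. t \<in> {a..b} \<Longrightarrow> \<gamma> t \<in> U \<Longrightarrow> ((\<phi> \<circ> \<gamma>) has_vector_derivative v t) (at t within {a..b})"
      using C1_curve_onD[OF C1 U(1)] unfolding R_def by (elim exE conjE) blast
    have R: "t \<in> {a..b}" "\<gamma> t \<in> U" if "t \<in> R" for t using that by (auto simp: R_def)
    have c\<phi>: "continuous_on R (\<lambda>t. \<phi> (\<gamma> t))"
      by (rule continuous_on_compose2[OF chartD(3)[OF U(1)] continuous_on_subset[OF cont]]) (auto simp: R_def)
    have "continuous_on R (\<lambda>t. g (U, \<phi>) (inv_into U \<phi> (\<phi> (\<gamma> t))) i j)" for i j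
      by (rule continuous_on_compose2[OF metric_continuous[OF U(1)] c\<phi>]) (auto simp: R_def)
    then have cg: "continuous_on R (\<lambda>t. g (U, \<phi>) (\<gamma> t) i j)" for i j
      by (rule continuous_on_eq) (simp add: chartD(5)[OF U(1)] R)
    have "continuous_on R (\<lambda>t. sqrt (\<Sum>i\<in>Basis. \<Sum>j\<in>Basis. (v t \<bullet> i) * (v t \<bullet> j) * g (U, \<phi>) (\<gamma> t) i j))"
      by (intro continuous_intros v(1) cg)
    then have "continuous_on R s"
    proof (rule continuous_on_eq)
      fix t assume t: "t \<in> R"
      have "s t = sqrt (g (U, \<phi>) (\<gamma> t) (v t) (v t))"
        using R[OF t] by (intro s_eq[OF U(1)] v(2))
      then show "sqrt (\<Sum>i\<in>Basis. \<Sum>j\<in>Basis. (v t \<bullet> i) * (v t \<bullet> j) * g (U, \<phi>) (\<gamma> t) i j) = s t"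
        by (simp only: metric_expand[OF U(1) R(2)[OF t], of "v t" "v t"])
    qed
    moreover have "t0 \<in> R" using t0 U by (simp add: R_def)
    ultimately have 1: "continuous (at t0 within R) s" by (simp add: continuous_on_eq_continuous_within)
    have "openin (top_of_set {a..b}) ({a..b} \<inter> \<gamma> -` U)"
      by (rule continuous_openin_preimage_gen[OF cont chartD(1)[OF U(1)]])
    then obtain O' where O': "open O'" "{a..b} \<inter> \<gamma> -` U = {a..b} \<inter> O'" unfolding openin_open by blast
    have "R = {a..b} \<inter> \<gamma> -` U" by (auto simp: R_def)
    then have R': "R = {a..b} \<inter> O'" using O'(2) by (rule trans)
    have "at t0 within R = at t0 within {a..b}"
    proof (rule at_within_nhd[OF _ O'(1)])
      show "t0 \<in> O'" using \<open>t0 \<in> R\<close> unfolding R' by blast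
      show "R \<inter> O' - {t0} = {a..b} \<inter> O' - {t0}" unfolding R' by blast
    qed
    then show ?thesis using 1 by simp
  qed
  then have "continuous_on {a..b} s" by (simp add: continuous_on_eq_continuous_within)
  moreover have "curve_speed A g \<gamma> t = s t" if t: "t \<in> {a<..<b}" for t
  proof -
    obtain U \<phi> where U: "(U, \<phi>) \<in> A" "\<gamma> t \<in> U" by (rule chart_at)
    obtain v' where vv: "\<And>t. t \<in> {a..b} \<Longrightarrow> \<gamma> t \<in> U \<Longrightarrow> ((\<phi> \<circ> \<gamma>) has_vector_derivative v' t) (at t within {a..b})"
      using C1_curve_onD[OF C1 U(1)] by (elim exE conjE) blast
    have ti: "t \<in> {a..b}" using t by simp
    obtain v where v: "((\<phi> \<circ> \<gamma>) has_vector_derivative v) (at t within {a..b})"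
      by (rule that[OF vv[OF ti U(2)]])
    have at: "at t within {a..b} = at t" using t by (simp add: at_within_Icc_at)
    have "continuous (at t within {a..b}) \<gamma>" using cont ti unfolding continuous_on_eq_continuous_within by blast
    then have ic: "isCont \<gamma> t" unfolding at .
    have "curve_speed A g \<gamma> t = sqrt (g (U, \<phi>) (\<gamma> t) v v)"
      by (rule curve_speed_chart[where \<phi>=\<phi>, OF U ic v[unfolded at]])
    moreover have "s t = sqrt (g (U, \<phi>) (\<gamma> t) v v)" by (rule s_eq[OF U ti v])
    ultimately show ?thesis by simp
  qed
  ultimately show ?thesis by blast
qed

lemma C1_curve_speed_integrable:
  assumes "a < b" "C1_curve_on A \<gamma> a b"
  shows "curve_speed A g \<gamma> integrable_on {a..b}"
proof -
  obtain s where s: "continuous_on {a..b} s" "\<forall>t\<in>{a<..<b}. curve_speed A g \<gamma> t = s t"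
    using C1_curve_speed_continuous[OF assms] by blast
  show ?thesis
    by (rule integrable_spike_finite[of "{a, b}" _ _ s])
       (use s integrable_continuous_real in auto)
qed

lemma C1_curve_on_restrict:
  assumes "C1_curve_on A \<gamma> a b" "a \<le> s" "t \<le> b"
  shows "C1_curve_on A \<gamma> s t"
  unfolding C1_curve_on_def
proof (intro conjI ballI)
  have sub: "{s..t} \<subseteq> {a..b}" using assms by auto
  have "continuous_on {a..b} \<gamma>" using assms(1) by (simp add: C1_curve_on_def)
  then show "continuous_on {s..t} \<gamma>" using sub by (rule continuous_on_subset)
  fix c assume "c \<in> A"
  then obtain U \<phi> where c: "c = (U, \<phi>)" "(U, \<phi>) \<in> A" by (cases c) auto
  obtain v where v: "continuous_on {t\<in>{a..b}. \<gamma> t \<in> U} v"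
    "\<And>t. t \<in> {a..b} \<Longrightarrow> \<gamma> t \<in> U \<Longrightarrow> ((\<phi> \<circ> \<gamma>) has_vector_derivative v t) (at t within {a..b})"
    using C1_curve_onD[OF assms(1) c(2)] by (elim exE conjE) blast
  have "continuous_on {r\<in>{s..t}. \<gamma> r \<in> U} v" by (rule continuous_on_subset[OF v(1)]) (use sub in auto)
  moreover have "((\<phi> \<circ> \<gamma>) has_vector_derivative v r) (at r within {s..t})" if "r \<in> {s..t}" "\<gamma> r \<in> U" for r
    by (rule has_vector_derivative_within_subset[OF v(2) sub]) (use that sub in auto)
  ultimately show "case c of (U, \<phi>) \<Rightarrow> \<exists>v. continuous_on {r\<in>{s..t}. \<gamma> r \<in> U} v \<and>
      (\<forall>r\<in>{s..t}. \<gamma> r \<in> U \<longrightarrow> ((\<phi> \<circ> \<gamma>) has_vector_derivative v r) (at r within {s..t}))"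
    unfolding c by auto
qed

lemma C1_curve_on_cong:
  assumes "C1_curve_on A \<gamma> a b" "\<And>t. t \<in> {a..b} \<Longrightarrow> \<gamma>' t = \<gamma> t"
  shows "C1_curve_on A \<gamma>' a b"
  unfolding C1_curve_on_def
proof (intro conjI ballI)
  have "continuous_on {a..b} \<gamma>" using assms(1) by (simp add: C1_curve_on_def)
  then show "continuous_on {a..b} \<gamma>'" by (rule continuous_on_eq) (simp add: assms(2))
  fix c assume "c \<in> A"
  then obtain U \<phi> where c: "c = (U, \<phi>)" "(U, \<phi>) \<in> A" by (cases c) auto
  obtain v where v: "continuous_on {t\<in>{a..b}. \<gamma> t \<in> U} v"
    "\<And>t. t \<in> {a..b} \<Longrightarrow> \<gamma> t \<in> U \<Longrightarrow> ((\<phi> \<circ> \<gamma>) has_vector_derivative v t) (at t within {a..b})"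
    using C1_curve_onD[OF assms(1) c(2)] by (elim exE conjE) blast
  have "{t\<in>{a..b}. \<gamma>' t \<in> U} = {t\<in>{a..b}. \<gamma> t \<in> U}" using assms(2) by auto
  then have "continuous_on {t\<in>{a..b}. \<gamma>' t \<in> U} v" using v(1) by simp
  moreover have "((\<phi> \<circ> \<gamma>') has_vector_derivative v r) (at r within {a..b})" if "r \<in> {a..b}" "\<gamma>' r \<in> U" for r
    by (rule has_vector_derivative_transform[OF that(1) _ v(2)]) (use that assms(2) in auto)
  ultimately show "case c of (U, \<phi>) \<Rightarrow> \<exists>v. continuous_on {r\<in>{a..b}. \<gamma>' r \<in> U} v \<and>
      (\<forall>r\<in>{a..b}. \<gamma>' r \<in> U \<longrightarrow> ((\<phi> \<circ> \<gamma>') has_vector_derivative v r) (at r within {a..b}))"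
    unfolding c prod.case by blast
qed

lemma C1_curve_on_affine:
  assumes C1: "C1_curve_on A \<gamma> a b" and m: "0 < (m::real)"
  shows "C1_curve_on A (\<lambda>t. \<gamma> (m * t + d)) ((a - d) / m) ((b - d) / m)"
  unfolding C1_curve_on_def
proof (intro conjI ballI)
  let ?I = "{(a - d) / m..(b - d) / m}"
  have im: "m * t + d \<in> {a..b} \<longleftrightarrow> t \<in> ?I" for t
    using m by (auto simp: divide_le_eq le_divide_eq algebra_simps)
  have sub: "(\<lambda>t. m * t + d) ` ?I \<subseteq> {a..b}" using im by blast
  have cont: "continuous_on {a..b} \<gamma>" using C1 by (simp add: C1_curve_on_def)
  have aff: "continuous_on S (\<lambda>t. m * t + d)" for S by (intro continuous_intros)
  show "continuous_on ?I (\<lambda>t. \<gamma> (m * t + d))"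
    by (rule continuous_on_compose2[OF cont aff sub])
  fix c assume "c \<in> A"
  then obtain U \<phi> where c: "c = (U, \<phi>)" "(U, \<phi>) \<in> A" by (cases c) auto
  obtain v where v: "continuous_on {t\<in>{a..b}. \<gamma> t \<in> U} v"
    "\<And>t. t \<in> {a..b} \<Longrightarrow> \<gamma> t \<in> U \<Longrightarrow> ((\<phi> \<circ> \<gamma>) has_vector_derivative v t) (at t within {a..b})"
    using C1_curve_onD[OF C1 c(2)] by (elim exE conjE) blast
  have "continuous_on {r\<in>?I. \<gamma> (m * r + d) \<in> U} (\<lambda>t. m *\<^sub>R v (m * t + d))"
    using im by (intro continuous_intros continuous_on_compose2[OF v(1) aff]) auto
  moreover have "((\<phi> \<circ> (\<lambda>t. \<gamma> (m * t + d))) has_vector_derivative m *\<^sub>R v (m * r + d)) (at r within ?I)"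
    if r: "r \<in> ?I" "\<gamma> (m * r + d) \<in> U" for r
  proof -
    have 1: "((\<lambda>t. m * t + d) has_vector_derivative m) (at r within ?I)"
      by (auto intro!: derivative_eq_intros)
    have "((\<phi> \<circ> \<gamma>) has_vector_derivative v (m * r + d)) (at (m * r + d) within (\<lambda>t. m * t + d) ` ?I)"
      by (rule has_vector_derivative_within_subset[OF v(2) sub]) (use r im in auto)
    from vector_diff_chain_within[OF 1 this] show ?thesis by (simp add: o_def)
  qed
  ultimately show "case c of (U, \<phi>) \<Rightarrow> \<exists>v. continuous_on {r\<in>?I. \<gamma> (m * r + d) \<in> U} v \<and>
      (\<forall>r\<in>?I. \<gamma> (m * r + d) \<in> U \<longrightarrow> ((\<phi> \<circ> (\<lambda>t. \<gamma> (m * t + d))) has_vector_derivative v r) (at r within ?I))"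
    unfolding c by (auto intro!: exI[of _ "\<lambda>t. m *\<^sub>R v (m * t + d)"])
qed

lemma C1_curve_speed_affine:
  assumes C1: "C1_curve_on A \<gamma> a b" and m: "0 < (m::real)" and t: "m * t + d \<in> {a<..<b}"
  shows "curve_speed A g (\<lambda>t. \<gamma> (m * t + d)) t = m * curve_speed A g \<gamma> (m * t + d)"
proof -
  let ?r = "m * t + d"
  have cont: "continuous_on {a..b} \<gamma>" using C1 by (simp add: C1_curve_on_def)
  obtain U \<phi> where U: "(U, \<phi>) \<in> A" "\<gamma> ?r \<in> U" by (rule chart_at)
  obtain v' where vv: "\<And>t. t \<in> {a..b} \<Longrightarrow> \<gamma> t \<in> U \<Longrightarrow> ((\<phi> \<circ> \<gamma>) has_vector_derivative v' t) (at t within {a..b})"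
    using C1_curve_onD[OF C1 U(1)] by (elim exE conjE) blast
  have ti: "?r \<in> {a..b}" using t by simp
  obtain v where v0: "((\<phi> \<circ> \<gamma>) has_vector_derivative v) (at ?r within {a..b})"
    by (rule that[OF vv[OF ti U(2)]])
  have at: "at ?r within {a..b} = at ?r" using t by (simp add: at_within_Icc_at)
  have v: "((\<phi> \<circ> \<gamma>) has_vector_derivative v) (at ?r)" using v0 at by simp
  have "continuous (at ?r within {a..b}) \<gamma>" using cont ti unfolding continuous_on_eq_continuous_within by blast
  then have c: "isCont \<gamma> ?r" unfolding at .
  have 1: "((\<lambda>t. m * t + d) has_vector_derivative m) (at t)" by (auto intro!: derivative_eq_intros)
  have "((\<phi> \<circ> (\<lambda>t. \<gamma> (m * t + d))) has_vector_derivative m *\<^sub>R v) (at t)"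
    using vector_diff_chain_at[OF 1 v] by (simp add: o_def)
  moreover have "isCont (\<lambda>t. \<gamma> (m * t + d)) t"
    by (rule isCont_o2[where f="\<lambda>t. m * t + d" and g=\<gamma>, OF _ c]) (intro continuous_intros)
  ultimately have "curve_speed A g (\<lambda>t. \<gamma> (m * t + d)) t = sqrt (g (U, \<phi>) (\<gamma> ?r) (m *\<^sub>R v) (m *\<^sub>R v))"
    by (intro curve_speed_chart[where \<phi>=\<phi>] U)
  also have "g (U, \<phi>) (\<gamma> ?r) (m *\<^sub>R v) (m *\<^sub>R v) = m^2 * g (U, \<phi>) (\<gamma> ?r) v v"
    using metric_bilinear[OF U] by (simp add: bilinear_lmul bilinear_rmul power2_eq_square)
  also have "sqrt \<dots> = m * sqrt (g (U, \<phi>) (\<gamma> ?r) v v)"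
    using m by (simp add: real_sqrt_mult)
  also have "sqrt (g (U, \<phi>) (\<gamma> ?r) v v) = curve_speed A g \<gamma> ?r"
    by (rule curve_speed_chart[where \<phi>=\<phi> and t="m * t + d", OF U c v, symmetric])
  finally show ?thesis .
qed

end

section \<open>Piecewise continuously differentiable paths\<close>

text \<open>The same curves as in \<^const>\<open>piecewise_C1_curve\<close>, on arbitrary intervals and in a form suited for
induction over the pieces.\<close>

inductive pw_C1 :: "('m::{t2_space, second_countable_topology}, 'e::euclidean_space) chart set \<Rightarrow>
    (real \<Rightarrow> 'm) \<Rightarrow> real \<Rightarrow> real \<Rightarrow> bool" for A \<gamma> where
  single: "a < b \<Longrightarrow> C1_curve_on A \<gamma> a b \<Longrightarrow> pw_C1 A \<gamma> a b"
| append: "pw_C1 A \<gamma> a b \<Longrightarrow> b < c \<Longrightarrow> C1_curve_on A \<gamma> b c \<Longrightarrow> pw_C1 A \<gamma> a c"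

lemma pw_C1_less: "pw_C1 A \<gamma> a b \<Longrightarrow> a < b"
  by (induction rule: pw_C1.induct) auto

lemma pw_C1_trans: "pw_C1 A \<gamma> b c \<Longrightarrow> pw_C1 A \<gamma> a b \<Longrightarrow> pw_C1 A \<gamma> a c"
  by (induction rule: pw_C1.induct) (auto intro: pw_C1.append)

lemma piecewise_C1_curve_iff: "piecewise_C1_curve A \<gamma> \<longleftrightarrow> pw_C1 A \<gamma> 0 1"
proof
  assume "piecewise_C1_curve A \<gamma>"
  then obtain k :: nat and \<tau> where "\<tau> 0 = 0 \<and> \<tau> k = 1 \<and>
      (\<forall>i<k. \<tau> i < \<tau> (Suc i) \<and> C1_curve_on A \<gamma> (\<tau> i) (\<tau> (Suc i)))"
    unfolding piecewise_C1_curve_def by (elim exE)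
  then have \<tau>: "\<tau> 0 = 0" "\<tau> k = 1"
    "\<And>i. i < k \<Longrightarrow> \<tau> i < \<tau> (Suc i)" "\<And>i. i < k \<Longrightarrow> C1_curve_on A \<gamma> (\<tau> i) (\<tau> (Suc i))" by simp_all
  have "pw_C1 A \<gamma> (\<tau> 0) (\<tau> (Suc i))" if "Suc i \<le> k" for i
    using that
  proof (induction i)
    case 0
    then show ?case by (intro pw_C1.single \<tau>(3,4)) simp_all
  next
    case (Suc i)
    then have "pw_C1 A \<gamma> (\<tau> 0) (\<tau> (Suc i))" by simp
    then show ?case by (rule pw_C1.append) (use Suc.prems in \<open>simp_all add: \<tau>(3,4)\<close>)
  qed
  from this[of "k - 1"] show "pw_C1 A \<gamma> 0 1" using \<tau>(1,2) by (cases k) simp_all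
next
  assume pw: "pw_C1 A \<gamma> 0 1"
  have ex: "\<exists>(k::nat) \<tau>. \<tau> 0 = a \<and> \<tau> k = b \<and>
      (\<forall>i<k. \<tau> i < \<tau> (Suc i) \<and> C1_curve_on A \<gamma> (\<tau> i) (\<tau> (Suc i)))" if "pw_C1 A \<gamma> a b" for a b
    using that
  proof (induction rule: pw_C1.induct)
    case (single a b)
    then show ?case by (intro exI[of _ 1] exI[of _ "\<lambda>i. if i = 0 then a else b"]) auto
  next
    case (append a b c)
    then obtain k \<tau> where \<tau>: "\<tau> 0 = a" "\<tau> k = b" 
      "\<forall>i<k::nat. \<tau> i < \<tau> (Suc i) \<and> C1_curve_on A \<gamma> (\<tau> i) (\<tau> (Suc i))" by blast
    have "\<forall>i<Suc k. (\<tau>(Suc k := c)) i < (\<tau>(Suc k := c)) (Suc i) \<and>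
        C1_curve_on A \<gamma> ((\<tau>(Suc k := c)) i) ((\<tau>(Suc k := c)) (Suc i))"
      using \<tau> append.hyps by (auto simp: less_Suc_eq)
    then show ?case using \<tau>(1) by (intro exI[of _ "Suc k"] exI[of _ "\<tau>(Suc k := c)"]) auto
  qed
  from ex[OF pw] show "piecewise_C1_curve A \<gamma>" unfolding piecewise_C1_curve_def .
qed

context riemannian_atlas
begin

lemma pw_C1_cong:
  assumes "pw_C1 A \<gamma> a b" "\<And>t. t \<in> {a..b} \<Longrightarrow> \<gamma>' t = \<gamma> t"
  shows "pw_C1 A \<gamma>' a b"
  using assms
proof (induction rule: pw_C1.induct)
  case (single a b)
  then show ?case using C1_curve_on_cong[of \<gamma> a b \<gamma>'] by (simp add: pw_C1.single)
next
  case (append a b c)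
  have "pw_C1 A \<gamma>' a b" using append.IH append.prems append.hyps(2) by simp
  moreover have "C1_curve_on A \<gamma>' b c"
    by (rule C1_curve_on_cong[OF append.hyps(3)])
       (use append.prems pw_C1_less[OF append.hyps(1)] in simp)
  ultimately show ?case by (rule pw_C1.append[OF _ append.hyps(2)])
qed

lemma pw_C1_integrable: "pw_C1 A \<gamma> a b \<Longrightarrow> curve_speed A g \<gamma> integrable_on {a..b}"
proof (induction rule: pw_C1.induct)
  case (single a b)
  then show ?case by (rule C1_curve_speed_integrable)
next
  case (append a b c)
  show ?case
    by (rule Henstock_Kurzweil_Integration.integrable_combine[OF _ _ append.IH C1_curve_speed_integrable[OF append.hyps(2,3)]])
       (use append.hyps(2) pw_C1_less[OF append.hyps(1)] in auto)
qed

text \<open>Length is invariant under affine reparametrisation. The statement about the integral is proved along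
with the first one because the speeds are related only at the interior points of each piece.\<close>

lemma pw_C1_affine:
  assumes "pw_C1 A \<gamma> a b" and m: "0 < (m::real)"
  shows "pw_C1 A (\<lambda>t. \<gamma> (m * t + d)) ((a - d) / m) ((b - d) / m)
    \<and> (curve_speed A g (\<lambda>t. \<gamma> (m * t + d)) has_integral integral {a..b} (curve_speed A g \<gamma>)) {(a - d) / m..(b - d) / m}"
  using assms(1)
proof (induction rule: pw_C1.induct)
  have C1: "(curve_speed A g (\<lambda>t. \<gamma> (m * t + d)) has_integral integral {a..b} (curve_speed A g \<gamma>)) {(a - d) / m..(b - d) / m}"
    if ab: "a < b" and c: "C1_curve_on A \<gamma> a b" for a b
  proof -
    have "(curve_speed A g \<gamma> has_integral integral {a..b} (curve_speed A g \<gamma>)) (cbox a b)"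
      using C1_curve_speed_integrable[OF ab c] by (simp add: has_integral_integral)
    from has_integral_affinity'[OF this m, of d]
    have "((\<lambda>t. curve_speed A g \<gamma> (m * t + d)) has_integral integral {a..b} (curve_speed A g \<gamma>) / m)
        {(a - d) / m..(b - d) / m}"
      by (simp add: divide_inverse mult.commute)
    from has_integral_mult_right[OF this, of m]
    have "((\<lambda>t. m * curve_speed A g \<gamma> (m * t + d)) has_integral integral {a..b} (curve_speed A g \<gamma>))
        {(a - d) / m..(b - d) / m}"
      using m by simp
    then show ?thesis
    proof (rule has_integral_spike_finite[of "{(a - d) / m, (b - d) / m}", rotated 2])
      fix t assume "t \<in> {(a - d) / m..(b - d) / m} - {(a - d) / m, (b - d) / m}"
      then have "m * t + d \<in> {a<..<b}" using m by (auto simp: field_simps)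
      then show "curve_speed A g (\<lambda>t. \<gamma> (m * t + d)) t = m * curve_speed A g \<gamma> (m * t + d)"
        by (rule C1_curve_speed_affine[OF c m])
    qed simp
  qed
  {
    case (single a b)
    then show ?case using C1 m C1_curve_on_affine[OF single(2) m]
      by (auto intro!: pw_C1.single divide_strict_right_mono)
  next
    case (append a b c)
    have ab: "a < b" by (rule pw_C1_less[OF append(1)])
    have "pw_C1 A (\<lambda>t. \<gamma> (m * t + d)) ((a - d) / m) ((c - d) / m)"
      using append m by (intro pw_C1.append[OF _ _ C1_curve_on_affine[OF append(3) m]])
        (auto intro!: divide_strict_right_mono)
    moreover have "integral {a..b} (curve_speed A g \<gamma>) + integral {b..c} (curve_speed A g \<gamma>) = integral {a..c} (curve_speed A g \<gamma>)"
      using ab append pw_C1_integrable[OF pw_C1.append[OF append(1-3)]] by (intro Henstock_Kurzweil_Integration.integral_combine) auto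
    moreover have "(curve_speed A g (\<lambda>t. \<gamma> (m * t + d)) has_integral
        integral {a..b} (curve_speed A g \<gamma>) + integral {b..c} (curve_speed A g \<gamma>)) {(a - d) / m..(c - d) / m}"
      using append.IH C1[OF append(2,3)] ab append(2) m
      by (intro has_integral_combine[of "(a - d) / m" "(b - d) / m"]) (auto intro!: divide_right_mono)
    ultimately show ?case by simp
  }
qed

text \<open>Arbitrary parameter intervals make it easy to concatenate and to cut curves.\<close>

definition joined :: "'m \<Rightarrow> 'm \<Rightarrow> real \<Rightarrow> bool" where
  "joined x y l \<longleftrightarrow> (\<exists>\<gamma> a b. pw_C1 A \<gamma> a b \<and> \<gamma> a = x \<and> \<gamma> b = y \<and> integral {a..b} (curve_speed A g \<gamma>) = l)"

text \<open>By affine reparametrisation, the parameter interval may be fixed to \<open>[0, 1]\<close>.\<close>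

lemma joined_unit: "joined x y l \<longleftrightarrow> (\<exists>\<gamma>. piecewise_C1_curve A \<gamma> \<and> \<gamma> 0 = x \<and> \<gamma> 1 = y \<and> curve_length A g \<gamma> = l)"
proof
  assume "joined x y l"
  then obtain \<gamma> a b where \<gamma>: "pw_C1 A \<gamma> a b" "\<gamma> a = x" "\<gamma> b = y" "integral {a..b} (curve_speed A g \<gamma>) = l"
    by (auto simp: joined_def)
  have ab: "0 < b - a" using pw_C1_less[OF \<gamma>(1)] by simp
  from pw_C1_affine[OF \<gamma>(1) ab, of a] have "pw_C1 A (\<lambda>t. \<gamma> ((b - a) * t + a)) 0 1"
    "(curve_speed A g (\<lambda>t. \<gamma> ((b - a) * t + a)) has_integral l) {0..1}"
    using ab \<gamma>(4) by simp_all
  then show "\<exists>\<gamma>. piecewise_C1_curve A \<gamma> \<and> \<gamma> 0 = x \<and> \<gamma> 1 = y \<and> curve_length A g \<gamma> = l"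
    using \<gamma>(2,3) by (intro exI[of _ "\<lambda>t. \<gamma> ((b - a) * t + a)"])
      (simp add: piecewise_C1_curve_iff curve_length_def integral_unique)
next
  assume "\<exists>\<gamma>. piecewise_C1_curve A \<gamma> \<and> \<gamma> 0 = x \<and> \<gamma> 1 = y \<and> curve_length A g \<gamma> = l"
  then show "joined x y l" unfolding joined_def piecewise_C1_curve_iff curve_length_def by blast
qed

lemma geodesic_dist_eq: "geodesic_dist A g x y = Inf {l. joined x y l}"
  unfolding geodesic_dist_def joined_unit by (rule arg_cong[of _ _ Inf]) blast

lemma joined_nonneg: "joined x y l \<Longrightarrow> 0 \<le> l"
  unfolding joined_def using curve_speed_nonneg pw_C1_integrable by (auto intro!: integral_nonneg)

text \<open>The second curve is shifted in time so as to start where the first one ends. The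
speed of the concatenation is the speed of its parts except at the junction and the end points.\<close>

lemma joined_trans:
  assumes "joined x y l" "joined y z l'"
  shows "joined x z (l + l')"
proof -
  obtain \<gamma>1 a b where 1: "pw_C1 A \<gamma>1 a b" "\<gamma>1 a = x" "\<gamma>1 b = y" "integral {a..b} (curve_speed A g \<gamma>1) = l"
    using assms(1) by (auto simp: joined_def)
  obtain \<gamma>2' a' b' where old: "pw_C1 A \<gamma>2' a' b'" "\<gamma>2' a' = y" "\<gamma>2' b' = z" "integral {a'..b'} (curve_speed A g \<gamma>2') = l'"
    using assms(2) by (auto simp: joined_def)
  define \<gamma>2 where "\<gamma>2 t = \<gamma>2' (1 * t + (a' - b))" for t
  define c where "c = b' - (a' - b)"
  have 2: "pw_C1 A \<gamma>2 b c" "(curve_speed A g \<gamma>2 has_integral l') {b..c}" "\<gamma>2 b = y" "\<gamma>2 c = z"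
    using pw_C1_affine[OF old(1), of 1 "a' - b"] old by (simp_all add: \<gamma>2_def[abs_def] c_def)
  have abc: "a < b" "b < c" using pw_C1_less[OF 1(1)] pw_C1_less[OF 2(1)] by auto
  define \<gamma> where "\<gamma> t = (if t \<le> b then \<gamma>1 t else \<gamma>2 t)" for t
  have "pw_C1 A \<gamma> a b" by (rule pw_C1_cong[OF 1(1)]) (simp add: \<gamma>_def)
  moreover have "pw_C1 A \<gamma> b c"
    by (rule pw_C1_cong[OF 2(1)]) (use 1(3) 2(3) in \<open>auto simp: \<gamma>_def\<close>)
  ultimately have pw: "pw_C1 A \<gamma> a c" using pw_C1_trans by blast
  have "(curve_speed A g \<gamma>1 has_integral l) {a..b}"
    using pw_C1_integrable[OF 1(1)] 1(4) by (simp add: has_integral_iff)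
  then have "(curve_speed A g \<gamma> has_integral l) {a..b}"
  proof (rule has_integral_spike_finite[of "{a, b}", rotated 2])
    fix t assume "t \<in> {a..b} - {a, b}"
    then show "curve_speed A g \<gamma> t = curve_speed A g \<gamma>1 t"
      by (intro curve_speed_cong[of "{..<b}"]) (auto simp: \<gamma>_def)
  qed simp
  moreover have "(curve_speed A g \<gamma> has_integral l') {b..c}"
    using 2(2)
  proof (rule has_integral_spike_finite[of "{b, c}", rotated 2])
    fix t assume "t \<in> {b..c} - {b, c}"
    then show "curve_speed A g \<gamma> t = curve_speed A g \<gamma>2 t"
      by (intro curve_speed_cong[of "{b<..}"]) (auto simp: \<gamma>_def)
  qed simp
  ultimately have "(curve_speed A g \<gamma> has_integral (l + l')) {a..c}"
    using abc by (intro has_integral_combine[of a b]) auto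
  then show ?thesis unfolding joined_def
    using pw abc 1(2) 2(4) by (intro exI[of _ \<gamma>] exI[of _ a] exI[of _ c]) (auto simp: \<gamma>_def integral_unique)
qed

text \<open>In a chart around \<open>x0\<close>, straight segments serve as curves. The metric coefficients are bounded on a
compact coordinate ball, so the length of a segment is at most a constant times its Euclidean length.\<close>

lemma joined_locally:
  assumes "0 < \<epsilon>"
  shows "\<exists>W. open W \<and> x0 \<in> W \<and> (\<forall>x\<in>W. \<forall>y\<in>W. \<exists>l<\<epsilon>. joined x y l)"
proof -
  obtain U \<phi> where U: "(U, \<phi>) \<in> A" "x0 \<in> U" by (rule chart_at)
  note C = chartD[OF U(1)]
  define inv where "inv = inv_into U \<phi>"
  have inv: "\<And>x. x \<in> U \<Longrightarrow> inv (\<phi> x) = x" "\<And>z. z \<in> \<phi> ` U \<Longrightarrow> \<phi> (inv z) = z"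
    "\<And>z. z \<in> \<phi> ` U \<Longrightarrow> inv z \<in> U" "continuous_on (\<phi> ` U) inv"
    using C(4-7) by (auto simp: inv_def)
  obtain r where r: "r > 0" "cball (\<phi> x0) r \<subseteq> \<phi> ` U"
    using C(2) U(2) by (meson open_contains_cball imageI)
  define G where "G z = (\<Sum>i\<in>Basis. \<Sum>j\<in>Basis. \<bar>g (U, \<phi>) (inv z) i j\<bar>)" for z
  have "continuous_on (cball (\<phi> x0) r) G"
    unfolding G_def inv_def
    by (intro continuous_intros continuous_on_subset[OF metric_continuous[OF U(1)] r(2)])
  then have "bounded (G ` cball (\<phi> x0) r)"
    by (intro compact_imp_bounded compact_continuous_image compact_cball)
  then obtain B where B: "B > 0" "\<forall>y\<in>G ` cball (\<phi> x0) r. norm y \<le> B"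
    unfolding bounded_pos by blast
  have GB: "G z \<le> B" if "z \<in> cball (\<phi> x0) r" for z using B(2) that by force
  have quad: "g (U, \<phi>) (inv z) w w \<le> B * (norm w)^2" if z: "z \<in> cball (\<phi> x0) r" for z w
  proof -
    have zU: "inv z \<in> U" using z r(2) inv(3) by blast
    have "g (U, \<phi>) (inv z) w w = (\<Sum>i\<in>Basis. \<Sum>j\<in>Basis. (w \<bullet> i) * (w \<bullet> j) * g (U, \<phi>) (inv z) i j)"
      by (rule metric_expand[OF U(1) zU])
    also have "\<dots> \<le> (\<Sum>i\<in>Basis. \<Sum>j\<in>Basis. (norm w)^2 * \<bar>g (U, \<phi>) (inv z) i j\<bar>)"
    proof (intro sum_mono)
      fix i j :: 'e assume ij: "i \<in> Basis" "j \<in> Basis"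
      have "(w \<bullet> i) * (w \<bullet> j) * g (U, \<phi>) (inv z) i j \<le> \<bar>w \<bullet> i\<bar> * \<bar>w \<bullet> j\<bar> * \<bar>g (U, \<phi>) (inv z) i j\<bar>"
        by (metis abs_ge_self abs_mult)
      also have "\<dots> \<le> (norm w * norm w) * \<bar>g (U, \<phi>) (inv z) i j\<bar>"
        using ij by (intro mult_right_mono mult_mono Basis_le_norm) auto
      finally show "(w \<bullet> i) * (w \<bullet> j) * g (U, \<phi>) (inv z) i j \<le> (norm w)^2 * \<bar>g (U, \<phi>) (inv z) i j\<bar>"
        by (simp add: power2_eq_square)
    qed
    also have "\<dots> = (norm w)^2 * G z" by (simp add: G_def sum_distrib_left)
    also have "\<dots> \<le> (norm w)^2 * B" using GB[OF z] by (intro mult_left_mono) auto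
    finally show ?thesis by (simp add: mult.commute)
  qed
  \<comment> \<open>Segments in the coordinate ball of radius \<open>\<rho>\<close> are shorter than \<open>2 * \<rho>\<close> and have speed at most \<open>sqrt B\<close> times that.\<close>
  define \<rho> where "\<rho> = min r (\<epsilon> / (4 * sqrt B))"
  have \<rho>: "\<rho> > 0" "\<rho> \<le> r" "sqrt B * (2 * \<rho>) < \<epsilon>"
  proof -
    show "\<rho> > 0" "\<rho> \<le> r" using r(1) B(1) assms by (auto simp: \<rho>_def)
    have "sqrt B * (2 * \<rho>) \<le> sqrt B * (2 * (\<epsilon> / (4 * sqrt B)))"
      using B(1) by (intro mult_left_mono) (auto simp: \<rho>_def)
    also have "\<dots> = \<epsilon> / 2" using B(1) by (simp add: field_simps)
    finally show "sqrt B * (2 * \<rho>) < \<epsilon>" using assms by simp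
  qed
  define W where "W = U \<inter> \<phi> -` ball (\<phi> x0) \<rho>"
  have oW: "open W" unfolding W_def by (rule continuous_open_preimage[OF C(3,1)]) simp
  have x0W: "x0 \<in> W" using U(2) \<rho>(1) by (simp add: W_def)
  have "\<exists>l<\<epsilon>. joined x y l" if xy: "x \<in> W" "y \<in> W" for x y
  proof -
    define w where "w = \<phi> y - \<phi> x"
    define L where "L t = \<phi> x + t *\<^sub>R w" for t
    define \<gamma> where "\<gamma> t = inv (L t)" for t
    have xU: "x \<in> U" "y \<in> U" and xb: "\<phi> x \<in> ball (\<phi> x0) \<rho>" "\<phi> y \<in> ball (\<phi> x0) \<rho>"
      using xy by (auto simp: W_def)
    have Lb: "L t \<in> ball (\<phi> x0) \<rho>" if "t \<in> {0..1}" for t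
    proof -
      have "(1 - t) *\<^sub>R \<phi> x + t *\<^sub>R \<phi> y \<in> ball (\<phi> x0) \<rho>"
        using convexD_alt[OF convex_ball xb, of t] that by simp
      then show ?thesis by (simp add: L_def w_def algebra_simps)
    qed
    have LU: "L t \<in> \<phi> ` U" and Lc: "L t \<in> cball (\<phi> x0) r" if "t \<in> {0..1}" for t
    proof -
      show "L t \<in> cball (\<phi> x0) r" using Lb[OF that] \<rho>(2) by (simp add: less_imp_le)
      then show "L t \<in> \<phi> ` U" using r(2) by blast
    qed
    have \<gamma>U: "\<gamma> t \<in> U" and \<phi>\<gamma>: "\<phi> (\<gamma> t) = L t" if "t \<in> {0..1}" for t
      using inv(2,3) LU[OF that] by (auto simp: \<gamma>_def)
    have Lcont: "continuous_on S L" for S unfolding L_def by (intro continuous_intros)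
    have Ld: "(L has_vector_derivative w) (at t within S)" for t S
      unfolding L_def by (auto intro!: derivative_eq_intros)
    have \<gamma>cont: "continuous_on {0..1} \<gamma>"
      unfolding \<gamma>_def by (rule continuous_on_compose2[OF inv(4) Lcont]) (use LU in auto)
    have C1: "C1_curve_on A \<gamma> 0 1"
      unfolding C1_curve_on_def
    proof (intro conjI ballI \<gamma>cont)
      fix c assume "c \<in> A"
      then obtain V \<psi> where c: "c = (V, \<psi>)" "(V, \<psi>) \<in> A" by (cases c) auto
      define v where "v t = frechet_derivative (\<psi> \<circ> inv) (at (L t)) w" for t
      have LUV: "L t \<in> \<phi> ` (U \<inter> V)" if "t \<in> {0..1}" "\<gamma> t \<in> V" for t
        using \<phi>\<gamma>[OF that(1)] \<gamma>U[OF that(1)] that(2) by (metis IntI imageI)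
      have "continuous_on {t\<in>{0..1}. \<gamma> t \<in> V} v"
        unfolding v_def inv_def
        by (rule continuous_on_compose2[OF transition(2)[OF U(1) c(2)] Lcont]) (use LUV in auto)
      moreover have "((\<psi> \<circ> \<gamma>) has_vector_derivative v t) (at t within {0..1})"
        if t: "t \<in> {0..1}" "\<gamma> t \<in> V" for t
      proof -
        have "((\<psi> \<circ> inv) has_derivative frechet_derivative (\<psi> \<circ> inv) (at (L t))) (at (L t))"
          using transition(1)[OF U(1) c(2), of "\<gamma> t"] \<gamma>U[OF t(1)] t(2) \<phi>\<gamma>[OF t(1)] by (simp add: inv_def)
        then have "((\<psi> \<circ> inv) has_derivative frechet_derivative (\<psi> \<circ> inv) (at (L t))) (at (L t) within L ` {0..1})"
          by (rule has_derivative_at_withinI)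
        from vector_derivative_diff_chain_within[OF Ld this]
        show ?thesis by (simp add: v_def \<gamma>_def o_def)
      qed
      ultimately show "case c of (U, \<phi>) \<Rightarrow> \<exists>v. continuous_on {t\<in>{0..1}. \<gamma> t \<in> U} v \<and>
          (\<forall>t\<in>{0..1}. \<gamma> t \<in> U \<longrightarrow> ((\<phi> \<circ> \<gamma>) has_vector_derivative v t) (at t within {0..1}))"
        unfolding c prod.case by blast
    qed
    have pw: "pw_C1 A \<gamma> 0 1" using C1 by (intro pw_C1.single) auto
    have sp: "curve_speed A g \<gamma> t \<le> sqrt B * (2 * \<rho>)" if t: "t \<in> {0<..<1}" for t
    proof -
      have t1: "t \<in> {0..1}" using t by simp
      have "((\<phi> \<circ> \<gamma>) has_vector_derivative w) (at t)"
        by (rule has_vector_derivative_transform_within_open[OF Ld, of "{0<..<1}"])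
           (use t \<phi>\<gamma> in auto)
      moreover have "isCont \<gamma> t"
        using continuous_on_interior[OF \<gamma>cont, of t] t by simp
      ultimately have "curve_speed A g \<gamma> t = sqrt (g (U, \<phi>) (\<gamma> t) w w)"
        by (intro curve_speed_chart[where \<phi>=\<phi>] U(1) \<gamma>U t1)
      also have "\<dots> \<le> sqrt (B * (norm w)^2)"
        using quad[OF Lc[OF t1], of w] by (intro real_sqrt_le_mono) (simp add: \<gamma>_def)
      also have "\<dots> = sqrt B * norm w" by (simp add: real_sqrt_mult)
      also have "\<dots> \<le> sqrt B * (2 * \<rho>)"
      proof -
        have "norm w = dist (\<phi> y) (\<phi> x)" by (simp add: w_def dist_norm)
        also have "\<dots> \<le> dist (\<phi> y) (\<phi> x0) + dist (\<phi> x0) (\<phi> x)" by (rule dist_triangle)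
        also have "\<dots> \<le> 2 * \<rho>" using xb by (simp add: dist_commute)
        finally show ?thesis using B(1) by (intro mult_left_mono) auto
      qed
      finally show ?thesis .
    qed
    have int: "(curve_speed A g \<gamma> has_integral integral {0..1} (curve_speed A g \<gamma>)) {0..1}"
      using pw_C1_integrable[OF pw] by (simp add: has_integral_integral)
    \<comment> \<open>the speed at the end points is arbitrary\<close>
    define s where "s t = (if t \<in> {0<..<1} then curve_speed A g \<gamma> t else 0)" for t
    have "(s has_integral integral {0..1} (curve_speed A g \<gamma>)) {0..1}"
      by (rule has_integral_spike_finite[of "{0, 1}" _ _ "curve_speed A g \<gamma>"]) (use int in \<open>auto simp: s_def\<close>)
    moreover have "((\<lambda>_. sqrt B * (2 * \<rho>)) has_integral (sqrt B * (2 * \<rho>))) {0..1::real}"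
      using has_integral_const_real[of "sqrt B * (2 * \<rho>)" 0 1] by simp
    ultimately have "integral {0..1} (curve_speed A g \<gamma>) \<le> sqrt B * (2 * \<rho>)"
      by (rule has_integral_le) (use sp B(1) \<rho>(1) in \<open>auto simp: s_def\<close>)
    moreover have "\<gamma> 0 = x" "\<gamma> 1 = y" using inv(1) xU by (auto simp: \<gamma>_def L_def w_def)
    ultimately show ?thesis using pw \<rho>(3) unfolding joined_def
      by (intro exI[of _ "integral {0..1} (curve_speed A g \<gamma>)"]) auto
  qed
  then show ?thesis using oW x0W by blast
qed

text \<open>The set of points that can be joined to \<open>x\<close> is open and closed, since nearby points can be joined.\<close>

lemma joined_all:
  assumes "connected (UNIV :: 'm set)"
  shows "\<exists>l. joined x y l"
proof -
  define S where "S = {y. \<exists>l. joined x y l}"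
  have loc: "\<exists>W. open W \<and> z \<in> W \<and> (\<forall>u\<in>W. \<forall>v\<in>W. \<exists>l. joined u v l)" for z
    using joined_locally[of 1 z] by (metis zero_less_one)
  have "open S"
  proof (subst open_subopen, intro ballI)
    fix z assume z: "z \<in> S"
    obtain W where W: "open W" "z \<in> W" "\<forall>u\<in>W. \<forall>v\<in>W. \<exists>l. joined u v l" using loc by blast
    have "W \<subseteq> S"
    proof
      fix u assume "u \<in> W"
      then obtain l' where "joined z u l'" using W by blast
      moreover obtain l where "joined x z l" using z by (auto simp: S_def)
      ultimately show "u \<in> S" using joined_trans unfolding S_def by blast
    qed
    then show "\<exists>T. open T \<and> z \<in> T \<and> T \<subseteq> S" using W by blast
  qed
  moreover have "open (- S)"
  proof (subst open_subopen, intro ballI)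
    fix z assume z: "z \<in> - S"
    obtain W where W: "open W" "z \<in> W" "\<forall>u\<in>W. \<forall>v\<in>W. \<exists>l. joined u v l" using loc by blast
    have "W \<subseteq> - S"
    proof
      fix u assume u: "u \<in> W"
      then obtain l' where l': "joined u z l'" using W by blast
      show "u \<in> - S"
      proof
        assume "u \<in> S"
        then obtain l where "joined x u l" by (auto simp: S_def)
        then have "z \<in> S" using joined_trans[OF _ l'] unfolding S_def by blast
        then show False using z by simp
      qed
    qed
    then show "\<exists>T. open T \<and> z \<in> T \<and> T \<subseteq> - S" using W by blast
  qed
  moreover have "x \<in> S" using loc[of x] unfolding S_def by blast
  ultimately have "S = UNIV"
    using connectedD[OF assms, of S "- S"] by auto
  then show ?thesis unfolding S_def by blast
qed

end

section \<open>The geodesic distance\<close>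

locale connected_riemannian = riemannian_atlas A g
  for A :: "('m::{t2_space, second_countable_topology}, 'e::euclidean_space) chart set"
    and g :: "('m, 'e) chart \<Rightarrow> 'm \<Rightarrow> 'e \<Rightarrow> 'e \<Rightarrow> real" +
  assumes connected: "connected (UNIV :: 'm set)"
begin

abbreviation dist_g ("D") where "D \<equiv> geodesic_dist A g"

lemma joined_bdd: "bdd_below {l. joined x y l}"
  using joined_nonneg by (intro bdd_belowI[of _ 0]) auto

lemma dist_le: "joined x y l \<Longrightarrow> D x y \<le> l"
  unfolding geodesic_dist_eq by (intro cInf_lower joined_bdd) simp

lemma dist_nonneg: "0 \<le> D x y"
  unfolding geodesic_dist_eq using joined_all[OF connected] joined_nonneg by (intro cInf_greatest) auto

lemma dist_less:
  assumes "D x y < c"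
  obtains l where "l < c" "joined x y l"
proof -
  have "{l. joined x y l} \<noteq> {}" using joined_all[OF connected] by simp
  then have "\<exists>l\<in>{l. joined x y l}. l < c"
    using assms unfolding geodesic_dist_eq by (rule cInf_lessD)
  then show ?thesis using that by blast
qed

lemma dist_triangle_g: "D x z \<le> D x y + D y z"
proof (rule field_le_epsilon)
  fix e :: real assume e: "0 < e"
  obtain l where l: "l < D x y + e / 2" "joined x y l" using dist_less[of x y "D x y + e / 2"] e by auto
  obtain l' where l': "l' < D y z + e / 2" "joined y z l'" using dist_less[of y z "D y z + e / 2"] e by auto
  show "D x z \<le> D x y + D y z + e" using dist_le[OF joined_trans[OF l(2) l'(2)]] l(1) l'(1) by linarith
qed

lemma dist_small:
  assumes "0 < \<epsilon>"
  obtains W where "open W" "x0 \<in> W" "\<And>x y. x \<in> W \<Longrightarrow> y \<in> W \<Longrightarrow> D x y < \<epsilon>"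
proof -
  obtain W where "open W" "x0 \<in> W" "\<forall>x\<in>W. \<forall>y\<in>W. \<exists>l<\<epsilon>. joined x y l"
    using joined_locally[OF assms, of x0] by (elim exE conjE)
  then show ?thesis using that dist_le by (meson order.strict_trans1)
qed

lemma dist_self: "D x x = 0"
proof (rule antisym)
  show "D x x \<le> 0"
  proof (rule field_le_epsilon)
    fix e :: real assume "0 < e"
    then show "D x x \<le> 0 + e" using dist_small[of e x] by (metis add_0 less_imp_le)
  qed
qed (rule dist_nonneg)

lemma dist_continuous: "continuous_on UNIV (\<lambda>z. D (fst z) (snd z))"
  unfolding continuous_on_eq_continuous_at[OF open_UNIV]
proof (intro ballI)
  fix z0 :: "'m \<times> 'm"
  obtain x0 y0 where z0: "z0 = (x0, y0)" by (cases z0)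
  show "isCont (\<lambda>z. D (fst z) (snd z)) z0"
    unfolding isCont_def
  proof (rule tendstoI)
    fix e :: real assume e: "0 < e"
    obtain W1 where W1: "open W1" "x0 \<in> W1" "\<And>x y. x \<in> W1 \<Longrightarrow> y \<in> W1 \<Longrightarrow> D x y < e / 2"
      by (rule dist_small[of "e / 2" x0]) (use e in auto)
    obtain W2 where W2: "open W2" "y0 \<in> W2" "\<And>x y. x \<in> W2 \<Longrightarrow> y \<in> W2 \<Longrightarrow> D x y < e / 2"
      by (rule dist_small[of "e / 2" y0]) (use e in auto)
    have "dist (D (fst z) (snd z)) (D (fst z0) (snd z0)) < e" if z: "z \<in> W1 \<times> W2" for z
    proof -
      obtain x y where xy: "z = (x, y)" "x \<in> W1" "y \<in> W2" using z by (cases z) auto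
      have "D x y \<le> D x x0 + D x0 y0 + D y0 y"
        using dist_triangle_g[of x y x0] dist_triangle_g[of x0 y y0] by linarith
      moreover have "D x0 y0 \<le> D x0 x + D x y + D y y0"
        using dist_triangle_g[of x0 y0 x] dist_triangle_g[of x y0 y] by linarith
      ultimately show ?thesis
        using W1(3)[OF xy(2) W1(2)] W1(3)[OF W1(2) xy(2)] W2(3)[OF xy(3) W2(2)] W2(3)[OF W2(2) xy(3)]
        by (simp add: xy(1) z0 dist_real_def abs_less_iff)
    qed
    moreover have "open (W1 \<times> W2)" "z0 \<in> W1 \<times> W2" using W1 W2 by (auto simp: z0 open_Times)
    ultimately show "eventually (\<lambda>z. dist (D (fst z) (snd z)) (D (fst z0) (snd z0)) < e) (at z0)"
      unfolding eventually_at_topological by blast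
  qed
qed

lemma dist_le_C1_length:
  assumes "C1_curve_on A \<gamma> s t" "s \<le> t"
  shows "D (\<gamma> s) (\<gamma> t) \<le> integral {s..t} (curve_speed A g \<gamma>)"
proof (cases "s = t")
  case True
  then show ?thesis by (simp add: dist_self)
next
  case False
  then have "pw_C1 A \<gamma> s t" using assms by (intro pw_C1.single) auto
  then show ?thesis by (intro dist_le) (auto simp: joined_def)
qed

text \<open>On one piece this is the definition of the distance, and pieces are put together by the triangle
inequality.\<close>

lemma dist_le_length:
  assumes "pw_C1 A \<gamma> a b" "a \<le> s" "s \<le> t" "t \<le> b"
  shows "D (\<gamma> s) (\<gamma> t) \<le> integral {s..t} (curve_speed A g \<gamma>)"
  using assms
proof (induction arbitrary: s t rule: pw_C1.induct)
  case (single a b)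
  show ?case by (rule dist_le_C1_length[OF C1_curve_on_restrict[OF single.hyps(2) single.prems(1,3)] single.prems(2)])
next
  case (append a b c)
  consider "t \<le> b" | "b \<le> s" | "s < b" "b < t" by linarith
  then show ?case
  proof cases
    case 1
    then show ?thesis using append by simp
  next
    case 2
    show ?thesis by (rule dist_le_C1_length[OF C1_curve_on_restrict[OF append.hyps(3) 2 append.prems(3)] append.prems(2)])
  next
    case 3
    have "curve_speed A g \<gamma> integrable_on {a..c}"
      by (rule pw_C1_integrable[OF pw_C1.append[OF append.hyps]])
    then have "curve_speed A g \<gamma> integrable_on {s..t}"
      by (rule integrable_on_subinterval) (use append.prems in auto)
    then have "integral {s..b} (curve_speed A g \<gamma>) + integral {b..t} (curve_speed A g \<gamma>)
        = integral {s..t} (curve_speed A g \<gamma>)"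
      using 3 by (intro Henstock_Kurzweil_Integration.integral_combine) auto
    moreover have "D (\<gamma> s) (\<gamma> b) \<le> integral {s..b} (curve_speed A g \<gamma>)"
      using append.IH[of s b] append.prems 3 by simp
    moreover have "D (\<gamma> b) (\<gamma> t) \<le> integral {b..t} (curve_speed A g \<gamma>)"
      using 3 by (intro dist_le_C1_length[OF C1_curve_on_restrict[OF append.hyps(3) order_refl append.prems(3)]]) auto
    ultimately show ?thesis using dist_triangle_g[of "\<gamma> s" "\<gamma> t" "\<gamma> b"] by linarith
  qed
qed

text \<open>The intermediate points divide the curve into \<open>k\<close> parts of equal length; they exist by the intermediate
value theorem for the arc length \<open>L\<close>.\<close>

lemma joined_chain:
  assumes "joined x y l" "0 < l" "0 < (k::nat)"
  shows "\<exists>z. z 0 = x \<and> z k = y \<and> (\<forall>i<k. D (z i) (z (Suc i)) \<le> l / real k)"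
proof -
  obtain \<gamma> a b where \<gamma>: "pw_C1 A \<gamma> a b" "\<gamma> a = x" "\<gamma> b = y" "integral {a..b} (curve_speed A g \<gamma>) = l"
    using assms(1) by (auto simp: joined_def)
  have ab: "a < b" by (rule pw_C1_less[OF \<gamma>(1)])
  have int: "curve_speed A g \<gamma> integrable_on {a..b}" by (rule pw_C1_integrable[OF \<gamma>(1)])
  define L where "L t = integral {a..t} (curve_speed A g \<gamma>)" for t
  have L: "L a = 0" "L b = l" using \<gamma>(4) by (simp_all add: L_def)
  have contL: "continuous_on {a..b} L"
    unfolding L_def by (rule indefinite_integral_continuous_1[OF int])
  have add: "L s + integral {s..t} (curve_speed A g \<gamma>) = L t" if "a \<le> s" "s \<le> t" "t \<le> b" for s t
  proof -
    have "curve_speed A g \<gamma> integrable_on {a..t}"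
      by (rule integrable_on_subinterval[OF int]) (use that in auto)
    then show ?thesis unfolding L_def using that by (intro Henstock_Kurzweil_Integration.integral_combine) auto
  qed
  have mono: "L s \<le> L t" if "a \<le> s" "s \<le> t" "t \<le> b" for s t
  proof -
    have "0 \<le> integral {s..t} (curve_speed A g \<gamma>)"
      by (intro integral_nonneg integrable_on_subinterval[OF int] curve_speed_nonneg) (use that in auto)
    then show ?thesis using add[OF that] by simp
  qed
  have "\<exists>t. a \<le> t \<and> t \<le> b \<and> L t = real i * l / real k" if "i \<le> k" for i
  proof (rule IVT'[OF _ _ less_imp_le[OF ab] contL])
    show "L a \<le> real i * l / real k" using assms by (simp add: L)
    show "real i * l / real k \<le> L b" using assms that by (simp add: L field_simps)
  qed
  then have "\<forall>i. \<exists>t. i \<le> k \<longrightarrow> a \<le> t \<and> t \<le> b \<and> L t = real i * l / real k" by blast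
  from choice[OF this] obtain \<sigma> where \<sigma>: "\<forall>i. i \<le> k \<longrightarrow> a \<le> \<sigma> i \<and> \<sigma> i \<le> b \<and> L (\<sigma> i) = real i * l / real k" ..
  \<comment> \<open>The arc length may be constant near the ends of the interval, so the end points are prescribed.\<close>
  define \<tau> where "\<tau> i = (if i = 0 then a else if i = k then b else \<sigma> i)" for i
  have \<tau>: "a \<le> \<tau> i" "\<tau> i \<le> b" "L (\<tau> i) = real i * l / real k" if "i \<le> k" for i
    using \<sigma>[rule_format, OF that] ab L assms(3) by (auto simp: \<tau>_def)
  have "D (\<gamma> (\<tau> i)) (\<gamma> (\<tau> (Suc i))) \<le> l / real k" if i: "i < k" for i
  proof -
    have i': "i \<le> k" "Suc i \<le> k" using i by auto
    have "L (\<tau> i) < L (\<tau> (Suc i))"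
      using \<tau>(3)[OF i'(1)] \<tau>(3)[OF i'(2)] assms(2,3) by (simp add: divide_strict_right_mono)
    then have le: "\<tau> i \<le> \<tau> (Suc i)"
      using mono[OF \<tau>(1)[OF i'(2)] _ \<tau>(2)[OF i'(1)]] by (meson leI less_imp_le not_less)
    have "D (\<gamma> (\<tau> i)) (\<gamma> (\<tau> (Suc i))) \<le> integral {\<tau> i..\<tau> (Suc i)} (curve_speed A g \<gamma>)"
      by (rule dist_le_length[OF \<gamma>(1) \<tau>(1)[OF i'(1)] le \<tau>(2)[OF i'(2)]])
    also have "\<dots> = L (\<tau> (Suc i)) - L (\<tau> i)"
      using add[OF \<tau>(1)[OF i'(1)] le \<tau>(2)[OF i'(2)]] by simp
    also have "\<dots> = l / real k"
      by (simp add: \<tau>(3)[OF i'(1)] \<tau>(3)[OF i'(2)] add_divide_distrib distrib_right)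
    finally show ?thesis .
  qed
  then show ?thesis using \<gamma>(2,3) assms(3)
    by (intro exI[of _ "\<lambda>i. \<gamma> (\<tau> i)"]) (simp add: \<tau>_def)
qed

text \<open>With \<open>k\<close> close to \<open>D x y / h\<close>, a nearly shortest curve, of length less than \<open>k * h'\<close>, is cut into \<open>k\<close>
parts of equal length.\<close>

lemma dist_chain:
  assumes h: "0 < h" "h < h'"
  shows "\<exists>(k::nat) z. z 0 = x \<and> z k = y \<and> (\<forall>i<k. D (z i) (z (Suc i)) \<le> h') \<and> real k \<le> D x y / h + 1"
proof -
  define k where "k = max 1 (nat \<lceil>D x y / h\<rceil>)"
  have q: "0 \<le> D x y / h" using dist_nonneg h by simp
  have k: "0 < k" "D x y / h \<le> real k" "real k \<le> D x y / h + 1"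
    using q unfolding k_def by linarith+
  have "D x y \<le> real k * h" using k(2) h by (simp add: divide_le_eq)
  also have "\<dots> < real k * h'" using h k(1) by (intro mult_strict_left_mono) auto
  finally obtain l where l: "l < real k * h'" "joined x y l" by (rule dist_less)
  have l0: "0 \<le> l" by (rule joined_nonneg[OF l(2)])
  show ?thesis
  proof (cases "l = 0")
    case True
    then have "D x y \<le> h'" using dist_le[OF l(2)] h by simp
    then show ?thesis using q
      by (intro exI[of _ "1::nat"] exI[of _ "\<lambda>i. if i = 0 then x else y"]) simp
  next
    case False
    then obtain z where z: "z 0 = x" "z k = y" "\<forall>i<k. D (z i) (z (Suc i)) \<le> l / real k"
      using joined_chain[OF l(2) _ k(1)] l0 by auto
    have "l / real k \<le> h'" using l(1) k(1) by (simp add: divide_le_eq mult.commute)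
    then have "\<forall>i<k. D (z i) (z (Suc i)) \<le> h'" using z(3) order_trans by blast
    then show ?thesis using z(1,2) k(3) by blast
  qed
qed

end

lemma length_quasimetric_geodesic_dist:
  assumes "compact_riemannian_manifold A g"
  shows "length_quasimetric (geodesic_dist A g)"
proof -
  interpret connected_riemannian A g
    using assms by unfold_locales (auto simp: compact_riemannian_manifold_def)
  show ?thesis
    using assms dist_nonneg dist_continuous dist_self dist_triangle_g dist_chain
    by unfold_locales (auto simp: compact_riemannian_manifold_def)
qed

theorem corollary3p2:
  fixes A :: "('m::{t2_space, second_countable_topology}, 'e::euclidean_space) chart set"
    and g :: "('m, 'e) chart \<Rightarrow> 'm \<Rightarrow> 'e \<Rightarrow> 'e \<Rightarrow> real"
    and lp lm :: "'m measure"
    and p :: real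
  defines "F \<equiv> \<lambda>(n::nat) \<mu>. wasserstein (geodesic_dist A g) p
      (add_measure \<mu> (scale_measure (ennreal (1 / real n)) lp))
      (add_measure \<mu> (scale_measure (ennreal (1 / real n)) lm))"
  assumes "compact_riemannian_manifold A g"
    and "p > 1"
    and "finite_borel_measure lp" and "finite_borel_measure lm"
    and "emeasure lp UNIV = emeasure lm UNIV"
  shows "(\<forall>n\<ge>1. \<exists>\<mu>. is_arg_min (F n) (\<lambda>\<mu>. \<mu> \<in> borel_prob_measures) \<mu>) \<and>
    (\<lambda>n. real n * (LEAST c. c \<in> F n ` borel_prob_measures))
      \<longlonglongrightarrow> wasserstein (geodesic_dist A g) 1 lp lm"
proof -
  interpret length_quasimetric "geodesic_dist A g"
    by (rule length_quasimetric_geodesic_dist[OF assms(2)])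
  show ?thesis
    unfolding F_def using minimal_shift_limit[OF assms(3-6)] by (rule conjI)
qed

end
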